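(* Let $\Phi$ be a graph parameter with values in $\mathbb{Q}$ such that there is a constant $\tau$ with $\mathrm{ae}_\Phi(G)=0$ for all graphs $G$ with vertex cover number greater than $\tau$. Then $\#\mathrm{IndSub}(\Phi)$ is fixed-parameter tractable, and there is an algorithm that computes $\#\mathrm{IndSub}_{(\Phi,k)}(G)$ in time $O(f(k)\cdot|V(G)|^{\tau+1})$ for some computable function $f$.
   Context: Graphs are finite, simple, undirected; a graph parameter is a computable isomorphism-invariant function on graphs. The vertex cover number of $G$ is the size of a smallest vertex cover. The alternating enumerator is $\mathrm{ae}_\Phi(G)=\sum_{S\subseteq E(G)}\Phi((V(G),S))(-1)^{|S|}$. $\#\mathrm{IndSub}_{(\Phi,k)}(G)=\sum_{A\subseteq V(G),|A|=k}\Phi(G[A])$; $\#\mathrm{IndSub}(\Phi)$ takes $(k,G)$ with parameter $k$. FPT means solvable in time $f(k)|x|^{O(1)}$ for computable $f$. *)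

theory Defs
  imports Complex_Main "HOL-Library.Discrete_Functions"
begin

section \<open>Graphs\<close>

text \<open>
  A graph is a pair of a vertex set and a set of two-element subsets of it. Every finite
  graph has an isomorphic copy with vertices in \<open>nat\<close>, so isomorphism-invariant functions lose
  nothing by this choice of universe.
\<close>

type_synonym graph = "nat set \<times> nat set set"

abbreviation verts :: "graph \<Rightarrow> nat set" where "verts G \<equiv> fst G"

abbreviation edges :: "graph \<Rightarrow> nat set set" where "edges G \<equiv> snd G"

definition simple_graph :: "graph \<Rightarrow> bool" where
  "simple_graph G \<longleftrightarrow> finite (verts G) \<and> edges G \<subseteq> {e. e \<subseteq> verts G \<and> card e = 2}"

definition graph_iso :: "graph \<Rightarrow> graph \<Rightarrow> bool" where
  "graph_iso G H \<longleftrightarrow>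
     (\<exists>h. bij_betw h (verts G) (verts H) \<and> (\<lambda>e. h ` e) ` edges G = edges H)"

definition induced_subgraph :: "graph \<Rightarrow> nat set \<Rightarrow> graph" where
  "induced_subgraph G A = (A, {e \<in> edges G. e \<subseteq> A})"

definition vertex_cover :: "graph \<Rightarrow> nat set \<Rightarrow> bool" where
  "vertex_cover G C \<longleftrightarrow> C \<subseteq> verts G \<and> (\<forall>e\<in>edges G. e \<inter> C \<noteq> {})"

definition vertex_cover_number :: "graph \<Rightarrow> nat" where
  "vertex_cover_number G = Min (card ` {C. vertex_cover G C})"

definition iso_invariant :: "(graph \<Rightarrow> rat) \<Rightarrow> bool" where
  "iso_invariant \<Phi> \<longleftrightarrow>
     (\<forall>G H. simple_graph G \<longrightarrow> simple_graph H \<longrightarrow> graph_iso G H \<longrightarrow> \<Phi> G = \<Phi> H)"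

definition alternating_enumerator :: "(graph \<Rightarrow> rat) \<Rightarrow> graph \<Rightarrow> rat" where
  "alternating_enumerator \<Phi> G = (\<Sum>S\<in>Pow (edges G). \<Phi> (verts G, S) * (-1) ^ card S)"

definition ind_sub :: "(graph \<Rightarrow> rat) \<Rightarrow> nat \<Rightarrow> graph \<Rightarrow> rat" where
  "ind_sub \<Phi> k G = (\<Sum>A\<in>{A. A \<subseteq> verts G \<and> card A = k}. \<Phi> (induced_subgraph G A))"

section \<open>Random access machines\<close>

text \<open>
  The machine model is the RAM with registers holding natural numbers, indirect addressing,
  addition, truncated subtraction and halving, under the uniform cost measure. There is
  deliberately no multiplication, which would make uniform cost unreasonable: here a number
  gains at most one bit per step. The input is a random-access read-only array, so an
  algorithm need not spend time on reading all of it. All registers are initially 0.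
\<close>

datatype instr =
    Const nat nat    \<comment> \<open>\<open>R\<^sub>i := c\<close>\<close>
  | Add nat nat nat  \<comment> \<open>\<open>R\<^sub>i := R\<^sub>j + R\<^sub>l\<close>\<close>
  | Sub nat nat nat  \<comment> \<open>\<open>R\<^sub>i := R\<^sub>j - R\<^sub>l\<close>\<close>
  | Half nat nat     \<comment> \<open>\<open>R\<^sub>i := R\<^sub>j div 2\<close>\<close>
  | Load nat nat     \<comment> \<open>\<open>R\<^sub>i := R\<^bsub>R\<^sub>j\<^esub>\<close>\<close>
  | Store nat nat    \<comment> \<open>\<open>R\<^bsub>R\<^sub>i\<^esub> := R\<^sub>j\<close>\<close>
  | Read nat nat     \<comment> \<open>\<open>R\<^sub>i :=\<close> input cell number \<open>R\<^sub>j\<close>\<close>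
  | Jzero nat nat    \<comment> \<open>if \<open>R\<^sub>i = 0\<close> then continue at program line \<open>l\<close>\<close>

type_synonym config = "nat \<times> (nat \<Rightarrow> nat)"

definition input_cell :: "nat list \<Rightarrow> nat \<Rightarrow> nat" where
  "input_cell x i = (if i < length x then x ! i else 0)"

fun exec_instr :: "nat list \<Rightarrow> instr \<Rightarrow> config \<Rightarrow> config" where
  "exec_instr x (Const i c) (pc, R) = (Suc pc, R(i := c))"
| "exec_instr x (Add i j l) (pc, R) = (Suc pc, R(i := R j + R l))"
| "exec_instr x (Sub i j l) (pc, R) = (Suc pc, R(i := R j - R l))"
| "exec_instr x (Half i j) (pc, R) = (Suc pc, R(i := R j div 2))"
| "exec_instr x (Load i j) (pc, R) = (Suc pc, R(i := R (R j)))"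
| "exec_instr x (Store i j) (pc, R) = (Suc pc, R(R i := R j))"
| "exec_instr x (Read i j) (pc, R) = (Suc pc, R(i := input_cell x (R j)))"
| "exec_instr x (Jzero i l) (pc, R) = (if R i = 0 then l else Suc pc, R)"

text \<open>The machine halts by leaving the program; a halted configuration no longer changes.\<close>

definition ram_step :: "instr list \<Rightarrow> nat list \<Rightarrow> config \<Rightarrow> config" where
  "ram_step P x c = (if fst c < length P then exec_instr x (P ! fst c) c else c)"

definition halts_within :: "instr list \<Rightarrow> nat list \<Rightarrow> nat \<Rightarrow> (nat \<Rightarrow> nat) \<Rightarrow> bool" where
  "halts_within P x t R \<longleftrightarrow>
     (\<exists>pc. (ram_step P x ^^ t) (0, \<lambda>_. 0) = (pc, R) \<and> length P \<le> pc)"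

definition computable_function :: "(nat \<Rightarrow> nat) \<Rightarrow> bool" where
  "computable_function f \<longleftrightarrow> (\<exists>P. \<forall>k. \<exists>t R. halts_within P [k] t R \<and> R 0 = f k)"

text \<open>
  A rational is output as a fraction, not necessarily in lowest terms, whose signed numerator is
  the difference of the first two registers.
\<close>

definition rat_output :: "(nat \<Rightarrow> nat) \<Rightarrow> rat \<Rightarrow> bool" where
  "rat_output R q \<longleftrightarrow> R 2 \<noteq> 0 \<and> q = (of_nat (R 0) - of_nat (R 1)) / of_nat (R 2)"

section \<open>Computational problems on graphs\<close>

text \<open>
  The number of vertices followed by the adjacency matrix in row-major order, with respect to an
  arbitrary enumeration of the vertices.
\<close>

definition graph_code :: "graph \<Rightarrow> nat list \<Rightarrow> bool" where
  "graph_code G x \<longleftrightarrow>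
     (\<exists>vs. distinct vs \<and> set vs = verts G \<and>
           x = length vs # concat (map (\<lambda>u. map (\<lambda>v. of_bool ({u, v} \<in> edges G)) vs) vs))"

definition computable_on_graphs :: "(graph \<Rightarrow> rat) \<Rightarrow> bool" where
  "computable_on_graphs \<Phi> \<longleftrightarrow>
     (\<exists>P. \<forall>G x. simple_graph G \<longrightarrow> graph_code G x \<longrightarrow>
            (\<exists>t R. halts_within P x t R \<and> rat_output R (\<Phi> G)))"

definition graph_parameter :: "(graph \<Rightarrow> rat) \<Rightarrow> bool" where
  "graph_parameter \<Phi> \<longleftrightarrow> iso_invariant \<Phi> \<and> computable_on_graphs \<Phi>"

text \<open>The total number of binary digits of the entries.\<close>

definition input_size :: "nat list \<Rightarrow> nat" where
  "input_size x = (\<Sum>a\<leftarrow>x. Suc (floor_log a))"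

text \<open>
  A parameterized problem with rational answers is given by the relation between its instances and
  their codes, the parameter \<open>\<kappa>\<close> and the answer \<open>F\<close>.
\<close>

definition fixed_parameter_tractable ::
    "('a \<Rightarrow> nat list \<Rightarrow> bool) \<Rightarrow> ('a \<Rightarrow> nat) \<Rightarrow> ('a \<Rightarrow> rat) \<Rightarrow> bool" where
  "fixed_parameter_tractable code \<kappa> F \<longleftrightarrow>
     (\<exists>P f c. computable_function f \<and>
        (\<forall>a x. code a x \<longrightarrow>
           (\<exists>R. halts_within P x (f (\<kappa> a) * input_size x ^ c) R \<and> rat_output R (F a))))"

definition ind_sub_code :: "nat \<times> graph \<Rightarrow> nat list \<Rightarrow> bool" where
  "ind_sub_code = (\<lambda>(k, G) x. simple_graph G \<and> (\<exists>y. graph_code G y \<and> x = k # y))"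

definition ind_sub_fpt :: "(graph \<Rightarrow> rat) \<Rightarrow> bool" where
  "ind_sub_fpt \<Phi> \<longleftrightarrow> fixed_parameter_tractable ind_sub_code fst (\<lambda>(k, G). ind_sub \<Phi> k G)"

end

theory Submission
  imports Defs
begin

text \<open>
  By inclusion-exclusion, \<open>\<Phi> (V, S)\<close> is the sum of \<open>(-1) ^ |T| * ae (V, T)\<close> over \<open>T \<subseteq> S\<close>, and only
  the \<open>T\<close> with a vertex cover of size at most \<open>\<tau>\<close> contribute. Listing such a cover as a tuple \<open>a\<close> of
  length \<open>\<tau>\<close>, whether an injective \<open>k\<close>-tuple \<open>v\<close> maps \<open>T\<close> into \<open>G\<close> and its cover to \<open>a\<close> depends only on
  the types of the \<open>v\<^sub>i\<close> relative to \<open>a\<close>, that is, on which entries of \<open>a\<close> they are adjacent or equal to.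
  Hence \<open>ind_sub \<Phi> k G\<close> is the sum, over all \<open>a\<close>, of a fixed rational combination of the numbers
  of injective tuples with a prescribed word of types, and each of these numbers is a product of \<open>k\<close>
  factors that are read off from the number of vertices of each type, in linear time for each \<open>a\<close>.

  The coefficients of the combination need not be computed from \<open>\<Phi>\<close>. A combination of words of
  length \<open>k\<close> that mention every entry of \<open>a\<close> is additive over the \<open>k\<close>-subsets of vertices, so it is
  correct on all graphs as soon as it is correct on the finitely many graphs with \<open>k\<close> vertices. One can
  therefore enumerate all natural numbers as codes of combinations and test each of them by
  running the given program for \<open>\<Phi>\<close>; the search ends because a correct combination exists. The
  function \<open>f\<close> is the running time of the search plus its result, which is computable by running
  the search with a clock.
\<close>

section \<open>A structured language for the machine\<close>

text \<open>The exponent \<open>\<tau> + 1\<close> has two sources: the tuples, of which there are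
  at most \<open>n ^ \<tau>\<close> for positive \<open>k\<close>, and linear work for each of them.
  On a machine without multiplication the latter is not automatic. Products are formed by repeated
  addition, and this stays cheap because each factor is a number of vertices of some type, hence at
  most \<open>n\<close>. Evaluating a word destroys the counts, so they are recounted before the
  next word; the number of words depends on \<open>k\<close> only.

  Searching for the coefficients keeps alternating enumerators and vertex covers out of the machine
  code: they occur only in the proof that the search ends. The price is an interpreter, as the
  program for \<open>\<Phi>\<close> is arbitrary, expects blank registers and a read-only input, and
  has to be run repeatedly on graphs that the search itself writes down. The same interpreter runs
  the counting program on these graphs, so that the code being tested is the code used afterwards,
  and it provides the clock for \<open>f\<close>.\<close>

text \<open>
  Register 0 serves as a scratch register for the backward jump of \<open>While\<close>. The number in \<open>exec\<close> is the
  exact number of machine steps of the compiled program.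
\<close>

datatype com = Op instr | Seq com com (infixr ";;" 60) | If nat com | While nat com

fun basic :: "instr \<Rightarrow> bool" where
  "basic (Jzero _ _) = False"
| "basic _ = True"

inductive exec :: "nat list \<Rightarrow> com \<Rightarrow> (nat \<Rightarrow> nat) \<Rightarrow> nat \<Rightarrow> (nat \<Rightarrow> nat) \<Rightarrow> bool" for x where
  Op: "basic i \<Longrightarrow> exec x (Op i) R (Suc 0) (snd (exec_instr x i (0, R)))"
| Seq: "exec x a R t R' \<Longrightarrow> exec x b R' t' R'' \<Longrightarrow> exec x (a ;; b) R (t + t') R''"
| IfFalse: "R r = 0 \<Longrightarrow> exec x (If r c) R (Suc 0) R"
| IfTrue: "R r \<noteq> 0 \<Longrightarrow> exec x c R t R' \<Longrightarrow> exec x (If r c) R (Suc t) R'"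
| WhileFalse: "R r = 0 \<Longrightarrow> exec x (While r c) R (Suc 0) R"
| WhileTrue: "R r \<noteq> 0 \<Longrightarrow> exec x c R t R' \<Longrightarrow> exec x (While r c) (R'(0 := 0)) t' R''
    \<Longrightarrow> exec x (While r c) R (t + t' + 3) R''"

inductive_cases exec_OpE: "exec x (Op i) R t R'"
inductive_cases exec_SeqE: "exec x (a ;; b) R t R'"
inductive_cases exec_IfE: "exec x (If r c) R t R'"
inductive_cases exec_WhileE: "exec x (While r c) R t R'"

fun csize :: "com \<Rightarrow> nat" where
  "csize (Op i) = 1"
| "csize (a ;; b) = csize a + csize b"
| "csize (If r c) = csize c + 1"
| "csize (While r c) = csize c + 3"

text \<open>Jump targets are absolute, so \<open>l\<close> is the address at which the code will be
  placed. The machine has no unconditional jump; clearing register 0 turns \<open>Jzero 0 l\<close>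
  into one. Test, clearing and jump are the three extra steps of a round of
  \<open>While\<close>.\<close>

fun compile :: "nat \<Rightarrow> com \<Rightarrow> instr list" where
  "compile l (Op i) = [i]"
| "compile l (a ;; b) = compile l a @ compile (l + csize a) b"
| "compile l (If r c) = Jzero r (l + csize c + 1) # compile (l + 1) c"
| "compile l (While r c) = Jzero r (l + csize c + 3) # compile (l + 1) c @ [Const 0 0, Jzero 0 l]"

lemma length_compile [simp]: "length (compile l c) = csize c"
  by (induction c arbitrary: l) auto

lemma ram_step_at:
  "P = pre @ i # post \<Longrightarrow> ram_step P x (length pre, R) = exec_instr x i (length pre, R)"
  by (simp add: ram_step_def)

lemma exec_instr_basic:
  "basic i \<Longrightarrow> exec_instr x i (pc, R) = (Suc pc, snd (exec_instr x i (0, R)))"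
  by (cases i) auto

lemma funpow_trans: "(f ^^ s) a = b \<Longrightarrow> (f ^^ t) b = c \<Longrightarrow> (f ^^ (s + t)) a = c"
  by (subst add.commute) (simp add: funpow_add)

text \<open>The bound on the intermediate program counters says that the run does not leave the
  program early, so that \<open>t\<close> is the first halting time. The clocked simulation counts
  up to the first halting time, and only thus can its count be compared with
  \<open>t\<close>.\<close>

definition run_below :: "(config \<Rightarrow> config) \<Rightarrow> nat \<Rightarrow> config \<Rightarrow> nat \<Rightarrow> config \<Rightarrow> bool" where
  "run_below f N a t b \<longleftrightarrow> (f ^^ t) a = b \<and> (\<forall>s<t. fst ((f ^^ s) a) < N)"

lemma run_below_1: "f a = b \<Longrightarrow> fst a < N \<Longrightarrow> run_below f N a 1 b"
  by (simp add: run_below_def)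

lemma run_below_trans:
  assumes "run_below f N a s b" "run_below f N' b t c" "N \<le> M" "N' \<le> M"
  shows "run_below f M a (s + t) c"
  unfolding run_below_def
proof (intro conjI allI impI)
  show "(f ^^ (s + t)) a = c" using assms(1,2) funpow_trans unfolding run_below_def by metis
  fix r assume r: "r < s + t"
  show "fst ((f ^^ r) a) < M"
  proof (cases "r < s")
    case True
    then show ?thesis using assms(1,3) by (auto simp: run_below_def)
  next
    case False
    then obtain q where q: "r = s + q" "q < t" using r by (metis add_less_cancel_left le_Suc_ex not_less)
    then have "(f ^^ r) a = (f ^^ q) b" using funpow_trans[of s f a b q] assms(1) by (simp add: run_below_def)
    then show ?thesis using q(2) assms(2,4) by (auto simp: run_below_def)
  qed
qed

text \<open>Each component of a command is compiled into the middle of a larger program; the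
  arbitrary \<open>pre\<close> and \<open>post\<close> give the induction this generality.\<close>

lemma compile_exec:
  assumes "exec x c R t R'" "P = pre @ compile (length pre) c @ post"
  shows "run_below (ram_step P x) (length pre + csize c) (length pre, R) t (length pre + csize c, R')"
  using assms
proof (induction arbitrary: pre post rule: exec.induct)
  case (Op i R)
  then show ?case
    using ram_step_at[of P pre i post x R]
    by (simp add: run_below_def exec_instr_basic[of i x "length pre" R])
next
  case (Seq a R t R' b t' R'')
  have 1: "run_below (ram_step P x) (length pre + csize a) (length pre, R) t (length pre + csize a, R')"
    using Seq.IH(1)[of pre "compile (length pre + csize a) b @ post"] Seq.prems by simp
  have 2: "run_below (ram_step P x) (length pre + csize a + csize b) (length pre + csize a, R') t'
      (length pre + csize a + csize b, R'')"
    using Seq.IH(2)[of "pre @ compile (length pre) a" post] Seq.prems by simp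
  show ?case using run_below_trans[OF 1 2 _ order.refl] by (simp add: add.assoc)
next
  case (IfFalse R r c)
  then show ?case
    using ram_step_at[of P pre "Jzero r (length pre + csize c + 1)" "compile (length pre + 1) c @ post" x R]
    by (simp add: run_below_def)
next
  case (IfTrue R r c t R')
  have 1: "run_below (ram_step P x) (length pre + 1) (length pre, R) 1 (length pre + 1, R)"
    using IfTrue.hyps IfTrue.prems
      ram_step_at[of P pre "Jzero r (length pre + csize c + 1)" "compile (length pre + 1) c @ post" x R]
    by (simp add: run_below_def)
  have 2: "run_below (ram_step P x) (length pre + 1 + csize c) (length pre + 1, R) t (length pre + 1 + csize c, R')"
    using IfTrue.IH[of "pre @ [Jzero r (length pre + csize c + 1)]" post] IfTrue.prems by simp
  show ?case using run_below_trans[OF 1 2 _ order.refl] by (simp add: ac_simps)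
next
  case (WhileFalse R r c)
  then show ?case
    using ram_step_at[of P pre "Jzero r (length pre + csize c + 3)"
        "compile (length pre + 1) c @ [Const 0 0, Jzero 0 (length pre)] @ post" x R]
    by (simp add: run_below_def)
next
  case (WhileTrue R r c t R' t' R'')
  let ?j = "Jzero r (length pre + csize c + 3)" and ?l = "length pre"
  let ?c = "compile (?l + 1) c" and ?N = "?l + csize (While r c)" and ?f = "ram_step P x"
  have P: "P = pre @ ?j # ?c @ [Const 0 0, Jzero 0 ?l] @ post"
    using WhileTrue.prems by simp
  have 1: "run_below ?f ?N (?l, R) 1 (?l + 1, R)"
    using WhileTrue.hyps ram_step_at[OF P] by (intro run_below_1) simp_all
  have 2: "run_below ?f (?l + 1 + csize c) (?l + 1, R) t (?l + 1 + csize c, R')"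
    using WhileTrue.IH(1)[of "pre @ [?j]" "[Const 0 0, Jzero 0 ?l] @ post"] P by simp
  have 3: "run_below ?f ?N (?l + 1 + csize c, R') 1 (?l + 2 + csize c, R'(0 := 0))"
    using ram_step_at[of P "pre @ ?j # ?c" "Const 0 0" "Jzero 0 ?l # post" x R'] P
    by (intro run_below_1) simp_all
  have 4: "run_below ?f ?N (?l + 2 + csize c, R'(0 := 0)) 1 (?l, R'(0 := 0))"
    using ram_step_at[of P "pre @ ?j # ?c @ [Const 0 0]" "Jzero 0 ?l" post x "R'(0 := 0)"] P
    by (intro run_below_1) simp_all
  have 5: "run_below ?f ?N (?l, R'(0 := 0)) t' (?N, R'')"
    using WhileTrue.IH(2) WhileTrue.prems by blast
  have "run_below ?f ?N (?l, R) (1 + (t + (1 + (1 + t')))) (?N, R'')"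
    using run_below_trans[OF 1 run_below_trans[OF 2 run_below_trans[OF 3 run_below_trans[OF 4 5]]],
        of "?l + csize (While r c)" "?l + csize (While r c)" "?l + csize (While r c)" "?l + csize (While r c)"]
    by simp
  moreover have "1 + (t + (1 + (1 + t'))) = t + t' + 3" by simp
  ultimately show ?case by (simp only:)
qed

lemma halts_within_compile:
  "exec x c (\<lambda>_. 0) t R \<Longrightarrow> halts_within (compile 0 c) x t R"
  using compile_exec[of x c "\<lambda>_. 0" t R "compile 0 c" "[]" "[]"]
  by (simp add: halts_within_def run_below_def)

lemma halts_within_mono:
  assumes "halts_within P x t R" "t \<le> t'"
  shows "halts_within P x t' R"
proof -
  obtain pc where 1: "(ram_step P x ^^ t) (0, \<lambda>_. 0) = (pc, R)" and pc: "length P \<le> pc"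
    using assms(1) by (auto simp: halts_within_def)
  have "(ram_step P x ^^ s) (pc, R) = (pc, R)" for s
    using pc by (induction s) (auto simp: ram_step_def)
  then have "(ram_step P x ^^ (t + (t' - t))) (0, \<lambda>_. 0) = (pc, R)"
    using funpow_trans[OF 1] by blast
  then show ?thesis using pc assms(2) by (auto simp: halts_within_def)
qed

fun no_read :: "com \<Rightarrow> bool" where
  "no_read (Op i) = (\<forall>a b. i \<noteq> Read a b)"
| "no_read (a ;; b) = (no_read a \<and> no_read b)"
| "no_read (If r c) = no_read c"
| "no_read (While r c) = no_read c"

text \<open>After \<open>k\<close> has been loaded, the search never looks at the real input. Its
  run on \<open>[k]\<close>, from which the bound \<open>f\<close> is made, is therefore also its
  run on the full instance.\<close>

lemma exec_no_read: "exec x c R t R' \<Longrightarrow> no_read c \<Longrightarrow> exec y c R t R'"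
proof (induction rule: exec.induct)
  case (Op i R)
  then have "exec_instr x i (0, R) = exec_instr y i (0, R)" by (cases i) auto
  then show ?case using exec.Op[OF Op.hyps, of y R] by simp
next
  case (WhileTrue R r c t R' t' R'')
  then show ?case by (metis exec.WhileTrue no_read.simps(4))
qed (auto intro: exec.Seq exec.IfFalse exec.IfTrue exec.WhileFalse)

section \<open>Weakest preconditions with step counts\<close>

definition wp :: "nat list \<Rightarrow> com \<Rightarrow> (nat \<Rightarrow> (nat \<Rightarrow> nat) \<Rightarrow> bool) \<Rightarrow> (nat \<Rightarrow> nat) \<Rightarrow> bool" where
  "wp x c Q R \<longleftrightarrow> (\<exists>t R'. exec x c R t R' \<and> Q t R')"

lemma wp_Op: "basic i \<Longrightarrow> wp x (Op i) Q R = Q (Suc 0) (snd (exec_instr x i (0, R)))"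
  unfolding wp_def by (blast elim: exec_OpE intro: exec.Op)

lemma wp_ops [simp]:
  "wp x (Op (Const i c)) Q R = Q (Suc 0) (R(i := c))"
  "wp x (Op (Add i j l)) Q R = Q (Suc 0) (R(i := R j + R l))"
  "wp x (Op (Sub i j l)) Q R = Q (Suc 0) (R(i := R j - R l))"
  "wp x (Op (Half i j)) Q R = Q (Suc 0) (R(i := R j div 2))"
  "wp x (Op (Load i j)) Q R = Q (Suc 0) (R(i := R (R j)))"
  "wp x (Op (Store i j)) Q R = Q (Suc 0) (R(R i := R j))"
  "wp x (Op (Read i j)) Q R = Q (Suc 0) (R(i := input_cell x (R j)))"
  by (simp_all add: wp_Op)

lemma wp_Seq [simp]: "wp x (a ;; b) Q R = wp x a (\<lambda>t R'. wp x b (\<lambda>t'. Q (t + t')) R') R"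
  unfolding wp_def by (metis exec.Seq exec_SeqE)

lemma wp_If [simp]: "wp x (If r c) Q R = (if R r = 0 then Q (Suc 0) R else wp x c (\<lambda>t. Q (Suc t)) R)"
proof (cases "R r = 0")
  case True
  then show ?thesis unfolding wp_def by (auto elim: exec_IfE intro: exec.IfFalse)
next
  case False
  then show ?thesis unfolding wp_def by (auto elim!: exec_IfE) (use exec.IfTrue in blast)
qed

lemma wp_mono: "wp x c Q R \<Longrightarrow> (\<And>t R'. Q t R' \<Longrightarrow> Q' t R') \<Longrightarrow> wp x c Q' R"
  by (auto simp: wp_def)

lemma wp_WhileFalse: "R r = 0 \<Longrightarrow> Q (Suc 0) R \<Longrightarrow> wp x (While r c) Q R"
  unfolding wp_def using exec.WhileFalse by blast

lemma wp_WhileTrue: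
  assumes "R r \<noteq> 0" "wp x c (\<lambda>t R'. wp x (While r c) (\<lambda>t'. Q (t + t' + 3)) (R'(0 := 0))) R"
  shows "wp x (While r c) Q R"
  using assms unfolding wp_def by (meson exec.WhileTrue)

text \<open>Each of the \<open>n\<close> rounds costs at most \<open>b\<close> steps plus 3 for the
  test and the jump back, and 1 step is left for the failing test. The invariant is required after
  register 0 has been cleared, since the backward jump overwrites it.\<close>

lemma wp_While_timed:
  assumes "I 0 R"
    and "\<And>i R. i < n \<Longrightarrow> I i R \<Longrightarrow> R r \<noteq> 0 \<and> wp x c (\<lambda>t R'. t \<le> b \<and> I (Suc i) (R'(0 := 0))) R"
    and "\<And>R. I n R \<Longrightarrow> R r = 0"
    and "\<And>t R'. I n R' \<Longrightarrow> t \<le> n * (b + 3) + 1 \<Longrightarrow> Q t R'"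
  shows "wp x (While r c) Q R"
proof -
  have "wp x (While r c) (\<lambda>t R'. I n R' \<and> t \<le> m * (b + 3) + 1) R" if "i + m = n" "I i R" for i m R
    using that
  proof (induction m arbitrary: i R)
    case 0
    then show ?case using assms(3) by (intro wp_WhileFalse) auto
  next
    case (Suc m)
    then have i: "i < n" and m: "Suc i + m = n" by auto
    show ?case
    proof (rule wp_WhileTrue)
      show "R r \<noteq> 0" using assms(2)[OF i Suc.prems(2)] by blast
      have "wp x c (\<lambda>t R'. t \<le> b \<and> I (Suc i) (R'(0 := 0))) R"
        using assms(2)[OF i Suc.prems(2)] by blast
      then show "wp x c (\<lambda>t R'. wp x (While r c)
          (\<lambda>t' R''. I n R'' \<and> t + t' + 3 \<le> Suc m * (b + 3) + 1) (R'(0 := 0))) R"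
      proof (rule wp_mono)
        fix t R' assume R': "t \<le> b \<and> I (Suc i) (R'(0 := 0))"
        then have "wp x (While r c) (\<lambda>t R''. I n R'' \<and> t \<le> m * (b + 3) + 1) (R'(0 := 0))"
          using Suc.IH[OF m] by blast
        then show "wp x (While r c) (\<lambda>t' R''. I n R'' \<and> t + t' + 3 \<le> Suc m * (b + 3) + 1) (R'(0 := 0))"
          by (rule wp_mono) (use R' in auto)
      qed
    qed
  qed
  from this[of 0 n, OF _ assms(1)] show ?thesis
    by (rule wp_mono) (use assms(4) in auto)
qed

text \<open>For loops of which only termination matters: the time of the search enters the final
  bound through a clock and is never estimated.\<close>

lemma wp_While_variant:
  assumes "I i R"
    and "\<And>i R. I i R \<Longrightarrow> R r \<noteq> 0 \<Longrightarrow> wp x c (\<lambda>t R'. \<exists>j. I j (R'(0 := 0)) \<and> (j::nat) < i) R"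
    and "\<And>t i R'. I i R' \<Longrightarrow> R' r = 0 \<Longrightarrow> Q t R'"
  shows "wp x (While r c) Q R"
proof -
  have "wp x (While r c) (\<lambda>t R'. \<exists>i. I i R' \<and> R' r = 0) R" if "I i R" for i R
    using that
  proof (induction i arbitrary: R rule: less_induct)
    case (less i)
    show ?case
    proof (cases "R r = 0")
      case True
      then show ?thesis using less.prems by (intro wp_WhileFalse) auto
    next
      case False
      show ?thesis
      proof (rule wp_WhileTrue[where R = R and r = r, OF False], rule wp_mono[OF assms(2)[OF less.prems False]])
        fix t R' assume "\<exists>j. I j (R'(0 := 0)) \<and> j < i"
        then show "wp x (While r c) (\<lambda>t' R''. \<exists>i. I i R'' \<and> R'' r = 0) (R'(0 := 0))"
          using less.IH by blast
      qed
    qed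
  qed
  from this[OF assms(1)] show ?thesis
    by (rule wp_mono) (use assms(3) in auto)
qed

section \<open>Simulation of one program by another\<close>

text \<open>
  The simulated register \<open>i\<close> lives at address \<open>i\<close> plus the content of register 11, and the simulated
  input, of length in register 13 and followed by a 0, starts at the address in register 14. All
  memory from the address in register 12 on is 0, so that a further simulation finds fresh memory
  there. Registers 10, 20 and 21 hold the simulated program counter, the number of program lines left
  and the number of steps done; 15 to 18 and 22 are auxiliary.
\<close>

definition sim_get :: "nat \<Rightarrow> nat \<Rightarrow> com" where
  "sim_get d j = Op (Const 15 j) ;; Op (Add 15 15 11) ;; Op (Load d 15)"

text \<open>Register 15 is moved behind the written cell; its truncated difference to register 12,
  added to register 12, gives the maximum of the two. Thus register 12 keeps bounding the memory in
  use.\<close>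

definition sim_put :: "nat \<Rightarrow> com" where
  "sim_put s = Op (Store 15 s) ;; Op (Const 16 1) ;; Op (Add 15 15 16) ;; Op (Sub 15 15 12) ;;
     Op (Add 12 12 15)"

definition sim_set :: "nat \<Rightarrow> nat \<Rightarrow> com" where
  "sim_set j s = Op (Const 15 j) ;; Op (Add 15 15 11) ;; sim_put s"

fun sim_instr :: "instr \<Rightarrow> com" where
  "sim_instr (Const i c) = Op (Const 17 c) ;; sim_set i 17"
| "sim_instr (Add i j l) = sim_get 17 j ;; sim_get 18 l ;; Op (Add 17 17 18) ;; sim_set i 17"
| "sim_instr (Sub i j l) = sim_get 17 j ;; sim_get 18 l ;; Op (Sub 17 17 18) ;; sim_set i 17"
| "sim_instr (Half i j) = sim_get 17 j ;; Op (Half 17 17) ;; sim_set i 17"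
| "sim_instr (Load i j) = sim_get 17 j ;; Op (Add 17 17 11) ;; Op (Load 17 17) ;; sim_set i 17"
| "sim_instr (Store i j) = sim_get 17 i ;; sim_get 18 j ;; Op (Add 15 17 11) ;; sim_put 18"
| "sim_instr (Read i j) = sim_get 17 j ;; Op (Sub 18 17 13) ;; Op (Sub 17 17 18) ;;
     Op (Add 17 17 14) ;; Op (Load 17 17) ;; sim_set i 17"
| "sim_instr (Jzero i l) = sim_get 17 i ;; Op (Const 18 1) ;; Op (Sub 18 18 17) ;;
     If 18 (Op (Const 10 l))"

text \<open>The interpreter is specialised to the program, with one test per line; two truncated
  differences add up to the distance between \<open>j\<close> and the program counter. The tests
  consult the copy in register 22, since a jump may already have put a later line number into
  register 10, and a second instruction would then be executed in the same step.\<close>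

fun dispatch :: "nat \<Rightarrow> instr list \<Rightarrow> com" where
  "dispatch j [] = Op (Const 16 0)"
| "dispatch j (i # P) = Op (Const 16 j) ;; Op (Sub 17 22 16) ;; Op (Sub 18 16 22) ;;
     Op (Add 17 17 18) ;; Op (Const 18 1) ;; Op (Sub 18 18 17) ;; If 18 (sim_instr i) ;;
     dispatch (Suc j) P"

definition sim_step :: "instr list \<Rightarrow> com" where
  "sim_step P =
     (Op (Const 16 0) ;; Op (Add 22 10 16) ;; Op (Const 16 1) ;; Op (Add 10 10 16) ;;
      Op (Add 21 21 16) ;; dispatch 0 P ;; Op (Const 16 (length P)) ;; Op (Sub 20 16 10))"

abbreviation sim_loop :: "instr list \<Rightarrow> com" where
  "sim_loop P \<equiv> While 20 (sim_step P)"

definition sim :: "instr list \<Rightarrow> com" where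
  "sim P = Op (Const 10 0) ;; Op (Const 21 0) ;; Op (Const 20 (length P)) ;; sim_loop P"

definition sim_state :: "nat list \<Rightarrow> (nat \<Rightarrow> nat) \<Rightarrow> (nat \<Rightarrow> nat) \<Rightarrow> bool" where
  "sim_state x R M \<longleftrightarrow> (\<forall>i. M (M 11 + i) = R i) \<and> (\<forall>a\<ge>M 12. M a = 0) \<and> M 11 \<le> M 12 \<and>
     M 13 = length x \<and> 100 \<le> M 14 \<and> M 14 + length x < M 11 \<and>
     (\<forall>i\<le>length x. M (M 14 + i) = input_cell x i)"

definition sim_regs :: "nat set" where
  "sim_regs = {0, 10, 12, 15, 16, 17, 18, 20, 21, 22}"

definition sim_frame :: "(nat \<Rightarrow> nat) \<Rightarrow> (nat \<Rightarrow> nat) \<Rightarrow> bool" where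
  "sim_frame M M' \<longleftrightarrow> (\<forall>a < M 11. a \<notin> sim_regs \<longrightarrow> M' a = M a)"

lemma sim_regs_mem [simp]:
  "0 \<in> sim_regs" "10 \<in> sim_regs" "12 \<in> sim_regs" "15 \<in> sim_regs" "16 \<in> sim_regs"
  "17 \<in> sim_regs" "18 \<in> sim_regs" "20 \<in> sim_regs" "21 \<in> sim_regs" "22 \<in> sim_regs"
  by (simp_all add: sim_regs_def)

lemma sim_frame_refl: "sim_frame M M"
  by (simp add: sim_frame_def)

lemma sim_frame_trans:
  assumes "sim_frame M M'" "sim_frame M' M''" "100 \<le> M 11"
  shows "sim_frame M M''"
proof -
  have 1: "M' 11 = M 11" using assms(1,3) by (simp add: sim_frame_def sim_regs_def)
  show ?thesis
    unfolding sim_frame_def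
  proof (intro allI impI)
    fix a assume a: "a < M 11" "a \<notin> sim_regs"
    then have "M' a = M a" using assms(1) unfolding sim_frame_def by blast
    moreover have "M'' a = M' a" using a 1 assms(2) unfolding sim_frame_def by simp
    ultimately show "M'' a = M a" by simp
  qed
qed

lemma sim_frame_upd:
  "r \<in> sim_regs \<Longrightarrow> sim_frame M M' \<Longrightarrow> sim_frame M (M'(r := v))"
  unfolding sim_frame_def by (metis fun_upd_other)

lemma sim_frame_upd_left:
  "r \<in> sim_regs \<Longrightarrow> sim_frame (M(r := v)) M' = sim_frame M M'"
proof -
  assume r: "r \<in> sim_regs"
  then have "r \<noteq> 11" by (auto simp: sim_regs_def)
  then show ?thesis using r unfolding sim_frame_def by (metis fun_upd_other)
qed

lemma sim_state_base: "sim_state x R M \<Longrightarrow> 100 \<le> M 11"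
  by (simp add: sim_state_def)

lemma sim_state_upd:
  assumes "r \<in> {0, 10, 15, 16, 17, 18, 20, 21, 22}" "sim_state x R M"
  shows "sim_state x R (M(r := v))"
proof -
  have "r \<noteq> 11" "r \<noteq> 12" "r \<noteq> 13" "r \<noteq> 14" "r < 100" using assms(1) by auto
  then show ?thesis using assms(2) by (auto simp: sim_state_def)
qed

lemma wp_sim_get:
  assumes "sim_state x R M" "d \<noteq> 15"
  shows "wp y (sim_get d j) (\<lambda>_. Q) M = Q (M(15 := M 11 + j, d := R j))"
proof -
  have "M (M 11 + j) = R j" "100 \<le> M 11" using assms(1) by (auto simp: sim_state_def)
  then show ?thesis by (simp add: sim_get_def add.commute[of j])
qed

lemma sim_state_put:
  assumes "sim_state x R M"
  shows "sim_state x (R(j := v)) (M(M 11 + j := v, 12 := max (M 12) (M 11 + j + 1)))"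
proof -
  let ?M = "M(M 11 + j := v, 12 := max (M 12) (M 11 + j + 1))"
  have 1: "\<And>i. M (M 11 + i) = R i" "\<And>a. M 12 \<le> a \<Longrightarrow> M a = 0" "M 11 \<le> M 12" "M 13 = length x"
    "100 \<le> M 14" "M 14 + length x < M 11" "\<And>i. i \<le> length x \<Longrightarrow> M (M 14 + i) = input_cell x i"
    using assms by (simp_all add: sim_state_def)
  then have "100 \<le> M 11" by simp
  then have 2: "?M 11 = M 11" "?M 12 = max (M 12) (M 11 + j + 1)" "?M 13 = M 13" "?M 14 = M 14"
    by simp_all
  show ?thesis
    unfolding sim_state_def 2
  proof (intro conjI allI impI)
    show "?M (M 11 + i) = (R(j := v)) i" for i
      using 1(1) \<open>100 \<le> M 11\<close> by simp
    show "?M a = 0" if "max (M 12) (M 11 + j + 1) \<le> a" for a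
      using that 1(2,3) \<open>100 \<le> M 11\<close> by simp
    show "?M (M 14 + i) = input_cell x i" if "i \<le> length x" for i
      using that 1(5-7) by simp
  qed (use 1 in auto)
qed

lemma wp_sim_put:
  assumes "sim_state x R M" "M 15 = M 11 + j" "s \<in> {17, 18}"
    and "\<And>M'. sim_state x (R(j := M s)) M' \<Longrightarrow> sim_frame M M' \<Longrightarrow> M' 10 = M 10 \<Longrightarrow>
      M' 20 = M 20 \<Longrightarrow> M' 21 = M 21 \<Longrightarrow> M' 22 = M 22 \<Longrightarrow> Q M'"
  shows "wp y (sim_put s) (\<lambda>_. Q) M"
proof -
  define A where "A = M(M 11 + j := M s, 12 := max (M 12) (M 11 + j + 1))"
  have b: "100 \<le> M 11" using assms(1) by (rule sim_state_base)
  have "sim_state x (R(j := M s)) A"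
    unfolding A_def using assms(1) by (rule sim_state_put)
  then have 1: "sim_state x (R(j := M s)) (A(16 := 1, 15 := M 11 + j + 1 - M 12))"
    by (intro sim_state_upd) auto
  have "sim_frame M A" using b by (auto simp: A_def sim_frame_def sim_regs_def)
  then have 2: "sim_frame M (A(16 := 1, 15 := M 11 + j + 1 - M 12))"
    by (intro sim_frame_upd) (auto simp: sim_regs_def)
  have "Q (A(16 := 1, 15 := M 11 + j + 1 - M 12))"
    using b by (intro assms(4) 1 2) (auto simp: A_def)
  moreover have "M(M 11 + j := M s, 16 := 1, 15 := M 11 + j + 1 - M 12, 12 := M 12 + (M 11 + j + 1 - M 12))
      = A(16 := 1, 15 := M 11 + j + 1 - M 12)"
    by (rule ext) (auto simp: A_def)
  ultimately show ?thesis
    using assms(2,3) b by (auto simp: sim_put_def fun_upd_twist)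
qed

lemma wp_sim_set:
  assumes "sim_state x R M" "s \<in> {17, 18}"
    and "\<And>M'. sim_state x (R(j := M s)) M' \<Longrightarrow> sim_frame M M' \<Longrightarrow> M' 10 = M 10 \<Longrightarrow>
      M' 20 = M 20 \<Longrightarrow> M' 21 = M 21 \<Longrightarrow> M' 22 = M 22 \<Longrightarrow> Q M'"
  shows "wp y (sim_set j s) (\<lambda>_. Q) M"
proof -
  have b: "100 \<le> M 11" using assms(1) by (rule sim_state_base)
  have "wp y (sim_put s) (\<lambda>_. Q) (M(15 := M 11 + j))"
  proof (rule wp_sim_put)
    show "sim_state x R (M(15 := M 11 + j))" by (rule sim_state_upd[OF _ assms(1)]) simp
  qed (use assms b in \<open>auto simp: sim_frame_upd_left\<close>)
  then show ?thesis by (simp add: sim_set_def add.commute[of j])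
qed

text \<open>Register 10 has been advanced beforehand, so that only a taken jump has to write to it.
  This is why its value is described under the condition \<open>M 10 = Suc pc\<close>.\<close>

lemma wp_sim_instr:
  assumes "sim_state x R M"
    and "\<And>M'. sim_state x (snd (exec_instr x i (pc, R))) M' \<Longrightarrow> sim_frame M M' \<Longrightarrow>
      (M 10 = Suc pc \<longrightarrow> M' 10 = fst (exec_instr x i (pc, R))) \<Longrightarrow>
      M' 20 = M 20 \<Longrightarrow> M' 21 = M 21 \<Longrightarrow> M' 22 = M 22 \<Longrightarrow> Q M'"
  shows "wp y (sim_instr i) (\<lambda>_. Q) M"
proof -
  have b: "100 \<le> M 11" "M 13 = length x" using assms(1) by (auto simp: sim_state_def)
  have ld: "M (M 11 + i) = R i" "M (i + M 11) = R i" for i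
    using assms(1) by (auto simp: sim_state_def add.commute)
  \<comment> \<open>\<open>i - (i - length x)\<close> is the minimum of the two. The cell behind the
    simulated input holds 0, which is also what \<open>input_cell\<close> returns beyond the
    end.\<close>
  have ld2: "M (i + M 14 - (i - length x)) = input_cell x i" for i
  proof -
    have "M (M 14 + (i - (i - length x))) = input_cell x (i - (i - length x))"
      using assms(1) unfolding sim_state_def by (metis diff_diff_cancel diff_le_self nat_le_linear diff_zero diff_is_0_eq)
    then show ?thesis by (cases "i < length x") (auto simp: input_cell_def add.commute)
  qed
  have b3: "100 \<le> M 14" using assms(1) by (simp add: sim_state_def)
  have ne: "i + M 11 \<noteq> 15" "i + M 11 \<noteq> 17" "i + M 11 \<noteq> 18"
    "i + M 14 - (i - length x) \<noteq> 15" "i + M 14 - (i - length x) \<noteq> 17"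
    "i + M 14 - (i - length x) \<noteq> 18" for i
    using b b3 by auto
  note get = ne wp_sim_get[where x = x and R = R] sim_state_upd assms(1)
  show ?thesis
  proof (cases i)
    case (Const a c)
    show ?thesis
      unfolding Const
      apply (simp add: get)
      apply (rule wp_sim_set[where x = x and R = R])
      apply (simp_all add: sim_state_upd assms(1))
      apply (rule assms(2))
      apply (simp_all add: Const sim_frame_upd_left)
      done
  next
    case (Add a c d)
    show ?thesis
      unfolding Add
      apply (simp add: get)
      apply (rule wp_sim_set[where x = x and R = R])
      apply (simp_all add: sim_state_upd assms(1))
      apply (rule assms(2))
      apply (simp_all add: Add sim_frame_upd_left)
      done
  next
    case (Sub a c d)
    show ?thesis
      unfolding Sub
      apply (simp add: get)
      apply (rule wp_sim_set[where x = x and R = R])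
      apply (simp_all add: sim_state_upd assms(1))
      apply (rule assms(2))
      apply (simp_all add: Sub sim_frame_upd_left)
      done
  next
    case (Half a c)
    show ?thesis
      unfolding Half
      apply (simp add: get)
      apply (rule wp_sim_set[where x = x and R = R])
      apply (simp_all add: sim_state_upd assms(1))
      apply (rule assms(2))
      apply (simp_all add: Half sim_frame_upd_left)
      done
  next
    case (Load a c)
    show ?thesis
      unfolding Load
      apply (simp add: get b ld)
      apply (rule wp_sim_set[where x = x and R = R])
      apply (simp_all add: sim_state_upd assms(1) b ld)
      apply (rule assms(2))
      apply (simp_all add: Load sim_frame_upd_left)
      done
  next
    case (Store a c)
    show ?thesis
      unfolding Store
      apply (simp add: get b)
      apply (rule wp_sim_put[where x = x and R = R and j = "R a"])
      apply (simp_all add: sim_state_upd assms(1) b)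
      apply (rule assms(2))
      apply (simp_all add: Store sim_frame_upd_left)
      done
  next
    case (Read a c)
    show ?thesis
      unfolding Read
      apply (simp add: get b b3 ld2)
      apply (rule wp_sim_set[where x = x and R = R])
      apply (simp_all add: sim_state_upd assms(1) b b3 ld2)
      apply (rule assms(2))
      apply (simp_all add: Read sim_frame_upd_left)
      done
  next
    case (Jzero a l)
    show ?thesis
      unfolding Jzero
      apply (simp add: get)
      apply (intro conjI impI)
       apply (rule assms(2); simp add: Jzero sim_state_upd assms(1) sim_frame_upd sim_frame_refl)
      apply (rule assms(2); simp add: Jzero sim_state_upd assms(1) sim_frame_upd sim_frame_refl)
      done
  qed
qed

lemma wp_dispatch:
  assumes "sim_state x R M" "M 10 = Suc (M 22)" "j \<le> M 22" "M 22 < j + length P"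
    and "\<And>M'. sim_state x (snd (exec_instr x (P ! (M 22 - j)) (M 22, R))) M' \<Longrightarrow> sim_frame M M' \<Longrightarrow>
      M' 10 = fst (exec_instr x (P ! (M 22 - j)) (M 22, R)) \<Longrightarrow> M' 21 = M 21 \<Longrightarrow> Q M'"
  shows "wp y (dispatch j P) (\<lambda>_. Q) M"
proof -
  \<comment> \<open>Once \<open>j\<close> has passed the line number in register 22 no further test
    succeeds, and the rest of the chain changes scratch registers only.\<close>
  have skip: "wp y (dispatch j P) (\<lambda>_. Q) M"
    if "sim_state x R M" "M 22 < j"
      "\<And>M'. sim_state x R M' \<Longrightarrow> sim_frame M M' \<Longrightarrow> M' 10 = M 10 \<Longrightarrow> M' 21 = M 21 \<Longrightarrow> Q M'"
    for j P Q R M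
    using that
  proof (induction P arbitrary: j M Q)
    case Nil
    have "Q (M(16 := 0))"
    proof (rule Nil(3))
      show "sim_state x R (M(16 := 0))" by (intro sim_state_upd Nil(1)) simp
      show "sim_frame M (M(16 := 0))" by (intro sim_frame_upd sim_frame_refl) simp
    qed simp_all
    then show ?case by simp
  next
    case (Cons i P)
    have 0: "Suc 0 \<le> M 22 - j + (j - M 22)" using Cons.prems(2) by simp
    show ?case
      apply (simp add: 0)
      apply (rule Cons.IH)
        apply (intro sim_state_upd Cons.prems; simp)
       apply (use Cons.prems(2) in simp)
      apply (simp only: sim_frame_upd_left sim_regs_mem)
      apply (rule Cons.prems(3))
         apply simp_all
      done
  qed
  show ?thesis
    using assms
  proof (induction P arbitrary: j M Q)
    case Nil
    then show ?case by simp
  next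
    case (Cons i P)
    show ?case
    proof (cases "M 22 = j")
      case True
      show ?thesis
        apply (simp add: True)
        apply (rule wp_sim_instr[where x = x and R = R and pc = j])
         apply (intro sim_state_upd Cons.prems; simp)
        apply (rule skip[where R = "snd (exec_instr x i (j, R))"])
        subgoal by simp
        subgoal using True by simp
        subgoal for M' M''
          apply (rule Cons.prems(5))
             apply (use True in simp)
            apply (rule sim_frame_trans[of _ M'])
              apply (simp add: sim_frame_upd_left)
             apply assumption
            apply (rule sim_state_base[OF Cons.prems(1)])
           apply (use True Cons.prems(2) in simp)
          apply simp
          done
        done
    next
      case False
      then have s: "M 22 - j = Suc (M 22 - Suc j)" "Suc j \<le> M 22" using Cons.prems(3) by auto
      have 0: "Suc 0 \<le> M 22 - j + (j - M 22)" using False by simp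
      show ?thesis
        apply (simp add: 0)
        apply (rule Cons.IH)
            apply (intro sim_state_upd Cons.prems; simp)
           apply (use Cons.prems(2) in simp)
          apply (use s in simp)
         apply (use Cons.prems(4) in simp)
        apply (simp only: sim_frame_upd_left sim_regs_mem)
        apply (rule Cons.prems(5))
           apply (simp_all add: s(1))
        done
    qed
  qed
qed

lemma wp_sim_loop:
  assumes "sim_state x R M" "M 20 = length P - M 10" "(ram_step P x ^^ t) (M 10, R) = (pc', R')"
    "length P \<le> pc'" "\<And>s. s < t \<Longrightarrow> fst ((ram_step P x ^^ s) (M 10, R)) < length P"
    and "\<And>M'. sim_state x R' M' \<Longrightarrow> sim_frame M M' \<Longrightarrow> M' 21 = M 21 + t \<Longrightarrow> Q M'"
  shows "wp y (sim_loop P) (\<lambda>_. Q) M"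
  using assms
proof (induction t arbitrary: M R Q)
  case 0
  then show ?case
    by (intro wp_WhileFalse) (auto intro: sim_frame_refl)
next
  case (Suc t)
  have pc: "M 10 < length P" using Suc.prems(5)[of 0] by simp
  have b: "100 \<le> M 11" using Suc.prems(1) by (rule sim_state_base)
  let ?E = "exec_instr x (P ! M 10) (M 10, R)"
  have st: "ram_step P x (M 10, R) = ?E" using pc by (simp add: ram_step_def)
  have 3: "(ram_step P x ^^ t) (fst ?E, snd ?E) = (pc', R')"
    using Suc.prems(3) by (simp add: funpow_Suc_right st del: funpow.simps)
  have 5: "fst ((ram_step P x ^^ s) (fst ?E, snd ?E)) < length P" if "s < t" for s
    using Suc.prems(5)[of "Suc s"] that by (simp add: funpow_Suc_right st del: funpow.simps)
  show ?case
    apply (rule wp_WhileTrue)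
     apply (use pc Suc.prems(2) in simp)
    apply (subst sim_step_def)
    apply simp
    apply (rule wp_dispatch[where x = x and R = R])
        apply (intro sim_state_upd Suc.prems; simp)
       apply simp
      apply simp
     apply (use pc in simp)
    subgoal for M'
      apply simp
      apply (rule Suc.IH[where R = "snd ?E"])
           apply (intro sim_state_upd; simp)
          apply simp
         apply (use 3 in simp)
        apply (use Suc.prems(4) in simp)
       apply (use 5 in simp)
      apply (rule Suc.prems(6))
        apply assumption
       apply (rule sim_frame_trans[of _ M'])
         apply (simp add: sim_frame_upd_left)
        apply (simp only: sim_frame_upd_left sim_regs_mem)
       apply (rule b)
      apply simp
      done
    done
qed

text \<open>A halted configuration repeats itself, so the given \<open>t\<close> may be too large;
  the simulation stops at the least halting time \<open>s\<close>, which register 21 reports. The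
  real input \<open>y\<close> is arbitrary, as the simulated input lies in memory.\<close>

lemma wp_sim:
  assumes "(ram_step P x ^^ t) (0, R) = (pc', R')" "length P \<le> pc'"
  obtains s where "(ram_step P x ^^ s) (0, R) = (pc', R')"
    "\<And>y Q M. sim_state x R M \<Longrightarrow>
      (\<And>M'. sim_state x R' M' \<Longrightarrow> sim_frame M M' \<Longrightarrow> M' 21 = s \<Longrightarrow> Q M') \<Longrightarrow> wp y (sim P) (\<lambda>_. Q) M"
proof -
  let ?c = "\<lambda>s. (ram_step P x ^^ s) (0, R)"
  define s where "s = (LEAST s. length P \<le> fst (?c s))"
  have 1: "length P \<le> fst (?c s)" "s \<le> t"
    unfolding s_def using assms by (auto intro: LeastI[of _ t] Least_le)
  have 2: "fst (?c r) < length P" if "r < s" for r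
    using that not_less_Least unfolding s_def by (metis not_le)
  have "?c (s + r) = ?c s" for r
    using 1 by (induction r) (auto simp: ram_step_def)
  then have 3: "?c s = (pc', R')" using 1(2) assms(1) by (metis le_add_diff_inverse)
  show ?thesis
  proof (rule that[OF 3])
    fix y Q M
    assume M: "sim_state x R M"
      and Q: "\<And>M'. sim_state x R' M' \<Longrightarrow> sim_frame M M' \<Longrightarrow> M' 21 = s \<Longrightarrow> Q M'"
    show "wp y (sim P) (\<lambda>_. Q) M"
      unfolding sim_def
      apply simp
      apply (rule wp_sim_loop[where x = x and R = R and t = s and pc' = pc' and R' = R'])
           apply (intro sim_state_upd M; simp)
      using 3 assms(2) 2 Q by (auto simp: sim_frame_upd_left)
  qed
qed

section \<open>The counting program\<close>

text \<open>
  The entry \<open>j\<close> of the current tuple is in register \<open>40 + j\<close>, the address of its row in the adjacency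
  matrix in \<open>40 + \<tau> + j\<close>, the loop counter in \<open>40 + 2 * \<tau> + j\<close>, and the numbers of vertices of each type
  start at \<open>40 + 3 * \<tau>\<close>. Registers 5, 7, 8, 30, 31 hold the number of vertices, the range of the tuple
  entries, the target weight, \<open>k\<close> and the code of the combination; 10, 11, 12 accumulate the positive part, the
  negative part and the denominator; 13 and 14 hold the value and the weight of the current word.
\<close>

definition vtype :: "nat \<Rightarrow> ('v \<Rightarrow> 'v \<Rightarrow> bool) \<Rightarrow> (nat \<Rightarrow> 'v) \<Rightarrow> 'v \<Rightarrow> nat" where
  "vtype \<tau> E a v = (\<Sum>j<\<tau>. 2 ^ j * of_bool (E (a j) v)) + 2 ^ \<tau> * (\<Sum>j<\<tau>. 2 ^ j * of_bool (v = a j))"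

definition count_type :: "nat \<Rightarrow> (nat \<Rightarrow> nat) \<Rightarrow> nat \<Rightarrow> nat" where
  "count_type n T t = card {v. v < n \<and> T v = t}"

fun repeat :: "nat \<Rightarrow> com \<Rightarrow> com" where
  "repeat 0 c = Op (Const 6 0)"
| "repeat (Suc m) c = c ;; repeat m c"

lemma wp_repeat_half:
  "r \<noteq> 6 \<Longrightarrow> wp x (repeat m (Op (Half r r))) Q R = Q (Suc m) (R(r := R r div 2 ^ m, 6 := 0))"
  by (induction m arbitrary: R Q) (auto simp: div_mult2_eq)

lemma wp_repeat_double:
  "r \<noteq> 6 \<Longrightarrow> wp x (repeat m (Op (Add r r r))) Q R = Q (Suc m) (R(r := R r * 2 ^ m, 6 := 0))"
  by (induction m arbitrary: R Q) (auto simp: mult_2 distrib_left distrib_right)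

fun zero_block :: "nat \<Rightarrow> nat \<Rightarrow> com" where
  "zero_block a 0 = Op (Const 6 0)"
| "zero_block a (Suc m) = Op (Const (a + m) 0) ;; zero_block a m"

lemma wp_zero_block:
  assumes "6 < a"
    and "\<And>R'. (\<And>r. R' r = (if r = 6 \<or> a \<le> r \<and> r < a + m then 0 else R r)) \<Longrightarrow> Q (Suc m) R'"
  shows "wp x (zero_block a m) Q R"
  using assms(2)
proof (induction m arbitrary: R Q)
  case (Suc m)
  show ?case
    by (simp, rule Suc.IH, rule Suc.prems) auto
qed simp

definition eq_step :: "nat \<Rightarrow> com" where
  "eq_step j = Op (Sub 17 25 (40 + j)) ;; Op (Sub 18 (40 + j) 25) ;; Op (Add 17 17 18) ;;
     Op (Const 6 1) ;; Op (Sub 17 6 17) ;; Op (Add 27 27 27) ;; Op (Add 27 27 17)"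

definition adj_step :: "nat \<Rightarrow> nat \<Rightarrow> com" where
  "adj_step \<tau> j = Op (Add 17 (40 + \<tau> + j) 25) ;; Op (Read 17 17) ;; Op (Const 6 1) ;;
     Op (Sub 17 6 17) ;; Op (Sub 17 6 17) ;; Op (Add 27 27 27) ;; Op (Add 27 27 17)"

text \<open>Horner's scheme, most significant bit first: each step doubles register 27 and adds a
  bit. \<open>count_step\<close> feeds in the equality bits before the adjacency bits, so that they
  form the upper half of the type, as in \<open>vtype\<close>.\<close>

fun down_steps :: "nat \<Rightarrow> (nat \<Rightarrow> com) \<Rightarrow> com" where
  "down_steps 0 c = Op (Const 6 0)"
| "down_steps (Suc j) c = c j ;; down_steps j c"

lemma wp_down_steps:
  assumes step: "\<And>j R Q. j < m \<Longrightarrow> (\<And>t R'. t \<le> 7 \<Longrightarrow> R' 27 = 2 * R 27 + f j (R 25) \<Longrightarrow>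
      (\<And>r. r \<notin> {6, 17, 18, 27} \<Longrightarrow> R' r = R r) \<Longrightarrow> Q t R') \<Longrightarrow> I R \<Longrightarrow> wp x (c j) Q R"
    and I: "\<And>R R'. I R \<Longrightarrow> (\<And>r. r \<notin> {6, 17, 18, 27} \<Longrightarrow> R' r = R r) \<Longrightarrow> I R'" "I R"
    and Q: "\<And>t R'. t \<le> 7 * m + 1 \<Longrightarrow> R' 27 = R 27 * 2 ^ m + (\<Sum>j<m. 2 ^ j * f j (R 25)) \<Longrightarrow>
      (\<And>r. r \<notin> {6, 17, 18, 27} \<Longrightarrow> R' r = R r) \<Longrightarrow> Q t R'"
  shows "wp x (down_steps m c) Q R"
  using assms
proof (induction m arbitrary: R Q)
  case 0
  then show ?case by simp
next
  case (Suc m)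
  show ?case
  proof (simp, rule Suc.prems(1)[of m])
    fix t :: nat and R1 :: "nat \<Rightarrow> nat"
    assume 1: "t \<le> 7" "R1 27 = 2 * R 27 + f m (R 25)" "\<And>r. r \<notin> {6, 17, 18, 27} \<Longrightarrow> R1 r = R r"
    show "wp x (down_steps m c) (\<lambda>t'. Q (t + t')) R1"
    proof (rule Suc.IH)
      show "I R1" using Suc.prems(2)[OF Suc.prems(3)] 1(3) by blast
      fix t' :: nat and R2 :: "nat \<Rightarrow> nat"
      assume 2: "t' \<le> 7 * m + 1" "R2 27 = R1 27 * 2 ^ m + (\<Sum>j<m. 2 ^ j * f j (R1 25))"
        "\<And>r. r \<notin> {6, 17, 18, 27} \<Longrightarrow> R2 r = R1 r"
      show "Q (t + t') R2"
        by (rule Suc.prems(4)) (use 1 2 in \<open>auto simp: algebra_simps\<close>)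
    qed (use Suc.prems in auto)
  qed (use Suc.prems in auto)
qed

lemma wp_eq_steps:
  assumes "\<And>t R'. t \<le> 7 * m + 1 \<Longrightarrow>
      R' 27 = R 27 * 2 ^ m + (\<Sum>j<m. 2 ^ j * of_bool (R 25 = R (40 + j))) \<Longrightarrow>
      (\<And>r. r \<notin> {6, 17, 18, 27} \<Longrightarrow> R' r = R r) \<Longrightarrow> Q t R'"
  shows "wp x (down_steps m eq_step) Q R"
proof (rule wp_down_steps[where f = "\<lambda>j v. of_bool (v = R (40 + j))"
      and I = "\<lambda>R'. \<forall>j. R' (40 + j) = R (40 + j)"])
  fix j R1 and Q :: "nat \<Rightarrow> (nat \<Rightarrow> nat) \<Rightarrow> bool"
  assume "\<forall>j. R1 (40 + j) = R (40 + j)"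
    and Q: "\<And>t R'. t \<le> 7 \<Longrightarrow> R' 27 = 2 * R1 27 + of_bool (R1 25 = R (40 + j)) \<Longrightarrow>
      (\<And>r. r \<notin> {6, 17, 18, 27} \<Longrightarrow> R' r = R1 r) \<Longrightarrow> Q t R'"
  then have a: "R1 (40 + j) = R (40 + j)" by blast
  show "wp x (eq_step j) Q R1"
    by (simp add: eq_step_def a, rule Q) auto
qed (use assms in auto)

lemma wp_adj_steps:
  assumes "\<And>t R'. t \<le> 7 * m + 1 \<Longrightarrow>
      R' 27 = R 27 * 2 ^ m + (\<Sum>j<m. 2 ^ j * of_bool (input_cell x (R (40 + \<tau> + j) + R 25) \<noteq> 0)) \<Longrightarrow>
      (\<And>r. r \<notin> {6, 17, 18, 27} \<Longrightarrow> R' r = R r) \<Longrightarrow> Q t R'"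
  shows "wp x (down_steps m (adj_step \<tau>)) Q R"
proof (rule wp_down_steps[where f = "\<lambda>j v. of_bool (input_cell x (R (40 + \<tau> + j) + v) \<noteq> 0)"
      and I = "\<lambda>R'. \<forall>j. R' (40 + j) = R (40 + j)"])
  fix j R1 and Q :: "nat \<Rightarrow> (nat \<Rightarrow> nat) \<Rightarrow> bool"
  assume "\<forall>j. R1 (40 + j) = R (40 + j)"
    and Q: "\<And>t R'. t \<le> 7 \<Longrightarrow>
      R' 27 = 2 * R1 27 + of_bool (input_cell x (R (40 + \<tau> + j) + R1 25) \<noteq> 0) \<Longrightarrow>
      (\<And>r. r \<notin> {6, 17, 18, 27} \<Longrightarrow> R' r = R1 r) \<Longrightarrow> Q t R'"
  then have a: "R1 (40 + \<tau> + j) = R (40 + \<tau> + j)" by (simp add: add.assoc)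
  show "wp x (adj_step \<tau> j) Q R1"
    by (simp add: adj_step_def a, rule Q) auto
qed (use assms in auto)

section \<open>Counting the vertices of each type\<close>

definition count_step :: "nat \<Rightarrow> com" where
  "count_step \<tau> = Op (Const 27 0) ;; down_steps \<tau> eq_step ;; down_steps \<tau> (adj_step \<tau>) ;;
     Op (Const 17 (40 + 3 * \<tau>)) ;; Op (Add 17 17 27) ;; Op (Load 18 17) ;; Op (Const 6 1) ;;
     Op (Add 18 18 6) ;; Op (Store 17 18) ;; Op (Add 25 25 6) ;; Op (Sub 26 26 6)"

text \<open>The table has a cell for each of the \<open>2 ^ (2 * \<tau> + 3)\<close> possible
  letters and not only for the \<open>2 ^ (2 * \<tau>)\<close> types, because the search also
  interprets meaningless codes. Their letters must address a cell of the table too; it stays 0, as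
  no vertex has such a type.\<close>

definition reset :: "nat \<Rightarrow> com" where
  "reset \<tau> = Op (Const 13 1) ;; Op (Const 14 0) ;; zero_block (40 + 3 * \<tau>) (2 ^ (2 * \<tau> + 3)) ;;
     Op (Const 25 0) ;; Op (Const 6 0) ;; Op (Add 26 5 6) ;; While 26 (count_step \<tau>)"

definition reg_type :: "nat \<Rightarrow> nat list \<Rightarrow> (nat \<Rightarrow> nat) \<Rightarrow> nat \<Rightarrow> nat" where
  "reg_type \<tau> x R v = (\<Sum>j<\<tau>. 2 ^ j * of_bool (input_cell x (R (40 + \<tau> + j) + v) \<noteq> 0)) +
     2 ^ \<tau> * (\<Sum>j<\<tau>. 2 ^ j * of_bool (v = R (40 + j)))"

lemma sum_bits_less: "(\<Sum>j<m. 2 ^ j * of_bool (f j)) < (2::nat) ^ m"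
  by (induction m) (auto simp: of_bool_def)

lemma bits_pair_less:
  assumes "p < 2 ^ m" "q < (2::nat) ^ m"
  shows "p + 2 ^ m * q < 2 ^ (2 * m)"
proof -
  have "p + 2 ^ m * q < 2 ^ m * (q + 1)" using assms by simp
  also have "\<dots> \<le> 2 ^ m * 2 ^ m" using assms by (intro mult_left_mono) auto
  finally show ?thesis by (simp add: mult_2 power_add)
qed

lemma vtype_less: "vtype \<tau> E a v < 2 ^ (2 * \<tau>)"
  unfolding vtype_def by (intro bits_pair_less sum_bits_less)

lemma reg_type_less: "reg_type \<tau> x R v < 2 ^ (2 * \<tau>)"
  unfolding reg_type_def by (intro bits_pair_less sum_bits_less)

lemma count_type_0 [simp]: "count_type 0 T t = 0"
  by (simp add: count_type_def)

lemma count_type_Suc: "count_type (Suc n) T t = count_type n T t + of_bool (T n = t)"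
proof -
  have "{v. v < Suc n \<and> T v = t} = {v. v < n \<and> T v = t} \<union> (if T n = t then {n} else {})"
    by (auto simp: less_Suc_eq)
  then show ?thesis by (simp add: count_type_def)
qed

lemma count_type_le: "count_type n T t \<le> n"
  unfolding count_type_def using card_mono[of "{..<n}" "{v. v < n \<and> T v = t}"] by auto

lemma wp_count_step:
  assumes "\<And>t R'. t \<le> 14 * \<tau> + 11 \<Longrightarrow>
      R' (40 + 3 * \<tau> + reg_type \<tau> x R (R 25)) = Suc (R (40 + 3 * \<tau> + reg_type \<tau> x R (R 25))) \<Longrightarrow>
      R' 25 = Suc (R 25) \<Longrightarrow> R' 26 = R 26 - 1 \<Longrightarrow>
      (\<And>r. r \<notin> {6, 17, 18, 25, 26, 27, 40 + 3 * \<tau> + reg_type \<tau> x R (R 25)} \<Longrightarrow> R' r = R r) \<Longrightarrow> Q t R'"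
  shows "wp x (count_step \<tau>) Q R"
  unfolding count_step_def
  apply simp
  apply (rule wp_eq_steps)
  apply (rule wp_adj_steps)
  subgoal premises p for t1 R1 t2 R2
  proof -
    have T: "R2 27 = reg_type \<tau> x R (R 25)"
      using p by (simp add: reg_type_def algebra_simps)
    have e: "R2 r = R r" if "r \<notin> {6, 17, 18, 27}" for r
      using p(3)[of r] p(6)[of r] that by simp
    show ?thesis
      using p(1,4) by (simp add: T e, intro assms) (auto simp: e)
  qed
  done

lemma reg_type_cong:
  assumes "\<And>r. 40 \<le> r \<Longrightarrow> r < 40 + 3 * \<tau> \<Longrightarrow> R' r = R r"
  shows "reg_type \<tau> x R' = reg_type \<tau> x R"
  by (rule ext) (auto simp: reg_type_def assms intro!: sum.cong)

lemma wp_reset: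
  assumes n: "R 5 = n"
    and Q: "\<And>t R'. t \<le> n * (14 * \<tau> + 14) + 2 ^ (2 * \<tau> + 3) + 8 \<Longrightarrow> R' 13 = 1 \<Longrightarrow> R' 14 = 0 \<Longrightarrow>
      (\<And>d. d < 2 ^ (2 * \<tau> + 3) \<Longrightarrow> R' (40 + 3 * \<tau> + d) = count_type n (reg_type \<tau> x R) d) \<Longrightarrow>
      (\<And>r. r < 40 + 3 * \<tau> \<Longrightarrow> r \<notin> {0, 6, 13, 14, 17, 18, 25, 26, 27} \<Longrightarrow> R' r = R r) \<Longrightarrow> Q t R'"
  shows "wp x (reset \<tau>) Q R"
proof -
  let ?T = "reg_type \<tau> x R"
  let ?I = "\<lambda>i R'. R' 25 = i \<and> R' 26 = n - i \<and>
       R' 13 = 1 \<and> R' 14 = 0 \<and>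
       (\<forall>d < 2 ^ (2 * \<tau> + 3). R' (40 + 3 * \<tau> + d) = count_type i ?T d) \<and>
       (\<forall>r < 40 + 3 * \<tau>. r \<notin> {0, 6, 13, 14, 17, 18, 25, 26, 27} \<longrightarrow> R' r = R r)"
  have step: "R2 26 \<noteq> 0 \<and> wp x (count_step \<tau>) (\<lambda>t R'. t \<le> 14 * \<tau> + 11 \<and> ?I (Suc i) (R'(0 := 0))) R2"
    if i: "i < n" and I: "?I i R2" for i R2
  proof
    show "R2 26 \<noteq> 0" using i I by simp
    have T: "reg_type \<tau> x R2 = ?T" using I by (intro reg_type_cong) auto
    have l: "?T i < 2 ^ (2 * \<tau> + 3)" by (rule less_le_trans[OF reg_type_less]) simp
    show "wp x (count_step \<tau>) (\<lambda>t R'. t \<le> 14 * \<tau> + 11 \<and> ?I (Suc i) (R'(0 := 0))) R2"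
    proof (rule wp_count_step, intro conjI allI impI)
      fix t :: nat and R' :: "nat \<Rightarrow> nat"
      let ?a = "40 + 3 * \<tau> + reg_type \<tau> x R2 (R2 25)"
      assume a: "t \<le> 14 * \<tau> + 11" "R' ?a = Suc (R2 ?a)" "R' 25 = Suc (R2 25)" "R' 26 = R2 26 - 1"
        "\<And>r. r \<notin> {6, 17, 18, 25, 26, 27, ?a} \<Longrightarrow> R' r = R2 r"
      show "t \<le> 14 * \<tau> + 11" "(R'(0 := 0)) 25 = Suc i" "(R'(0 := 0)) 26 = n - Suc i"
        "(R'(0 := 0)) 13 = 1" "(R'(0 := 0)) 14 = 0"
        using a I by auto
      show "(R'(0 := 0)) r = R r" if "r < 40 + 3 * \<tau>" "r \<notin> {0, 6, 13, 14, 17, 18, 25, 26, 27}" for r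
        using a(5)[of r] I that by auto
      show "(R'(0 := 0)) (40 + 3 * \<tau> + d) = count_type (Suc i) ?T d" if "d < 2 ^ (2 * \<tau> + 3)" for d
        using a(2) a(5)[of "40 + 3 * \<tau> + d"] I that l T
        by (cases "d = ?T i") (auto simp: count_type_Suc)
    qed
  qed
  show ?thesis
    unfolding reset_def
    apply simp
    apply (rule wp_zero_block)
     apply simp
    subgoal premises z for R1
      apply simp
      apply (rule wp_While_timed[where n = n and b = "14 * \<tau> + 11" and I = ?I])
      subgoal using n by (simp add: z)
      subgoal by (rule step)
      subgoal by simp
      subgoal by (rule Q) (auto simp: algebra_simps)
      done
    done
qed

section \<open>Words\<close>

text \<open>
  A combination is coded by a list of letters. A letter \<open>d \<ge> 4\<close> extends the current word by the type
  \<open>d - 4\<close>; a smaller letter ends the word, where 1 adds and 2 subtracts its value and 3 increments the common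
  denominator instead. A word counts only if its weight is the target: the weight determines
  the length of the word and whether every entry of the tuple occurs in it.
\<close>

fun word_val :: "(nat \<Rightarrow> nat) \<Rightarrow> nat list \<Rightarrow> nat" where
  "word_val c [] = 1"
| "word_val c (t # w) = word_val c w * (c t - count_list w t)"

definition word_wt :: "nat \<Rightarrow> nat list \<Rightarrow> nat" where
  "word_wt \<tau> w = (\<Sum>t\<leftarrow>w. t div 2 ^ \<tau> + 2 ^ \<tau>)"

fun letters_run :: "nat \<Rightarrow> nat \<Rightarrow> (nat \<Rightarrow> nat) \<Rightarrow> nat list \<Rightarrow> nat list \<times> nat \<times> nat \<times> nat \<Rightarrow>
    nat list \<times> nat \<times> nat \<times> nat" where
  "letters_run \<tau> g c [] s = s"
| "letters_run \<tau> g c (d # L) (w, p, m, q) = letters_run \<tau> g c L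
     (if d < 4 then ([], p + of_bool (d = 1 \<and> word_wt \<tau> w = g) * word_val c w,
        m + of_bool (d = 2 \<and> word_wt \<tau> w = g) * word_val c w, q + of_bool (d = 3))
      else ((d - 4) # w, p, m, q))"

text \<open>Least significant digit first. The base \<open>2 ^ Suc b\<close> is at least 2, so that
  the recursion terminates.\<close>

function digits :: "nat \<Rightarrow> nat \<Rightarrow> nat list" where
  "digits b y = (if y = 0 then [] else y mod 2 ^ Suc b # digits b (y div 2 ^ Suc b))"
  by auto
termination
proof (relation "measure snd")
  fix b y :: nat assume "y \<noteq> 0"
  then have "y div 2 ^ Suc b < y" by (intro div_less_dividend one_less_power) auto
  then show "((b, y div 2 ^ Suc b), b, y) \<in> measure snd" by (simp only: in_measure snd_conv)
qed simp

declare digits.simps [simp del]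

lemma digits_0 [simp]: "digits b 0 = []"
  by (simp add: digits.simps)

lemma length_digits: "length (digits b y) \<le> y"
proof (induction b y rule: digits.induct)
  case (1 b y)
  have "y \<noteq> 0 \<Longrightarrow> y div 2 ^ Suc b < y" by (intro div_less_dividend one_less_power) auto
  then show ?case using 1 by (subst digits.simps) auto
qed

section \<open>Interpreting the letters of a code\<close>

definition mult_letter :: "nat \<Rightarrow> com" where
  "mult_letter \<tau> = Op (Const 6 4) ;; Op (Sub 21 16 6) ;; Op (Const 17 (40 + 3 * \<tau>)) ;; Op (Add 17 17 21) ;;
     Op (Load 18 17) ;; Op (Const 6 1) ;; Op (Sub 19 18 6) ;; Op (Store 17 19) ;; Op (Const 20 0) ;;
     While 18 (Op (Add 20 20 13) ;; Op (Const 6 1) ;; Op (Sub 18 18 6)) ;;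
     Op (Const 6 0) ;; Op (Add 13 20 6) ;; repeat \<tau> (Op (Half 21 21)) ;; Op (Add 14 14 21) ;;
     Op (Const 6 (2 ^ \<tau>)) ;; Op (Add 14 14 6)"

text \<open>Repeated addition makes the cost proportional to the table cell, which is at most the
  number of vertices. The cell is decremented, as a later occurrence of the same type has one vertex
  less to choose from.\<close>

lemma wp_mult_letter:
  assumes "\<And>t R'. t \<le> 6 * R (40 + 3 * \<tau> + (R 16 - 4)) + \<tau> + 17 \<Longrightarrow>
      R' 13 = R 13 * R (40 + 3 * \<tau> + (R 16 - 4)) \<Longrightarrow> R' 14 = R 14 + (R 16 - 4) div 2 ^ \<tau> + 2 ^ \<tau> \<Longrightarrow>
      R' (40 + 3 * \<tau> + (R 16 - 4)) = R (40 + 3 * \<tau> + (R 16 - 4)) - 1 \<Longrightarrow>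
      (\<And>r. r \<notin> {0, 6, 13, 14, 17, 18, 19, 20, 21, 40 + 3 * \<tau> + (R 16 - 4)} \<Longrightarrow> R' r = R r) \<Longrightarrow> Q t R'"
  shows "wp x (mult_letter \<tau>) Q R"
  unfolding mult_letter_def
  apply simp
  apply (rule wp_While_timed[where n = "R (40 + 3 * \<tau> + (R 16 - 4))" and b = 3 and
        I = "\<lambda>i R'. R' 18 = R (40 + 3 * \<tau> + (R 16 - 4)) - i \<and> R' 20 = i * R 13 \<and> R' 21 = R 16 - 4 \<and>
          R' (40 + 3 * \<tau> + (R 16 - 4)) = R (40 + 3 * \<tau> + (R 16 - 4)) - 1 \<and>
          (\<forall>r. r \<notin> {0, 6, 17, 18, 19, 20, 21, 40 + 3 * \<tau> + (R 16 - 4)} \<longrightarrow> R' r = R r)"])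
  subgoal by simp
  subgoal by simp
  subgoal by simp
  subgoal by (simp add: wp_repeat_half, rule assms) auto
  done

definition is_digit :: "nat \<Rightarrow> com" where
  "is_digit c = Op (Const 6 c) ;; Op (Sub 18 16 6) ;; Op (Sub 19 6 16) ;; Op (Add 18 18 19) ;;
     Op (Const 6 1) ;; Op (Sub 18 6 18)"

lemma wp_is_digit:
  assumes "\<And>t R'. t \<le> 6 \<Longrightarrow> R' 18 = of_bool (R 16 = c) \<Longrightarrow>
     (\<And>r. r \<notin> {6, 18, 19} \<Longrightarrow> R' r = R r) \<Longrightarrow> Q t R'"
  shows "wp x (is_digit c) Q R"
  unfolding is_digit_def by (simp, rule assms) auto

definition acc_letter :: "nat \<Rightarrow> nat \<Rightarrow> com" where
  "acc_letter c r = is_digit c ;; If 18 (If 17 (Op (Add r r 13)))"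

lemma wp_acc_letter:
  assumes "r \<notin> {6, 13, 17, 18, 19}"
    and "\<And>t R'. t \<le> 9 \<Longrightarrow> R' r = R r + of_bool (R 16 = c \<and> R 17 \<noteq> 0) * R 13 \<Longrightarrow>
     (\<And>i. i \<notin> {6, 18, 19, r} \<Longrightarrow> R' i = R i) \<Longrightarrow> Q t R'"
  shows "wp x (acc_letter c r) Q R"
  unfolding acc_letter_def
  apply simp
  apply (rule wp_is_digit)
  subgoal premises p for t R'
    proof -
    have e: "\<And>i. i \<noteq> 6 \<Longrightarrow> i \<noteq> 18 \<Longrightarrow> i \<noteq> 19 \<Longrightarrow> R' i = R i" using p(3) by simp
    show ?thesis
      by (intro conjI impI; rule assms(2); use assms(1) p(1,2) in \<open>simp add: e\<close>)
  qed
  done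

definition acc_denom :: com where
  "acc_denom = is_digit 3 ;; If 18 (Op (Const 6 1) ;; Op (Add 12 12 6))"

lemma wp_acc_denom:
  assumes "\<And>t R'. t \<le> 9 \<Longrightarrow> R' 12 = R 12 + of_bool (R 16 = 3) \<Longrightarrow>
     (\<And>i. i \<notin> {6, 12, 18, 19} \<Longrightarrow> R' i = R i) \<Longrightarrow> Q t R'"
  shows "wp x acc_denom Q R"
  unfolding acc_denom_def
  apply simp
  apply (rule wp_is_digit)
  subgoal premises p for t R'
  proof -
    have e: "\<And>i. i \<noteq> 6 \<Longrightarrow> i \<noteq> 18 \<Longrightarrow> i \<noteq> 19 \<Longrightarrow> R' i = R i" using p(3) by simp
    show ?thesis
      by (intro conjI impI; rule assms; use p(1,2) in \<open>simp add: e\<close>)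
  qed
  done

definition control_letter :: "nat \<Rightarrow> com" where
  "control_letter \<tau> = Op (Sub 17 14 8) ;; Op (Sub 18 8 14) ;; Op (Add 17 17 18) ;; Op (Const 6 1) ;;
     Op (Sub 17 6 17) ;; acc_letter 1 10 ;; acc_letter 2 11 ;; acc_denom ;; reset \<tau>"

lemma wp_control_letter:
  assumes n: "R 5 = n"
    and Q: "\<And>t R'. t \<le> n * (14 * \<tau> + 14) + 2 ^ (2 * \<tau> + 3) + 40 \<Longrightarrow> R' 13 = 1 \<Longrightarrow> R' 14 = 0 \<Longrightarrow>
      R' 10 = R 10 + of_bool (R 16 = 1 \<and> R 14 = R 8) * R 13 \<Longrightarrow>
      R' 11 = R 11 + of_bool (R 16 = 2 \<and> R 14 = R 8) * R 13 \<Longrightarrow>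
      R' 12 = R 12 + of_bool (R 16 = 3) \<Longrightarrow>
      (\<And>d. d < 2 ^ (2 * \<tau> + 3) \<Longrightarrow> R' (40 + 3 * \<tau> + d) = count_type n (reg_type \<tau> x R) d) \<Longrightarrow>
      (\<And>r. r < 40 + 3 * \<tau> \<Longrightarrow> r \<notin> {0, 6, 10, 11, 12, 13, 14, 17, 18, 19, 25, 26, 27} \<Longrightarrow> R' r = R r) \<Longrightarrow> Q t R'"
  shows "wp x (control_letter \<tau>) Q R"
proof -
  have body: "wp x (reset \<tau>) (\<lambda>t'. Q (t + t')) R1"
    if h: "t \<le> 32"
      "R1 10 = R 10 + of_bool (R 16 = 1 \<and> R 14 = R 8) * R 13"
      "R1 11 = R 11 + of_bool (R 16 = 2 \<and> R 14 = R 8) * R 13"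
      "R1 12 = R 12 + of_bool (R 16 = 3)"
      "\<And>r. r \<notin> {6, 10, 11, 12, 17, 18, 19} \<Longrightarrow> R1 r = R r" for t R1
  proof (rule wp_reset)
    show "R1 5 = n" using n that by simp
    have T: "reg_type \<tau> x R1 = reg_type \<tau> x R"
      using that by (intro reg_type_cong) auto
    show "Q (t + t') R'" if "t' \<le> n * (14 * \<tau> + 14) + 2 ^ (2 * \<tau> + 3) + 8" "R' 13 = 1" "R' 14 = 0"
      "\<And>d. d < 2 ^ (2 * \<tau> + 3) \<Longrightarrow> R' (40 + 3 * \<tau> + d) = count_type n (reg_type \<tau> x R1) d"
      "\<And>r. r < 40 + 3 * \<tau> \<Longrightarrow> r \<notin> {0, 6, 13, 14, 17, 18, 25, 26, 27} \<Longrightarrow> R' r = R1 r" for t' R'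
      by (rule Q) (use that h T in simp_all)
  qed
  show ?thesis
    unfolding control_letter_def
    apply simp
    apply (rule wp_acc_letter)
     apply simp
    apply (rule wp_acc_letter)
     apply simp
    apply (rule wp_acc_denom)
    subgoal premises p for t1 R1 t2 R2 t3 R3
    proof -
      have e: "R3 r = R r" if "r \<notin> {6, 10, 11, 12, 17, 18, 19}" for r
        using p(3)[of r] p(6)[of r] p(9)[of r] that by simp
      have "wp x (reset \<tau>) (\<lambda>t'. Q (5 + t1 + t2 + t3 + t')) R3"
      proof (rule body)
        show "5 + t1 + t2 + t3 \<le> 32" using p by simp
        have "R3 10 = R1 10" "R1 16 = R 16" "R1 13 = R 13" "R3 11 = R2 11" "R1 11 = R 11" "R1 12 = R 12" "R2 16 = R 16" "R2 12 = R 12"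
          using p(3,6,9) by simp_all
        moreover have "R1 17 = Suc 0 - (R 14 - R 8 + (R 8 - R 14))" using p(3)[of 17] by simp
        ultimately show "R3 10 = R 10 + of_bool (R 16 = 1 \<and> R 14 = R 8) * R 13"
          "R3 11 = R 11 + of_bool (R 16 = 2 \<and> R 14 = R 8) * R 13"
          "R3 12 = R 12 + of_bool (R 16 = 3)" using p(2,5,8) by auto
      qed (rule e)
      then show ?thesis by (simp add: add.assoc eval_nat_numeral)
    qed
    done
qed

definition letter :: "nat \<Rightarrow> com" where
  "letter \<tau> = Op (Const 6 4) ;; Op (Sub 23 6 16) ;; Op (Const 6 3) ;; Op (Sub 24 16 6) ;;
     If 23 (control_letter \<tau>) ;; If 24 (mult_letter \<tau>)"

definition word_state :: "nat \<Rightarrow> (nat \<Rightarrow> nat) \<Rightarrow> nat list \<Rightarrow> (nat \<Rightarrow> nat) \<Rightarrow> bool" where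
  "word_state \<tau> c w R \<longleftrightarrow> R 13 = word_val c w \<and> R 14 = word_wt \<tau> w \<and>
     (\<forall>d < 2 ^ (2 * \<tau> + 3). R (40 + 3 * \<tau> + d) = c d - count_list w d)"

abbreviation body_time :: "nat \<Rightarrow> nat \<Rightarrow> nat" where
  "body_time \<tau> n \<equiv> n * (14 * \<tau> + 14) + 2 ^ (2 * \<tau> + 3) + \<tau> + 60"

lemma numeral_add_Suc:
  "3 + n = Suc (Suc (Suc n))" "6 + n = Suc (Suc (Suc (Suc (Suc (Suc n)))))"
  by simp_all

text \<open>Quantifying over the remaining letters \<open>L\<close> expresses one step as a
  preserved quantity, the final result of \<open>letters_run\<close> from the current state. This
  quantity is the loop invariant of \<open>interp\<close>.\<close>

lemma wp_letter:
  assumes R: "R 5 = n" "R 16 < 2 ^ (2 * \<tau> + 3)" "word_state \<tau> (count_type n (reg_type \<tau> x R)) w R"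
    and Q: "\<And>t R' w'. t \<le> body_time \<tau> n \<Longrightarrow> word_state \<tau> (count_type n (reg_type \<tau> x R)) w' R' \<Longrightarrow>
      (\<And>L. letters_run \<tau> (R 8) (count_type n (reg_type \<tau> x R)) L (w', R' 10, R' 11, R' 12) =
         letters_run \<tau> (R 8) (count_type n (reg_type \<tau> x R)) (R 16 # L) (w, R 10, R 11, R 12)) \<Longrightarrow>
      (\<And>r. r < 40 + 3 * \<tau> \<Longrightarrow> r \<notin> {0, 6, 10, 11, 12, 13, 14, 17, 18, 19, 20, 21, 23, 24, 25, 26, 27} \<Longrightarrow> R' r = R r) \<Longrightarrow> Q t R'"
  shows "wp x (letter \<tau>) Q R"
proof (cases "R 16 < 4")
  case True
  let ?R = "R(23 := 4 - R 16, 6 := 3, 24 := R 16 - 3)"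
  have T: "reg_type \<tau> x (R(23 := 4 - R 16, 6 := 3, 24 := 0)) = reg_type \<tau> x R" by (intro reg_type_cong) auto
  show ?thesis
    unfolding letter_def using True
    apply simp
    apply (rule wp_control_letter[where n = n])
    subgoal using R(1) by simp
    subgoal premises p for t R'
    proof -
      have 1: "R' 24 = 0" using p(9)[of 24] by simp
      have "Q (6 + t) R'"
      proof (rule Q[where w' = "[]"])
        show "6 + t \<le> body_time \<tau> n" using p(2) by simp
        show "word_state \<tau> (count_type n (reg_type \<tau> x R)) [] R'"
          using p(3,4,8) T by (auto simp: word_state_def word_wt_def)
        show "letters_run \<tau> (R 8) (count_type n (reg_type \<tau> x R)) L ([], R' 10, R' 11, R' 12) =
          letters_run \<tau> (R 8) (count_type n (reg_type \<tau> x R)) (R 16 # L) (w, R 10, R 11, R 12)" for L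
          using p(5-7) True R(3) by (simp add: word_state_def)
        show "R' r = R r" if "r < 40 + 3 * \<tau>"
          "r \<notin> {0, 6, 10, 11, 12, 13, 14, 17, 18, 19, 20, 21, 23, 24, 25, 26, 27}" for r
          using p(9)[of r] that by simp
      qed
      then show ?thesis using 1 by (simp add: numeral_add_Suc)
    qed
    done
next
  case False
  let ?c = "count_type n (reg_type \<tau> x R)" and ?d = "R 16 - 4"
  have d: "?d < 2 ^ (2 * \<tau> + 3)" using R(2) by simp
  have cd: "R (40 + 3 * \<tau> + ?d) = ?c ?d - count_list w ?d"
    using R(3) d by (simp add: word_state_def)
  have "?c ?d \<le> n" by (rule count_type_le)
  then have cn: "R (40 + 3 * \<tau> + ?d) \<le> n" using cd by simp
  show ?thesis
    unfolding letter_def using False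
    apply simp
    apply (rule wp_mult_letter)
    subgoal premises p for t R'
    proof -
      have 1: "R' r = R r" if "r \<notin> {0, 6, 13, 14, 17, 18, 19, 20, 21, 23, 24, 40 + 3 * \<tau> + ?d}" for r
        using p(6)[of r] that by simp
      have "Q (6 + t) R'"
      proof (rule Q[where w' = "?d # w"])
        have "t \<le> 6 * n + \<tau> + 17" using p(2) cn by simp
        moreover have "6 * n \<le> n * (14 * \<tau> + 14)" by (simp add: algebra_simps)
        ultimately show "6 + t \<le> body_time \<tau> n" by linarith
        show "word_state \<tau> ?c (?d # w) R'"
          unfolding word_state_def
        proof (intro conjI allI impI)
          show "R' 13 = word_val ?c (?d # w)" using p(3) R(3) cd by (simp add: word_state_def)
          show "R' 14 = word_wt \<tau> (?d # w)" using p(4) R(3) by (simp add: word_state_def word_wt_def)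
          show "R' (40 + 3 * \<tau> + d) = ?c d - count_list (?d # w) d" if "d < 2 ^ (2 * \<tau> + 3)" for d
            using p(5) 1[of "40 + 3 * \<tau> + d"] cd R(3) that by (cases "d = ?d") (simp_all add: word_state_def)
        qed
        show "letters_run \<tau> (R 8) ?c L (?d # w, R' 10, R' 11, R' 12) =
          letters_run \<tau> (R 8) ?c (R 16 # L) (w, R 10, R 11, R 12)" for L
          using 1 False by simp
        show "R' r = R r" if "r < 40 + 3 * \<tau>"
          "r \<notin> {0, 6, 10, 11, 12, 13, 14, 17, 18, 19, 20, 21, 23, 24, 25, 26, 27}" for r
          using 1[of r] that by simp
      qed
      then show ?thesis by (simp add: numeral_add_Suc)
    qed
    done
qed

definition pop :: "nat \<Rightarrow> com" where
  "pop \<tau> = Op (Const 6 0) ;; Op (Add 22 15 6) ;; repeat (2 * \<tau> + 3) (Op (Half 22 22)) ;;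
     Op (Const 6 0) ;; Op (Add 23 22 6) ;; repeat (2 * \<tau> + 3) (Op (Add 23 23 23)) ;;
     Op (Sub 16 15 23) ;; Op (Const 6 0) ;; Op (Add 15 22 6)"

lemma wp_pop:
  assumes "\<And>t R'. t \<le> 4 * \<tau> + 15 \<Longrightarrow> R' 16 = R 15 mod 2 ^ (2 * \<tau> + 3) \<Longrightarrow> R' 15 = R 15 div 2 ^ (2 * \<tau> + 3) \<Longrightarrow>
     (\<And>r. r \<notin> {6, 15, 16, 22, 23} \<Longrightarrow> R' r = R r) \<Longrightarrow> Q t R'"
  shows "wp x (pop \<tau>) Q R"
  unfolding pop_def
  by (simp add: wp_repeat_half wp_repeat_double del: repeat.simps, rule assms)
    (auto simp: minus_div_mult_eq_mod)

definition interp :: "nat \<Rightarrow> com" where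
  "interp \<tau> = Op (Const 12 0) ;; Op (Const 6 0) ;; Op (Add 15 31 6) ;; reset \<tau> ;;
     While 15 (pop \<tau> ;; letter \<tau>)"

definition interp_regs :: "nat set" where
  "interp_regs = {0, 6, 10, 11, 12, 13, 14, 15, 16, 17, 18, 19, 20, 21, 22, 23, 24, 25, 26, 27}"

lemma wp_interp:
  assumes n: "R 5 = n"
    and Q: "\<And>t R' w. t \<le> (R 31 + 1) * (body_time \<tau> n + 4 * \<tau> + 20) \<Longrightarrow>
      letters_run \<tau> (R 8) (count_type n (reg_type \<tau> x R)) (digits (2 * \<tau> + 2) (R 31)) ([], R 10, R 11, 0)
        = (w, R' 10, R' 11, R' 12) \<Longrightarrow>
      (\<And>r. r < 40 + 3 * \<tau> \<Longrightarrow> r \<notin> interp_regs \<Longrightarrow> R' r = R r) \<Longrightarrow> Q t R'"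
  shows "wp x (interp \<tau>) Q R"
proof -
  let ?c = "count_type n (reg_type \<tau> x R)" and ?L = "digits (2 * \<tau> + 2)"
  let ?I = "\<lambda>i R'. length (?L (R' 15)) + i = length (?L (R 31)) \<and>
        (\<exists>w. word_state \<tau> ?c w R' \<and>
          letters_run \<tau> (R 8) ?c (?L (R' 15)) (w, R' 10, R' 11, R' 12) =
          letters_run \<tau> (R 8) ?c (?L (R 31)) ([], R 10, R 11, 0)) \<and>
        (\<forall>r < 40 + 3 * \<tau>. r \<notin> interp_regs \<longrightarrow> R' r = R r)"
  have loop: "wp x (While 15 (pop \<tau> ;; letter \<tau>)) (\<lambda>t. Q (3 + (t0 + t))) R0"
    if R0: "t0 \<le> n * (14 * \<tau> + 14) + 2 ^ (2 * \<tau> + 3) + 8" "word_state \<tau> ?c [] R0" "R0 15 = R 31" "R0 12 = 0"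
      "R0 10 = R 10" "R0 11 = R 11"
      "\<And>r. r < 40 + 3 * \<tau> \<Longrightarrow> r \<notin> interp_regs \<Longrightarrow> R0 r = R r" for t0 R0
  proof (rule wp_While_timed[where n = "length (?L (R 31))" and b = "body_time \<tau> n + 4 * \<tau> + 15"
      and I = ?I])
    show "?I 0 R0"
      using R0 by auto
  next
    fix i R1
    assume i: "i < length (?L (R 31))" and I: "?I i R1"
    then obtain w where w: "word_state \<tau> ?c w R1"
      "letters_run \<tau> (R 8) ?c (?L (R1 15)) (w, R1 10, R1 11, R1 12) =
          letters_run \<tau> (R 8) ?c (?L (R 31)) ([], R 10, R 11, 0)" by blast
    have fr: "\<And>r. r < 40 + 3 * \<tau> \<Longrightarrow> r \<notin> interp_regs \<Longrightarrow> R1 r = R r" using I by blast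
    have ne: "R1 15 \<noteq> 0" using i I by (metis add_0 digits_0 list.size(3) less_irrefl)
    have dg: "?L (R1 15) = R1 15 mod 2 ^ (2 * \<tau> + 3) # ?L (R1 15 div 2 ^ (2 * \<tau> + 3))"
      using ne by (subst digits.simps) (simp add: numeral_3_eq_3)
    show "R1 15 \<noteq> 0 \<and> wp x (pop \<tau> ;; letter \<tau>) (\<lambda>t R'. t \<le> body_time \<tau> n + 4 * \<tau> + 15 \<and>
        ?I (Suc i) (R'(0 := 0))) R1"
    proof (rule conjI[OF ne], unfold wp_Seq, rule wp_pop)
      fix t :: nat and R2 :: "nat \<Rightarrow> nat"
      assume p: "t \<le> 4 * \<tau> + 15" "R2 16 = R1 15 mod 2 ^ (2 * \<tau> + 3)" "R2 15 = R1 15 div 2 ^ (2 * \<tau> + 3)"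
        "\<And>r. r \<notin> {6, 15, 16, 22, 23} \<Longrightarrow> R2 r = R1 r"
      have T: "reg_type \<tau> x R2 = reg_type \<tau> x R"
        by (intro reg_type_cong) (use p(4) fr in \<open>simp add: interp_regs_def\<close>)
      have R2: "R2 5 = n" "R2 8 = R 8" using p(4) fr n by (simp_all add: interp_regs_def)
      show "wp x (letter \<tau>) (\<lambda>t' R'. t + t' \<le> body_time \<tau> n + 4 * \<tau> + 15 \<and>
        ?I (Suc i) (R'(0 := 0))) R2"
      proof (rule wp_letter[where w = w and n = n])
        show "R2 5 = n" by (rule R2)
        show "R2 16 < 2 ^ (2 * \<tau> + 3)" by (simp add: p(2))
        show "word_state \<tau> (count_type n (reg_type \<tau> x R2)) w R2"
          using w(1) p(4) unfolding T word_state_def by simp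
        fix t' R3 w'
        assume q: "t' \<le> body_time \<tau> n" "word_state \<tau> (count_type n (reg_type \<tau> x R2)) w' R3"
          "\<And>L. letters_run \<tau> (R2 8) (count_type n (reg_type \<tau> x R2)) L (w', R3 10, R3 11, R3 12) =
           letters_run \<tau> (R2 8) (count_type n (reg_type \<tau> x R2)) (R2 16 # L) (w, R2 10, R2 11, R2 12)"
          "\<And>r. r < 40 + 3 * \<tau> \<Longrightarrow> r \<notin> {0, 6, 10, 11, 12, 13, 14, 17, 18, 19, 20, 21, 23, 24, 25, 26, 27} \<Longrightarrow> R3 r = R2 r"
        have 15: "R3 15 = R1 15 div 2 ^ (2 * \<tau> + 3)" using q(4)[of 15] p(3) by simp
        show "t + t' \<le> body_time \<tau> n + 4 * \<tau> + 15 \<and>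
        ?I (Suc i) (R3(0 := 0))"
        proof (intro conjI exI allI impI)
          show "t + t' \<le> body_time \<tau> n + 4 * \<tau> + 15" using p(1) q(1) by simp
          show "length (?L ((R3(0 := 0)) 15)) + Suc i = length (?L (R 31))"
            using I dg 15 by simp
          show "word_state \<tau> ?c w' (R3(0 := 0))" using q(2) T by (simp add: word_state_def)
          have "letters_run \<tau> (R 8) ?c (?L (R3 15)) (w', R3 10, R3 11, R3 12) =
            letters_run \<tau> (R 8) ?c (R2 16 # ?L (R3 15)) (w, R2 10, R2 11, R2 12)"
            using q(3) by (simp only: T R2)
          also have "R2 16 # ?L (R3 15) = ?L (R1 15)" by (simp only: dg 15 p(2))
          also have "(w, R2 10, R2 11, R2 12) = (w, R1 10, R1 11, R1 12)" using p(4) by simp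
          finally show "letters_run \<tau> (R 8) ?c (?L ((R3(0 := 0)) 15)) (w', (R3(0 := 0)) 10, (R3(0 := 0)) 11, (R3(0 := 0)) 12) =
            letters_run \<tau> (R 8) ?c (?L (R 31)) ([], R 10, R 11, 0)"
            using w(2) by simp
          show "(R3(0 := 0)) r = R r" if "r < 40 + 3 * \<tau>" "r \<notin> interp_regs" for r
            using that q(4)[of r] p(4)[of r] fr[of r] by (simp add: interp_regs_def)
        qed
      qed
    qed
  next
    fix R1
    assume "?I (length (?L (R 31))) R1"
    then have e: "?L (R1 15) = []" by simp
    show "R1 15 = 0"
    proof (rule ccontr)
      assume "R1 15 \<noteq> 0"
      with e show False by (subst (asm) digits.simps) simp
    qed
  next
    fix t R1
    assume I: "?I (length (?L (R 31))) R1"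
      and t: "t \<le> length (?L (R 31)) * (body_time \<tau> n + 4 * \<tau> + 15 + 3) + 1"
    then have e: "?L (R1 15) = []" by simp
    from I obtain w where w: "letters_run \<tau> (R 8) ?c (?L (R1 15)) (w, R1 10, R1 11, R1 12) =
          letters_run \<tau> (R 8) ?c (?L (R 31)) ([], R 10, R 11, 0)" by blast
    show "Q (3 + (t0 + t)) R1"
    proof (rule Q[where w = w])
      show "letters_run \<tau> (R 8) ?c (?L (R 31)) ([], R 10, R 11, 0) = (w, R1 10, R1 11, R1 12)"
        using w e by simp
      \<comment> \<open>A number has at most as many digits as its value. The estimate is crude, but
        the code depends on \<open>k\<close> only and disappears in \<open>f\<close>.\<close>
      have "t \<le> R 31 * (body_time \<tau> n + 4 * \<tau> + 20) + 1"
        by (rule order.trans[OF t], rule add_right_mono, rule mult_le_mono[OF length_digits]) simp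
      then show "3 + (t0 + t) \<le> (R 31 + 1) * (body_time \<tau> n + 4 * \<tau> + 20)"
        using R0(1) by simp
    qed (use I in blast)
  qed
  have "wp x (reset \<tau>) (\<lambda>t0. wp x (While 15 (pop \<tau> ;; letter \<tau>)) (\<lambda>t. Q (3 + (t0 + t))))
      (R(12 := 0, 6 := 0, 15 := R 31))"
    apply (rule wp_reset[where n = n])
    subgoal using n by simp
    subgoal premises p for t R'
    proof -
      have T: "reg_type \<tau> x (R(12 := 0, 6 := 0, 15 := R 31)) = reg_type \<tau> x R"
        by (intro reg_type_cong) auto
      show ?thesis
        by (rule loop) (use p T in \<open>auto simp: word_state_def word_wt_def interp_regs_def\<close>)
    qed
    done
  then show ?thesis by (simp add: interp_def numeral_add_Suc)
qed

fun letters_val :: "nat \<Rightarrow> nat \<Rightarrow> nat \<Rightarrow> (nat \<Rightarrow> nat) \<Rightarrow> nat list \<Rightarrow> nat list \<Rightarrow> nat" where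
  "letters_val s \<tau> g c [] w = 0"
| "letters_val s \<tau> g c (d # L) w = (if d < 4
     then of_bool (d = s \<and> word_wt \<tau> w = g) * word_val c w + letters_val s \<tau> g c L []
     else letters_val s \<tau> g c L ((d - 4) # w))"

lemma letters_run_eq:
  "snd (letters_run \<tau> g c L (w, p, m, q)) =
     (p + letters_val 1 \<tau> g c L w, m + letters_val 2 \<tau> g c L w, q + count_list L 3)"
  by (induction L arbitrary: w p m q) auto

section \<open>The loop over all tuples\<close>

definition cell_adj :: "nat list \<Rightarrow> nat \<Rightarrow> nat \<Rightarrow> nat \<Rightarrow> bool" where
  "cell_adj x n u v \<longleftrightarrow> input_cell x (2 + u * n + v) \<noteq> 0"

definition tuple_val :: "nat \<Rightarrow> nat \<Rightarrow> nat \<Rightarrow> nat list \<Rightarrow> nat \<Rightarrow> nat \<Rightarrow> (nat \<Rightarrow> nat) \<Rightarrow> nat" where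
  "tuple_val s \<tau> g x n N a =
     letters_val s \<tau> g (count_type n (vtype \<tau> (cell_adj x n) a)) (digits (2 * \<tau> + 2) N) []"

fun tuple_sum :: "nat \<Rightarrow> nat \<Rightarrow> ((nat \<Rightarrow> nat) \<Rightarrow> nat) \<Rightarrow> (nat \<Rightarrow> nat) \<Rightarrow> nat" where
  "tuple_sum m 0 F a = F a"
| "tuple_sum m (Suc j) F a = (\<Sum>u<m. tuple_sum m j F (a(j := u)))"

text \<open>Advancing the row address by the number of vertices, held in register 5, replaces the
  multiplication \<open>a j * n\<close>.\<close>

definition tuple_incr :: "nat \<Rightarrow> nat \<Rightarrow> com" where
  "tuple_incr \<tau> j = Op (Add (40 + \<tau> + j) (40 + \<tau> + j) 5) ;; Op (Const 6 1) ;;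
     Op (Add (40 + j) (40 + j) 6) ;; Op (Sub (40 + 2 * \<tau> + j) (40 + 2 * \<tau> + j) 6)"

lemma wp_tuple_incr:
  assumes "j < \<tau>"
  shows "wp x (tuple_incr \<tau> j) Q R = Q (Suc (Suc (Suc (Suc 0)))) (R(40 + \<tau> + j := R (40 + \<tau> + j) + R 5, 6 := 1,
    40 + j := R (40 + j) + 1, 40 + 2 * \<tau> + j := R (40 + 2 * \<tau> + j) - 1))"
  using assms by (simp add: tuple_incr_def)

fun nest :: "nat \<Rightarrow> nat \<Rightarrow> com \<Rightarrow> com" where
  "nest \<tau> 0 c = c"
| "nest \<tau> (Suc j) c = Op (Const (40 + j) 0) ;; Op (Const (40 + \<tau> + j) 2) ;; Op (Const 6 0) ;;
     Op (Add (40 + 2 * \<tau> + j) 7 6) ;;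
     While (40 + 2 * \<tau> + j) (nest \<tau> j c ;; tuple_incr \<tau> j)"

definition tuple_regs :: "nat \<Rightarrow> nat \<Rightarrow> nat set" where
  "tuple_regs \<tau> j = {r. \<exists>i<j. r = 40 + i \<or> r = 40 + \<tau> + i \<or> r = 40 + 2 * \<tau> + i}"

abbreviation interp_time :: "nat \<Rightarrow> nat \<Rightarrow> nat \<Rightarrow> nat" where
  "interp_time \<tau> n N \<equiv> (N + 1) * (body_time \<tau> n + 4 * \<tau> + 20)"

lemma reg_type_eq_vtype:
  assumes "\<And>i. i < \<tau> \<Longrightarrow> R (40 + i) = a i \<and> R (40 + \<tau> + i) = 2 + a i * n"
  shows "reg_type \<tau> x R = vtype \<tau> (cell_adj x n) a"
proof
  fix v
  show "reg_type \<tau> x R v = vtype \<tau> (cell_adj x n) a v"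
    unfolding reg_type_def vtype_def cell_adj_def
    by (intro arg_cong2[where f = "(+)"] arg_cong2[where f = "(*)"] refl sum.cong) (use assms in auto)
qed

text \<open>The summand 7 is the overhead of a round, 4 steps for \<open>tuple_incr\<close> and 3
  for the loop; having \<open>m + 1\<close> in place of \<open>m\<close> pays for setting up the
  loop.\<close>

lemma wp_nest:
  assumes "j \<le> \<tau>" "R 5 = n" "R 7 = m" "R 8 = g" "R 31 = N" "R 12 = count_list (digits (2 * \<tau> + 2) N) 3"
    and "\<And>i. j \<le> i \<Longrightarrow> i < \<tau> \<Longrightarrow> R (40 + i) = a i \<and> R (40 + \<tau> + i) = 2 + a i * n"
    and "\<And>t R'. t + 7 \<le> (m + 1) ^ j * (interp_time \<tau> n N + 7) \<Longrightarrow>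
       R' 10 = R 10 + tuple_sum m j (tuple_val 1 \<tau> g x n N) a \<Longrightarrow>
       R' 11 = R 11 + tuple_sum m j (tuple_val 2 \<tau> g x n N) a \<Longrightarrow>
       R' 12 = R 12 \<Longrightarrow>
       (\<And>r. r < 40 + 3 * \<tau> \<Longrightarrow> r \<notin> interp_regs \<Longrightarrow> r \<notin> tuple_regs \<tau> j \<Longrightarrow> R' r = R r) \<Longrightarrow> Q t R'"
  shows "wp x (nest \<tau> j (interp \<tau>)) Q R"
  using assms
proof (induction j arbitrary: R a Q)
  case 0
  have T: "reg_type \<tau> x R = vtype \<tau> (cell_adj x n) a"
    by (rule reg_type_eq_vtype) (use "0.prems"(7) in auto)
  let ?c = "count_type n (vtype \<tau> (cell_adj x n) a)"
  show ?case
    unfolding nest.simps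
  proof (rule wp_interp)
    show "R 5 = n" by (rule "0.prems")
    fix t R' w
    assume t: "t \<le> (R 31 + 1) * (body_time \<tau> n + 4 * \<tau> + 20)"
      and r: "letters_run \<tau> (R 8) (count_type n (reg_type \<tau> x R)) (digits (2 * \<tau> + 2) (R 31)) ([], R 10, R 11, 0)
        = (w, R' 10, R' 11, R' 12)"
      and f: "\<And>r. r < 40 + 3 * \<tau> \<Longrightarrow> r \<notin> interp_regs \<Longrightarrow> R' r = R r"
    have "(R' 10, R' 11, R' 12) = (R 10 + tuple_val 1 \<tau> g x n N a, R 11 + tuple_val 2 \<tau> g x n N a, R 12)"
      using letters_run_eq[of \<tau> g ?c "digits (2 * \<tau> + 2) N" "[]" "R 10" "R 11" 0] "0.prems"(4-6) r T
      by (simp add: tuple_val_def)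
    then have e: "R' 10 = R 10 + tuple_val 1 \<tau> g x n N a"
      "R' 11 = R 11 + tuple_val 2 \<tau> g x n N a" "R' 12 = R 12" by auto
    show "Q t R'"
      by (rule "0.prems"(8)) (use e t f "0.prems" in auto)
  qed
next
  case (Suc j)
  let ?S = "\<lambda>s i. \<Sum>u<i. tuple_sum m j (tuple_val s \<tau> g x n N) (a(j := u))"
  let ?b = "(m + 1) ^ j * (interp_time \<tau> n N + 7)"
  let ?I = "\<lambda>i R'. R' (40 + j) = i \<and> R' (40 + \<tau> + j) = 2 + i * n \<and> R' (40 + 2 * \<tau> + j) = m - i \<and>
    R' 10 = R 10 + ?S 1 i \<and> R' 11 = R 11 + ?S 2 i \<and> R' 12 = R 12 \<and>
    (\<forall>r < 40 + 3 * \<tau>. r \<notin> interp_regs \<longrightarrow> r \<notin> tuple_regs \<tau> (Suc j) \<longrightarrow> R' r = R r)"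
  have j: "j < \<tau>" using Suc.prems(1) by simp
  have dis: "40 + i \<notin> interp_regs" "5 \<notin> interp_regs" "7 \<notin> interp_regs" "8 \<notin> interp_regs" "31 \<notin> interp_regs" for i
    by (auto simp: interp_regs_def)
  have tr: "5 \<notin> tuple_regs \<tau> i" "7 \<notin> tuple_regs \<tau> i" "8 \<notin> tuple_regs \<tau> i" "31 \<notin> tuple_regs \<tau> i" for i
    by (auto simp: tuple_regs_def)
  have trj: "40 + j \<notin> tuple_regs \<tau> j" "40 + \<tau> + j \<notin> tuple_regs \<tau> j" "40 + 2 * \<tau> + j \<notin> tuple_regs \<tau> j"
    using j by (auto simp: tuple_regs_def)
  have trS: "40 + i \<notin> tuple_regs \<tau> (Suc j)" "40 + \<tau> + i \<notin> tuple_regs \<tau> (Suc j)" if "Suc j \<le> i" "i < \<tau>" for i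
    using j that by (auto simp: tuple_regs_def)
  have small: "r \<notin> tuple_regs \<tau> i" if "r < 40" for r i using that by (auto simp: tuple_regs_def)
  have loop: "wp x (While (40 + 2 * \<tau> + j) (nest \<tau> j (interp \<tau>) ;; tuple_incr \<tau> j)) (\<lambda>t. Q (4 + t))
     (R(40 + j := 0, 40 + \<tau> + j := 2, 6 := 0, 40 + 2 * \<tau> + j := m))"
  proof (rule wp_While_timed[where n = m and b = "?b - 3" and I = ?I])
    show "?I 0 (R(40 + j := 0, 40 + \<tau> + j := 2, 6 := 0, 40 + 2 * \<tau> + j := m))"
      using j by (auto simp: tuple_regs_def interp_regs_def)
  next
    fix i R1 assume i: "i < m" and I: "?I i R1"
    have fr: "\<And>r. r < 40 + 3 * \<tau> \<Longrightarrow> r \<notin> interp_regs \<Longrightarrow> r \<notin> tuple_regs \<tau> (Suc j) \<Longrightarrow> R1 r = R r"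
      using I by blast
    show "R1 (40 + 2 * \<tau> + j) \<noteq> 0 \<and> wp x (nest \<tau> j (interp \<tau>) ;; tuple_incr \<tau> j)
       (\<lambda>t R'. t \<le> ?b - 3 \<and> ?I (Suc i) (R'(0 := 0))) R1"
    proof
      show "R1 (40 + 2 * \<tau> + j) \<noteq> 0" using i I by simp
      show "wp x (nest \<tau> j (interp \<tau>) ;; tuple_incr \<tau> j)
       (\<lambda>t R'. t \<le> ?b - 3 \<and> ?I (Suc i) (R'(0 := 0))) R1"
        unfolding wp_Seq
      proof (rule Suc.IH[where a = "a(j := i)"])
        show "j \<le> \<tau>" using j by simp
        show "R1 5 = n" "R1 7 = m" "R1 8 = g" "R1 31 = N"
          using Suc.prems fr dis tr by simp_all
        show "R1 12 = count_list (digits (2 * \<tau> + 2) N) 3" using I Suc.prems by simp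
        show "R1 (40 + k) = (a(j := i)) k \<and> R1 (40 + \<tau> + k) = 2 + (a(j := i)) k * n" if "j \<le> k" "k < \<tau>" for k
        proof (cases "k = j")
          case True then show ?thesis using I by simp
        next
          case False
          then have k: "Suc j \<le> k" using that by simp
          have "R1 (40 + k) = R (40 + k)" "R1 (40 + \<tau> + k) = R (40 + \<tau> + k)"
            using k that trS[OF k that(2)] dis(1)[of k] dis(1)[of "\<tau> + k"] by (auto intro!: fr simp: add.assoc)
          then show ?thesis using Suc.prems(7)[OF k that(2)] False by simp
        qed
        fix t R2
        assume t: "t + 7 \<le> ?b"
          and p: "R2 10 = R1 10 + tuple_sum m j (tuple_val 1 \<tau> g x n N) (a(j := i))"
            "R2 11 = R1 11 + tuple_sum m j (tuple_val 2 \<tau> g x n N) (a(j := i))" "R2 12 = R1 12"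
          and f2: "\<And>r. r < 40 + 3 * \<tau> \<Longrightarrow> r \<notin> interp_regs \<Longrightarrow> r \<notin> tuple_regs \<tau> j \<Longrightarrow> R2 r = R1 r"
        have r2: "R2 (40 + j) = i" "R2 (40 + \<tau> + j) = 2 + i * n" "R2 (40 + 2 * \<tau> + j) = m - i" "R2 5 = n"
          using f2[of "40 + j"] f2[of "40 + \<tau> + j"] f2[of "40 + 2 * \<tau> + j"] f2[of 5] fr[of 5] I j trj dis tr
            dis(1)[of "\<tau> + j"] dis(1)[of "2 * \<tau> + j"] Suc.prems(2)
          by (auto simp: add.assoc)
        have f3: "R2 r = R r" if "r < 40 + 3 * \<tau>" "r \<notin> interp_regs" "r \<notin> tuple_regs \<tau> (Suc j)" for r
        proof -
          have "r \<notin> tuple_regs \<tau> j" using that(3) less_SucI unfolding tuple_regs_def by blast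
          then show ?thesis using f2 fr that by simp
        qed
        show "wp x (tuple_incr \<tau> j) (\<lambda>t' R'. t + t' \<le> ?b - 3 \<and> ?I (Suc i) (R'(0 := 0))) R2"
        proof -
          let ?R = "R2(40 + \<tau> + j := R2 (40 + \<tau> + j) + R2 5, 6 := 1, 40 + j := i + 1, 40 + 2 * \<tau> + j := m - i - 1, 0 := 0)"
          have "t + Suc (Suc (Suc (Suc 0))) \<le> ?b - 3" using t by simp
          moreover have "?I (Suc i) ?R"
          proof (intro conjI allI impI)
            show "?R r = R r" if "r < 40 + 3 * \<tau>" "r \<notin> interp_regs" "r \<notin> tuple_regs \<tau> (Suc j)" for r
            proof -
              have "r \<noteq> 40 + \<tau> + j" "r \<noteq> 6" "r \<noteq> 40 + j" "r \<noteq> 40 + 2 * \<tau> + j" "r \<noteq> 0"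
                using that by (auto simp: tuple_regs_def interp_regs_def)
              then show ?thesis using f3[OF that] by simp
            qed
          qed (use r2 j p I in auto)
          ultimately show ?thesis unfolding wp_tuple_incr[OF j] r2(1,3) by blast
        qed
      qed
    qed
  next
    fix R1 assume "?I m R1"
    then show "R1 (40 + 2 * \<tau> + j) = 0" by simp
  next
    fix t R1 assume I: "?I m R1" and t: "t \<le> m * (?b - 3 + 3) + 1"
    show "Q (4 + t) R1"
    proof (rule Suc.prems(8))
      have "20 \<le> interp_time \<tau> n N" by simp
      moreover have "interp_time \<tau> n N + 7 \<le> ?b" by simp
      ultimately have b: "20 \<le> ?b" by linarith
      then have "4 + t + 7 \<le> m * ?b + ?b" using t by simp
      then show "4 + t + 7 \<le> (m + 1) ^ Suc j * (interp_time \<tau> n N + 7)" by (simp add: algebra_simps)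
    qed (use I in auto)
  qed
  show ?case using j loop Suc.prems(3) by (simp add: eval_nat_numeral)
qed

text \<open>The term \<open>k * 2 ^ \<tau>\<close> demands length \<open>k\<close>, the term
  \<open>2 ^ \<tau> - 1\<close> that the bit of each tuple entry is set. For \<open>k = 0\<close> no
  vertex is left to carry the entries, so only the empty word is demanded, and
  \<open>tuple_bound\<close> admits exactly one tuple, also in the graph without vertices.\<close>

definition target :: "nat \<Rightarrow> nat \<Rightarrow> nat" where
  "target \<tau> k = (if k = 0 then 0 else k * 2 ^ \<tau> + (2 ^ \<tau> - 1))"

definition tuple_bound :: "nat \<Rightarrow> nat \<Rightarrow> nat" where
  "tuple_bound k n = (if k = 0 then 1 else n)"

definition count_val :: "nat \<Rightarrow> nat \<Rightarrow> nat \<Rightarrow> nat list \<Rightarrow> nat \<Rightarrow> nat \<Rightarrow> nat" where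
  "count_val s \<tau> k x n N =
     tuple_sum (tuple_bound k n) \<tau> (tuple_val s \<tau> (target \<tau> k) x n N) (\<lambda>_. 0)"

definition denom :: "nat \<Rightarrow> nat \<Rightarrow> nat" where
  "denom \<tau> N = count_list (digits (2 * \<tau> + 2) N) 3"

definition count_setup :: "nat \<Rightarrow> com" where
  "count_setup \<tau> = Op (Const 1 0) ;; Op (Read 30 1) ;; Op (Const 1 1) ;; Op (Read 5 1) ;;
     Op (Const 6 0) ;; Op (Add 7 5 6) ;; Op (Add 8 30 6) ;; repeat \<tau> (Op (Add 8 8 8)) ;;
     Op (Const 6 (2 ^ \<tau> - 1)) ;; Op (Add 8 8 6) ;; Op (Const 6 1) ;; Op (Sub 9 6 30) ;;
     If 9 (Op (Const 7 1) ;; Op (Const 8 0)) ;; Op (Const 10 0) ;; Op (Const 11 0)"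

definition count_output :: com where
  "count_output = Op (Const 6 0) ;; Op (Add 0 10 6) ;; Op (Add 1 11 6) ;; Op (Add 2 12 6)"

text \<open>
  The first call of \<open>interp\<close> only determines the denominator, which would be missing if there
  were no tuples at all.
\<close>

definition count_prog :: "nat \<Rightarrow> com" where
  "count_prog \<tau> = count_setup \<tau> ;; interp \<tau> ;; Op (Const 10 0) ;; Op (Const 11 0) ;;
     nest \<tau> \<tau> (interp \<tau>) ;; count_output"

lemma wp_count_setup:
  assumes "input_cell x 0 = k" "input_cell x 1 = n"
    and Q: "\<And>t R'. t \<le> \<tau> + 20 \<Longrightarrow> R' 5 = n \<Longrightarrow> R' 7 = tuple_bound k n \<Longrightarrow> R' 8 = target \<tau> k \<Longrightarrow>
      R' 31 = R 31 \<Longrightarrow> Q t R'"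
  shows "wp x (count_setup \<tau>) Q R"
  unfolding count_setup_def using assms(1,2)
  by (simp add: wp_repeat_double)
    (intro conjI impI; rule Q; simp add: tuple_bound_def target_def)

lemma wp_count_output:
  "wp x count_output Q R = Q (Suc (Suc (Suc (Suc 0)))) (R(6 := 0, 0 := R 10, 1 := R 11, 2 := R 12))"
  by (simp add: count_output_def)

text \<open>Of the initial registers only number 31 is specified, because the program is started
  both in the simulated memory of the tests and on the registers left behind by the search.\<close>

lemma wp_count_prog:
  assumes x: "input_cell x 0 = k" "input_cell x 1 = n" and N: "R 31 = N"
    and Q: "\<And>t R'. t \<le> interp_time \<tau> n N + (n + 2) ^ \<tau> * (interp_time \<tau> n N + 7) + \<tau> + 30 \<Longrightarrow>
      R' 0 = count_val 1 \<tau> k x n N \<Longrightarrow> R' 1 = count_val 2 \<tau> k x n N \<Longrightarrow> R' 2 = denom \<tau> N \<Longrightarrow> Q t R'"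
  shows "wp x (count_prog \<tau>) Q R"
proof -
  let ?m = "tuple_bound k n" and ?g = "target \<tau> k"
  show ?thesis
    unfolding count_prog_def wp_Seq wp_ops
  proof (rule wp_count_setup[OF x], rule wp_interp[where n = n])
    fix t0 :: nat and R0 :: "nat \<Rightarrow> nat"
    assume t0: "t0 \<le> \<tau> + 20" and R0: "R0 5 = n" "R0 7 = ?m" "R0 8 = ?g" "R0 31 = R 31"
    show "R0 5 = n" by (rule R0)
    fix t R1 w
    assume t: "t \<le> (R0 31 + 1) * (body_time \<tau> n + 4 * \<tau> + 20)"
      and r: "letters_run \<tau> (R0 8) (count_type n (reg_type \<tau> x R0)) (digits (2 * \<tau> + 2) (R0 31))
        ([], R0 10, R0 11, 0) = (w, R1 10, R1 11, R1 12)"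
      and f: "\<And>r. r < 40 + 3 * \<tau> \<Longrightarrow> r \<notin> interp_regs \<Longrightarrow> R1 r = R0 r"
    have e: "R1 5 = n" "R1 7 = ?m" "R1 8 = ?g" "R1 31 = N"
      using R0 N f by (auto simp: interp_regs_def)
    have d: "R1 12 = denom \<tau> N"
      using arg_cong[OF r, of "\<lambda>z. snd (snd (snd z))"] R0(4) N by (simp add: letters_run_eq denom_def)
    show "wp x (nest \<tau> \<tau> (interp \<tau>)) (\<lambda>t'. wp x count_output
        (\<lambda>t''. Q (t0 + (t + (Suc 0 + (Suc 0 + (t' + t''))))))) (R1(10 := 0, 11 := 0))"
    proof (rule wp_nest[where n = n and m = ?m and g = ?g and N = N and a = "\<lambda>_. 0"])
      fix t' and R2 :: "nat \<Rightarrow> nat"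
      assume q: "t' + 7 \<le> (?m + 1) ^ \<tau> * (interp_time \<tau> n N + 7)"
        "R2 10 = (R1(10 := 0, 11 := 0)) 10 + tuple_sum ?m \<tau> (tuple_val 1 \<tau> ?g x n N) (\<lambda>_. 0)"
        "R2 11 = (R1(10 := 0, 11 := 0)) 11 + tuple_sum ?m \<tau> (tuple_val 2 \<tau> ?g x n N) (\<lambda>_. 0)"
        "R2 12 = (R1(10 := 0, 11 := 0)) 12"
      have "(?m + 1) ^ \<tau> \<le> (n + 2) ^ \<tau>" by (intro power_mono) (auto simp: tuple_bound_def)
      then have "(?m + 1) ^ \<tau> * (interp_time \<tau> n N + 7) \<le> (n + 2) ^ \<tau> * (interp_time \<tau> n N + 7)"
        by (rule mult_right_mono) simp
      then have t2: "t' + 7 \<le> (n + 2) ^ \<tau> * (interp_time \<tau> n N + 7)" using q(1) by linarith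
      have t1: "t \<le> interp_time \<tau> n N" using t R0(4) N by simp
      show "wp x count_output (\<lambda>t''. Q (t0 + (t + (Suc 0 + (Suc 0 + (t' + t'')))))) R2"
        unfolding wp_count_output
      proof (rule Q)
        show "t0 + (t + (Suc 0 + (Suc 0 + (t' + Suc (Suc (Suc (Suc 0))))))) \<le>
          interp_time \<tau> n N + (n + 2) ^ \<tau> * (interp_time \<tau> n N + 7) + \<tau> + 30"
          using t1 t2 t0 by linarith
      qed (use q d in \<open>auto simp: count_val_def\<close>)
    qed (use e d in \<open>auto simp: denom_def\<close>)
  qed
qed

definition count_const :: "nat \<Rightarrow> nat" where
  "count_const \<tau> = (2 ^ \<tau> + 1) * (2 ^ (2 * \<tau> + 3) + 19 * \<tau> + 101) + \<tau> + 30"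

text \<open>The tuples contribute \<open>\<tau>\<close> factors \<open>n + 1\<close> and
  \<open>interp_time\<close>, which is linear in \<open>n\<close>, contributes one more. The base
  \<open>n + 1\<close> lets constants be absorbed also for \<open>n = 0\<close>; passing to it from
  \<open>n + 2\<close> costs the \<open>2 ^ \<tau>\<close> in \<open>count_const\<close>.\<close>

lemma count_time:
  "interp_time \<tau> n N + (n + 2) ^ \<tau> * (interp_time \<tau> n N + 7) + \<tau> + 30
    \<le> count_const \<tau> * ((N + 1) * (n + 1) ^ (\<tau> + 1))"
proof -
  let ?K = "2 ^ (2 * \<tau> + 3) + 19 * \<tau> + 101" and ?M = "(N + 1) * (n + 1)"
  have "body_time \<tau> n + 4 * \<tau> + 27 \<le> (n + 1) * ?K" by (simp add: algebra_simps)
  then have "(N + 1) * (body_time \<tau> n + 4 * \<tau> + 27) \<le> (N + 1) * ((n + 1) * ?K)"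
    by (rule mult_le_mono2)
  also have "\<dots> = ?K * ?M" by (simp only: ac_simps)
  finally have "(N + 1) * (body_time \<tau> n + 4 * \<tau> + 27) \<le> ?K * ?M" .
  moreover have "interp_time \<tau> n N + 7 \<le> (N + 1) * (body_time \<tau> n + 4 * \<tau> + 27)"
    by (simp add: algebra_simps)
  ultimately have 1: "interp_time \<tau> n N + 7 \<le> ?K * ?M" by (rule order.trans[rotated])
  have "(n + 2) ^ \<tau> \<le> (2 * (n + 1)) ^ \<tau>" by (intro power_mono) auto
  then have 2: "(n + 2) ^ \<tau> \<le> 2 ^ \<tau> * (n + 1) ^ \<tau>" by (simp only: power_mult_distrib)
  have 3: "(1::nat) \<le> (n + 1) ^ \<tau>" by simp
  have "(n + 2) ^ \<tau> * (interp_time \<tau> n N + 7) \<le> (2 ^ \<tau> * (n + 1) ^ \<tau>) * (?K * ?M)"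
    by (intro mult_le_mono 1 2)
  moreover have "interp_time \<tau> n N \<le> (n + 1) ^ \<tau> * (?K * ?M)"
    using mult_le_mono[OF 3 1] unfolding mult_1 by (rule add_leD1)
  moreover have "\<tau> + 30 \<le> (\<tau> + 30) * ((n + 1) ^ \<tau> * ?M)"
    using mult_le_mono2[of 1 "(n + 1) ^ \<tau> * ?M" "\<tau> + 30"] by (simp add: Suc_le_eq)
  ultimately have "interp_time \<tau> n N + (n + 2) ^ \<tau> * (interp_time \<tau> n N + 7) + \<tau> + 30 \<le>
    (n + 1) ^ \<tau> * (?K * ?M) + (2 ^ \<tau> * (n + 1) ^ \<tau>) * (?K * ?M) + (\<tau> + 30) * ((n + 1) ^ \<tau> * ?M)"
    unfolding add.assoc by (intro add_mono) (simp_all only: add.assoc)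
  also have "\<dots> = count_const \<tau> * ((N + 1) * (n + 1) ^ (\<tau> + 1))"
    unfolding count_const_def by (simp add: algebra_simps)
  finally show ?thesis .
qed

section \<open>The search program\<close>

text \<open>
  The adjacency matrix of the graph with number \<open>h\<close> (register 33) starts at address 102 and is preceded
  by two cells containing \<open>k\<close>, so that the input of the counting program starts at 100 and that of
  the program for \<open>\<Phi>\<close> at 101. Registers 30, 31, 37, 38 hold \<open>k\<close>, the candidate code, \<open>k * k\<close> and 0; register 36
  says whether the candidate has passed all tests so far.
\<close>

lemma wp_While_count:
  assumes "I 0 R"
    and "\<And>i R. i < n \<Longrightarrow> I i R \<Longrightarrow> R r \<noteq> 0 \<and> wp x c (\<lambda>_ R'. I (Suc i) (R'(0 := 0))) R"
    and "\<And>R. I n R \<Longrightarrow> R r = 0"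
    and "\<And>R'. I n R' \<Longrightarrow> Q R'"
  shows "wp x (While r c) (\<lambda>_. Q) R"
proof (rule wp_While_variant[where I = "\<lambda>m R. \<exists>i\<le>n. m = n - i \<and> I i R" and i = n])
  show "\<exists>i\<le>n. n = n - i \<and> I i R" using assms(1) by (intro exI[of _ 0]) auto
next
  fix m R assume "\<exists>i\<le>n. m = n - i \<and> I i R" "R r \<noteq> 0"
  then obtain i where i: "i \<le> n" "m = n - i" "I i R" by blast
  then have "i < n" using assms(3) \<open>R r \<noteq> 0\<close> by (cases "i = n") auto
  show "wp x c (\<lambda>t R'. \<exists>j. (\<exists>i\<le>n. j = n - i \<and> I i (R'(0 := 0))) \<and> j < m) R"
    using conjunct2[OF assms(2)[OF \<open>i < n\<close> i(3)]]
    by (rule wp_mono) (use i \<open>i < n\<close> in \<open>intro exI[of _ "n - Suc i"] conjI exI[of _ "Suc i"]; simp\<close>)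
next
  fix t m R' assume "\<exists>i\<le>n. m = n - i \<and> I i R'" "R' r = 0"
  then obtain i where i: "i \<le> n" "I i R'" by blast
  then have "i = n" using assms(2) \<open>R' r = 0\<close> by (metis le_neq_implies_less)
  then show "Q R'" using i assms(4) by blast
qed

definition mul :: "nat \<Rightarrow> nat \<Rightarrow> nat \<Rightarrow> com" where
  "mul d a b = Op (Const d 0) ;; Op (Add 46 b d) ;;
     While 46 (Op (Add d d a) ;; Op (Const 47 1) ;; Op (Sub 46 46 47))"

lemma wp_mul:
  assumes "d \<notin> {0, 46, 47, a, b}" "a \<notin> {0, 46, 47}" "b \<notin> {46, 47}"
    and "\<And>M'. M' d = M a * M b \<Longrightarrow> (\<And>r. r \<notin> {0, 46, 47, d} \<Longrightarrow> M' r = M r) \<Longrightarrow> Q M'"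
  shows "wp y (mul d a b) (\<lambda>_. Q) M"
  unfolding mul_def using assms(1-3)
  apply simp
  apply (rule wp_While_count[where n = "M b" and I = "\<lambda>i M'. M' d = i * M a \<and> M' 46 = M b - i \<and>
     (\<forall>r. r \<notin> {0, 46, 47, d} \<longrightarrow> M' r = M r)"])
  subgoal by auto
  subgoal by (auto simp: algebra_simps)
  subgoal by auto
  subgoal by (rule assms(4)) (auto simp: mult.commute)
  done

text \<open>The diagonal of the matrix is never written with anything but its initial zeros, so
  these belong to the invariant. The cell \<open>102 + k * k\<close> is the 0 by which a simulated
  input must be followed.\<close>

definition search_inv :: "nat \<Rightarrow> (nat \<Rightarrow> nat) \<Rightarrow> bool" where
  "search_inv k M \<longleftrightarrow> M 30 = k \<and> M 37 = k * k \<and> M 38 = 0 \<and> M 100 = k \<and> M 101 = k \<and>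
     M (102 + k * k) = 0 \<and> 102 + k * k < M 12 \<and> (\<forall>a\<ge>M 12. M a = 0) \<and> (\<forall>u<k. M (102 + u * k + u) = 0)"

section \<open>Writing down the graph with a given number\<close>

definition fill_bit :: com where
  "fill_bit = Op (Half 55 34) ;; Op (Add 56 55 55) ;; Op (Sub 56 34 56) ;; Op (Const 57 0) ;;
     Op (Add 34 55 57) ;; Op (Sub 57 50 51)"

lemma wp_fill_bit:
  assumes "\<And>M'. M' 34 = M 34 div 2 \<Longrightarrow> M' 56 = M 34 mod 2 \<Longrightarrow> M' 57 = M 50 - M 51 \<Longrightarrow>
    (\<And>a. a \<notin> {34, 55, 56, 57} \<Longrightarrow> M' a = M a) \<Longrightarrow> Q M'"
  shows "wp y fill_bit (\<lambda>_. Q) M"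
proof -
  have bit: "z - (z div 2 + z div 2) = z mod 2" for z :: nat by presburger
  show ?thesis unfolding fill_bit_def by (simp add: bit) (rule assms; simp)
qed

definition fill_next :: com where
  "fill_next = Op (Const 57 1) ;; Op (Add 52 52 57) ;; Op (Add 51 51 57) ;; Op (Add 53 53 30) ;;
     Op (Sub 54 54 57) ;; Op (Sub 55 30 51) ;; Op (Sub 55 57 55) ;;
     If 55 (Op (Const 51 0) ;; Op (Add 50 50 57) ;; Op (Const 53 102) ;; Op (Add 53 53 50))"

lemma wp_fill_next:
  assumes "M 30 = k" "M 51 < k"
    and "\<And>M'. M' 52 = Suc (M 52) \<Longrightarrow> M' 54 = M 54 - 1 \<Longrightarrow>
     (M' 50, M' 51, M' 53) = (if Suc (M 51) = k then (Suc (M 50), 0, 102 + Suc (M 50))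
       else (M 50, Suc (M 51), M 53 + k)) \<Longrightarrow>
    (\<And>a. a \<notin> {50, 51, 52, 53, 54, 55, 57} \<Longrightarrow> M' a = M a) \<Longrightarrow> Q M'"
  shows "wp y fill_next (\<lambda>_. Q) M"
proof (cases "Suc (M 51) = k")
  case True
  then show ?thesis
    unfolding fill_next_def using assms(1) by simp (rule assms(3); simp)
next
  case False
  then have "Suc 0 \<le> k - Suc (M 51)" using assms(2) by simp
  with False show ?thesis
    unfolding fill_next_def using assms(1) by simp (rule assms(3); simp)
qed

text \<open>Registers 52 and 53 traverse the matrix by rows and by columns simultaneously, so that
  the two cells of an unordered pair are found without multiplication. Register 57 is nonzero below
  the diagonal only; the other bits of the graph number are consumed without effect, which makes the
  index of a bit equal to the index of its cell.\<close>

definition fill_step :: com where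
  "fill_step = fill_bit ;; If 57 (Op (Store 52 56) ;; Op (Store 53 56)) ;; fill_next"

definition fill :: com where
  "fill = Op (Const 50 0) ;; Op (Const 51 0) ;; Op (Const 52 102) ;; Op (Const 53 102) ;;
     Op (Add 34 33 50) ;; Op (Add 54 37 50) ;; While 54 fill_step"

definition bit_mat :: "nat \<Rightarrow> nat \<Rightarrow> nat \<Rightarrow> nat \<Rightarrow> nat" where
  "bit_mat h k u v = (if v < u then h div 2 ^ (u * k + v) mod 2
     else if u < v then h div 2 ^ (v * k + u) mod 2 else 0)"

lemma cell_div_mod:
  assumes "v < (k::nat)"
  shows "(u * k + v) div k = u" "(u * k + v) mod k = v"
  using assms by simp_all

lemma cell_eq_iff:
  assumes "v < k" "v' < (k::nat)"
  shows "u * k + v = u' * k + v' \<longleftrightarrow> u = u' \<and> v = v'"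
proof
  assume e: "u * k + v = u' * k + v'"
  then show "u = u' \<and> v = v'" using cell_div_mod[OF assms(1), of u] cell_div_mod[OF assms(2), of u'] by simp
qed simp

lemma cell_less: "u < k \<Longrightarrow> v < k \<Longrightarrow> u * k + v < k * (k::nat)"
proof -
  assume "u < k" "v < k"
  then have "u * k + v < Suc u * k" by simp
  also have "\<dots> \<le> k * k" using \<open>u < k\<close> by (intro mult_le_mono1) simp
  finally show ?thesis .
qed

definition fill_inv :: "nat \<Rightarrow> nat \<Rightarrow> (nat \<Rightarrow> nat) \<Rightarrow> nat \<Rightarrow> (nat \<Rightarrow> nat) \<Rightarrow> bool" where
  "fill_inv k h M c M' \<longleftrightarrow> M' 34 = h div 2 ^ c \<and> M' 50 = c div k \<and> M' 51 = c mod k \<and> M' 52 = 102 + c \<and>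
     M' 53 = 102 + (c mod k) * k + c div k \<and> M' 54 = k * k - c \<and>
     (\<forall>u<k. \<forall>v<u. u * k + v < c \<longrightarrow> M' (102 + u * k + v) = h div 2 ^ (u * k + v) mod 2 \<and>
        M' (102 + v * k + u) = h div 2 ^ (u * k + v) mod 2) \<and>
     (\<forall>u<k. M' (102 + u * k + u) = 0) \<and>
     (\<forall>a. a \<notin> {0, 34, 50, 51, 52, 53, 54, 55, 56, 57} \<longrightarrow> \<not> (102 \<le> a \<and> a < 102 + k * k) \<longrightarrow> M' a = M a)"

lemma wp_fill_step:
  assumes inv: "fill_inv k h M c M'" and c: "c < k * k" and k: "M 30 = k"
  shows "wp y fill_step (\<lambda>_ M''. fill_inv k h M (Suc c) (M''(0 := 0))) M'"
proof -
  define u v where "u = c div k" and "v = c mod k"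
  have k0: "0 < k" using c by (cases k) auto
  have cuv: "c = u * k + v" unfolding u_def v_def by simp
  have v: "v < k" unfolding v_def using k0 by simp
  have u: "u < k" unfolding u_def using c k0 by (simp add: less_mult_imp_div_less)
  have r: "M' 34 = h div 2 ^ c" "M' 50 = u" "M' 51 = v" "M' 52 = 102 + c" "M' 53 = 102 + v * k + u"
    "M' 54 = k * k - c" "M' 30 = k"
    using inv k by (auto simp: fill_inv_def u_def v_def)
  define b where "b = h div 2 ^ c mod 2"
  have half: "h div 2 ^ c div 2 = h div 2 ^ Suc c"
    by (metis div_mult2_eq power_Suc2)
  define W where "W = (if v < u then M'(102 + c := b, 102 + v * k + u := b) else M')"
  define s where "s = (if Suc v = k then (Suc u, 0, 102 + Suc u) else (u, Suc v, 102 + v * k + u + k))"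
  have s: "fst s = Suc c div k" "fst (snd s) = Suc c mod k" "snd (snd s) = 102 + Suc c mod k * k + Suc c div k"
    unfolding atomize_conj
  proof (cases "Suc v = k")
    case True
    then have "Suc c = Suc u * k + 0" using cuv by simp
    then have "Suc c div k = Suc u" "Suc c mod k = 0" using k0 by simp_all
    then show "fst s = Suc c div k \<and> fst (snd s) = Suc c mod k \<and> snd (snd s) = 102 + Suc c mod k * k + Suc c div k"
      using True by (simp add: s_def)
  next
    case False
    then have "Suc v < k" using v by simp
    moreover have "Suc c = u * k + Suc v" using cuv by simp
    ultimately have "Suc c div k = u" "Suc c mod k = Suc v" using cell_div_mod[of "Suc v" k u] by simp_all
    then show "fst s = Suc c div k \<and> fst (snd s) = Suc c mod k \<and> snd (snd s) = 102 + Suc c mod k * k + Suc c div k"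
      using False by (simp add: s_def)
  qed
  have fin: "fill_inv k h M (Suc c) M2"
    if M2: "M2 34 = h div 2 ^ Suc c" "M2 50 = fst s" "M2 51 = fst (snd s)" "M2 52 = 102 + Suc c"
      "M2 53 = snd (snd s)" "M2 54 = k * k - Suc c"
      "\<And>a. a \<notin> {0, 34, 50, 51, 52, 53, 54, 55, 56, 57} \<Longrightarrow> M2 a = W a" for M2
  proof -
    have big: "M2 (102 + a) = W (102 + a)" for a by (rule M2(7)) auto
    have W: "W (102 + (u' * k + v')) = (if v < u \<and> (u' = u \<and> v' = v \<or> u' = v \<and> v' = u) then b
       else M' (102 + (u' * k + v')))" if "u' < k" "v' < k" for u' v'
      using cell_eq_iff[OF v that(2), of u u'] cell_eq_iff[OF u that(2), of v u']
      unfolding W_def cuv by auto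
    show ?thesis
      unfolding fill_inv_def
    proof (intro conjI allI impI)
      fix u' v' assume h: "u' < k" "v' < u'" "u' * k + v' < Suc c"
      then have v': "v' < k" by simp
      have "u' * k + v' = c \<longleftrightarrow> u' = u \<and> v' = v"
        unfolding cuv using cell_eq_iff[OF v' v] by auto
      moreover have "M' (102 + u' * k + v') = h div 2 ^ (u' * k + v') mod 2 \<and>
        M' (102 + v' * k + u') = h div 2 ^ (u' * k + v') mod 2" if "u' * k + v' < c"
        using inv h that by (simp add: fill_inv_def)
      ultimately show "M2 (102 + u' * k + v') = h div 2 ^ (u' * k + v') mod 2"
        "M2 (102 + v' * k + u') = h div 2 ^ (u' * k + v') mod 2"
        using h v' W[OF h(1) v'] W[OF v' h(1)] big b_def cuv
        by (auto simp: add.assoc less_Suc_eq)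
    next
      fix u' assume "u' < k"
      then show "M2 (102 + u' * k + u') = 0"
        using W[of u' u'] big inv by (auto simp: add.assoc fill_inv_def)
    next
      fix a assume a: "a \<notin> {0, 34, 50, 51, 52, 53, 54, 55, 56, 57}" "\<not> (102 \<le> a \<and> a < 102 + k * k)"
      have "a \<noteq> 102 + c" "a \<noteq> 102 + v * k + u" using a(2) c cell_less[OF v u] by auto
      then have "W a = M' a" by (simp add: W_def)
      moreover have "M' a = M a" using inv a unfolding fill_inv_def by blast
      ultimately show "M2 a = M a" using M2(7)[OF a(1)] by simp
    qed (use M2 s in auto)
  qed
  have nxt: "wp y fill_next (\<lambda>_ M''. fill_inv k h M (Suc c) (M''(0 := 0))) M1"
    if M1: "M1 34 = h div 2 ^ Suc c" "\<And>a. a \<notin> {34, 55, 56, 57} \<Longrightarrow> M1 a = W a" for M1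
  proof -
    have "W a = M' a" if "a < 102" for a using that by (simp add: W_def)
    then have e: "M1 50 = u" "M1 51 = v" "M1 52 = 102 + c" "M1 53 = 102 + v * k + u" "M1 54 = k * k - c" "M1 30 = k"
      using M1(2) r by simp_all
    show ?thesis
    proof (rule wp_fill_next[where k = k])
      fix M2 :: "nat \<Rightarrow> nat"
      assume q: "M2 52 = Suc (M1 52)" "M2 54 = M1 54 - 1"
        "(M2 50, M2 51, M2 53) = (if Suc (M1 51) = k then (Suc (M1 50), 0, 102 + Suc (M1 50))
         else (M1 50, Suc (M1 51), M1 53 + k))"
        "\<And>a. a \<notin> {50, 51, 52, 53, 54, 55, 57} \<Longrightarrow> M2 a = M1 a"
      have "(M2 50, M2 51, M2 53) = s" using q(3) e by (simp add: s_def)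
      then have "M2 50 = fst s" "M2 51 = fst (snd s)" "M2 53 = snd (snd s)" by auto
      then show "fill_inv k h M (Suc c) (M2(0 := 0))"
        by (intro fin) (use q(1,2) e q(4) M1 in simp_all)
    qed (use e v in simp_all)
  qed
  show ?thesis
    unfolding fill_step_def wp_Seq
  proof (rule wp_fill_bit)
    fix M1 :: "nat \<Rightarrow> nat"
    assume q: "M1 34 = M' 34 div 2" "M1 56 = M' 34 mod 2" "M1 57 = M' 50 - M' 51"
      "\<And>a. a \<notin> {34, 55, 56, 57} \<Longrightarrow> M1 a = M' a"
    have e: "M1 34 = h div 2 ^ Suc c" "M1 56 = b" "M1 57 = u - v" "M1 52 = 102 + c" "M1 53 = 102 + v * k + u"
      using q r half by (simp_all add: b_def)
    show "wp y (If 57 (Op (Store 52 56) ;; Op (Store 53 56)))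
       (\<lambda>_. wp y fill_next (\<lambda>_ M''. fill_inv k h M (Suc c) (M''(0 := 0)))) M1"
    proof (cases "v < u")
      case True
      then have "wp y fill_next (\<lambda>_ M''. fill_inv k h M (Suc c) (M''(0 := 0)))
         (M1(102 + c := b, 102 + v * k + u := b))"
        by (intro nxt) (use e q(4) in \<open>simp_all add: W_def\<close>)
      then show ?thesis using True e by simp
    next
      case False
      then have "wp y fill_next (\<lambda>_ M''. fill_inv k h M (Suc c) (M''(0 := 0))) M1"
        by (intro nxt) (use e q(4) in \<open>simp_all add: W_def\<close>)
      then show ?thesis using False e by simp
    qed
  qed
qed

text \<open>What is left of the graph number after \<open>k * k\<close> halvings is 0 exactly if the
  number is less than \<open>2 ^ (k * k)\<close>; \<open>check\<close> uses this remainder to end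
  the enumeration of the graphs.\<close>

lemma wp_fill:
  assumes "search_inv k M"
    and "\<And>M'. search_inv k M' \<Longrightarrow> M' 34 = M 33 div 2 ^ (k * k) \<Longrightarrow>
      (\<And>u v. u < k \<Longrightarrow> v < k \<Longrightarrow> M' (102 + u * k + v) = bit_mat (M 33) k u v) \<Longrightarrow>
      (\<And>a. a < 100 \<Longrightarrow> a \<notin> {0, 34, 50, 51, 52, 53, 54, 55, 56, 57} \<Longrightarrow> M' a = M a) \<Longrightarrow> Q M'"
  shows "wp y fill (\<lambda>_. Q) M"
proof -
  have s: "M 30 = k" "M 37 = k * k" "M 38 = 0" "M 100 = k" "M 101 = k" "M (102 + k * k) = 0" "102 + k * k < M 12"
    "\<And>a. M 12 \<le> a \<Longrightarrow> M a = 0" "\<And>u. u < k \<Longrightarrow> M (102 + u * k + u) = 0"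
    using assms(1) by (simp_all add: search_inv_def)
  let ?M = "M(50 := 0, 51 := 0, 52 := 102, 53 := 102, 34 := M 33, 54 := k * k)"
  have "wp y (While 54 fill_step) (\<lambda>_. Q) ?M"
  proof (rule wp_While_count[where n = "k * k" and I = "fill_inv k (M 33) M"])
    show "fill_inv k (M 33) M 0 ?M"
      unfolding fill_inv_def
    proof (intro conjI allI impI)
      show "?M (102 + u * k + u) = 0" if "u < k" for u using s(9)[OF that] by simp
    qed simp_all
  next
    fix i M' assume i: "i < k * k" and I: "fill_inv k (M 33) M i M'"
    have "M' 54 \<noteq> 0" using I i unfolding fill_inv_def by linarith
    then show "M' 54 \<noteq> 0 \<and> wp y fill_step (\<lambda>_ R'. fill_inv k (M 33) M (Suc i) (R'(0 := 0))) M'"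
      using wp_fill_step[OF I i s(1)] by blast
  next
    fix M' assume "fill_inv k (M 33) M (k * k) M'"
    then show "M' 54 = 0" unfolding fill_inv_def by linarith
  next
    fix M' assume p: "fill_inv k (M 33) M (k * k) M'"
    have d: "M' (102 + u * k + u) = 0" if "u < k" for u using p that unfolding fill_inv_def by blast
    have f: "M' a = M a" if "a \<notin> {0, 34, 50, 51, 52, 53, 54, 55, 56, 57}" "\<not> (102 \<le> a \<and> a < 102 + k * k)" for a
      using p that unfolding fill_inv_def by blast
    show "Q M'"
    proof (rule assms(2))
      have e: "M' 12 = M 12" by (rule f) auto
      show "search_inv k M'"
        unfolding search_inv_def e
      proof (intro conjI allI impI)
        show "M' a = 0" if "M 12 \<le> a" for a
          using f[of a] s(7) s(8)[OF that] that by simp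
        show "M' (102 + k * k) = 0" using f[of "102 + k * k"] s(6) by simp
        show "M' 30 = k" "M' 37 = k * k" "M' 38 = 0" "M' 100 = k" "M' 101 = k"
          using f[of 30] f[of 37] f[of 38] f[of 100] f[of 101] s(1-5) by simp_all
      qed (use s(7) d in simp_all)
      show "M' 34 = M 33 div 2 ^ (k * k)" using p unfolding fill_inv_def by blast
      have low: "M' (102 + u * k + v) = M 33 div 2 ^ (u * k + v) mod 2 \<and>
          M' (102 + v * k + u) = M 33 div 2 ^ (u * k + v) mod 2" if "u < k" "v < u" for u v
        using p that cell_less[of u k v] unfolding fill_inv_def by simp
      show "M' (102 + u * k + v) = bit_mat (M 33) k u v" if "u < k" "v < k" for u v
        using low[of u v] low[of v u] d[of u] that
        by (cases u v rule: linorder_cases) (simp_all add: bit_mat_def)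
      show "M' a = M a" if "a < 100" "a \<notin> {0, 34, 50, 51, 52, 53, 54, 55, 56, 57}" for a
        using f that by simp
    qed
  qed
  then show ?thesis using s(2) by (simp add: fill_def)
qed

section \<open>Testing a candidate on one graph\<close>

definition sim_call :: "instr list \<Rightarrow> nat \<Rightarrow> nat \<Rightarrow> nat \<Rightarrow> com" where
  "sim_call P l s d = Op (Const 14 l) ;; Op (Const 13 (102 - l)) ;; Op (Add 13 13 37) ;; Op (Const 16 0) ;;
     Op (Add 11 12 16) ;; Op (Add 17 s 16) ;; sim_set 31 17 ;; sim P ;;
     sim_get d 0 ;; sim_get (d + 1) 1 ;; sim_get (d + 2) 2"

lemma sim_state_upd':
  assumes "r < 100" "r \<notin> {11, 12, 13, 14}" "sim_state x R M"
  shows "sim_state x R (M(r := v))"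
proof -
  have "r \<noteq> 11" "r \<noteq> 12" "r \<noteq> 13" "r \<noteq> 14" using assms(2) by auto
  then show ?thesis using assms(1,3) by (auto simp: sim_state_def)
qed

lemma wp_sim_get':
  assumes "sim_state x R M" "d < 100" "d \<notin> {11, 12, 13, 14, 15}"
    and Q: "\<And>M'. sim_state x R M' \<Longrightarrow> M' d = R j \<Longrightarrow> (\<And>r. r \<notin> {15, d} \<Longrightarrow> M' r = M r) \<Longrightarrow> Q M'"
  shows "wp y (sim_get d j) (\<lambda>_. Q) M"
proof -
  have "sim_state x R (M(15 := M 11 + j, d := R j))"
    by (intro sim_state_upd' assms(1)) (use assms(2,3) in auto)
  then have "Q (M(15 := M 11 + j, d := R j))" by (rule Q) auto
  then show ?thesis using wp_sim_get[OF assms(1)] assms(3) by simp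
qed

lemma search_inv_facts:
  assumes "search_inv k M"
  shows "M 30 = k" "M 37 = k * k" "M 38 = 0" "M 100 = k" "M 101 = k" "M (102 + k * k) = 0" "102 + k * k < M 12"
    "\<And>a. M 12 \<le> a \<Longrightarrow> M a = 0" "\<And>u. u < k \<Longrightarrow> M (102 + u * k + u) = 0"
  using assms by (simp_all add: search_inv_def)

text \<open>The simulated memory starts at the address in register 12, beyond everything used so
  far, so that each run finds zeros. The simulated register 31 receives the candidate code, where
  the counting program expects it; for \<open>\<Phi>\<close> the source is register 38, whose 0
  leaves the simulated memory blank. The address \<open>l\<close> decides whether the additional
  leading \<open>k\<close> belongs to the input.\<close>

lemma wp_sim_call:
  assumes inv: "search_inv k M" and ls: "l \<in> {100, 101}" "s \<in> {31, 38}" "d \<in> {40, 43}"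
    and x: "length x = k * k + (102 - l)" "\<And>i. i \<le> length x \<Longrightarrow> M (l + i) = input_cell x i"
    and run: "(ram_step P x ^^ t) (0, (\<lambda>_. 0)(31 := M s)) = (pc, R)" "length P \<le> pc"
    and Q: "\<And>M'. search_inv k M' \<Longrightarrow> M' d = R 0 \<Longrightarrow> M' (d + 1) = R 1 \<Longrightarrow> M' (d + 2) = R 2 \<Longrightarrow>
      (\<And>a. a < M 12 \<Longrightarrow> a \<notin> sim_regs \<union> {11, 13, 14, d, d + 1, d + 2} \<Longrightarrow> M' a = M a) \<Longrightarrow> Q M'"
  shows "wp y (sim_call P l s d) (\<lambda>_. Q) M"
proof -
  note f = search_inv_facts[OF inv]
  define M1 where "M1 = M(14 := l, 13 := length x, 16 := 0, 11 := M 12, 17 := M s)"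
  have l: "100 \<le> l" "l + length x = 102 + k * k" using ls x by auto
  have st1: "sim_state x (\<lambda>_. 0) M1"
    unfolding sim_state_def
  proof (intro conjI allI impI)
    show "M1 (M1 11 + i) = 0" for i using f(7) f(8)[of "M 12 + i"] by (simp add: M1_def)
    show "M1 a = 0" if "M1 12 \<le> a" for a using f(7) f(8)[of a] that by (simp add: M1_def)
    show "M1 14 + length x < M1 11" using f(7) l by (simp add: M1_def)
    show "M1 (M1 14 + i) = input_cell x i" if "i \<le> length x" for i
      using x(2)[OF that] l(1) by (simp add: M1_def)
  qed (use l in \<open>simp_all add: M1_def\<close>)
  obtain c where sim: "\<And>y Q M. sim_state x ((\<lambda>_. 0)(31 := M1 17)) M \<Longrightarrow>
      (\<And>M'. sim_state x R M' \<Longrightarrow> sim_frame M M' \<Longrightarrow> M' 21 = c \<Longrightarrow> Q M') \<Longrightarrow> wp y (sim P) (\<lambda>_. Q) M"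
    using wp_sim[OF run] by (metis M1_def fun_upd_same)
  have fin: "Q M'" if M': "sim_state x R M'" "sim_frame M2 M3" "sim_frame M1 M2"
    "M' d = R 0" "M' (d + 1) = R 1" "M' (d + 2) = R 2"
    "\<And>r. r \<notin> {15, d, d + 1, d + 2} \<Longrightarrow> M' r = M3 r" for M2 M3 M'
  proof -
    have fr: "sim_frame M1 M3" using M'(2,3) sim_state_base[OF st1] sim_frame_trans by blast
    have e: "M' a = M a" if "a < M 12" "a \<notin> sim_regs \<union> {11, 13, 14, d, d + 1, d + 2}" for a
    proof -
      have ne: "a \<notin> {15, d, d + 1, d + 2}" "a \<noteq> 16" "a \<noteq> 17" "a \<noteq> 11" "a \<noteq> 13" "a \<noteq> 14"
        using that(2) by (auto simp: sim_regs_def)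
      have "M3 a = M1 a" using fr that by (simp add: sim_frame_def M1_def)
      also have "\<dots> = M a" using ne by (simp add: M1_def)
      finally show ?thesis using M'(7)[OF ne(1)] by simp
    qed
    have d: "d < 100" "d + 2 < 100" "12 < d" using ls(3) by auto
    have "M3 11 = M1 11" using fr f(7) by (simp add: sim_frame_def M1_def sim_regs_def)
    moreover have "M' 11 = M3 11" using d by (intro M'(7)) auto
    ultimately have M12: "M 12 \<le> M' 12" using M'(1) by (simp add: sim_state_def M1_def)
    have reg: "r \<notin> sim_regs \<union> {11, 13, 14, d, d + 1, d + 2}" if "r \<in> {30, 37, 38}" for r
      using that ls(3) by (auto simp: sim_regs_def)
    have big: "a \<notin> sim_regs \<union> {11, 13, 14, d, d + 1, d + 2}" if "100 \<le> a" for a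
      using that d by (auto simp: sim_regs_def)
    show ?thesis
    proof (rule Q)
      show "search_inv k M'"
        unfolding search_inv_def
      proof (intro conjI allI impI)
        show "M' a = 0" if "M' 12 \<le> a" for a
          using M'(1) that by (simp add: sim_state_def)
        show "M' (102 + u * k + u) = 0" if "u < k" for u
          using e[of "102 + u * k + u"] f(7) f(9)[OF that] big[of "102 + u * k + u"] cell_less[OF that that] by simp
        show "M' 30 = k" "M' 37 = k * k" "M' 38 = 0"
          using e[OF _ reg[of 30]] e[OF _ reg[of 37]] e[OF _ reg[of 38]] f(1-3,7) by simp_all
        show "M' 100 = k" "M' 101 = k" "M' (102 + k * k) = 0"
          using e[OF _ big[of 100]] e[OF _ big[of 101]] e[OF _ big[of "102 + k * k"]] f(4-7) by simp_all
        show "102 + k * k < M' 12" using M12 f(7) by simp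
      qed
    qed (use M'(4-6) e in blast)+
  qed
  have get: "wp y (sim_get d 0 ;; sim_get (d + 1) 1 ;; sim_get (d + 2) 2) (\<lambda>_. Q) M3"
    if M': "sim_state x R M3" "sim_frame M2 M3" "sim_frame M1 M2" for M2 M3
  proof -
    have d: "d < 100" "d + 1 < 100" "d + 2 < 100" "d \<notin> {11, 12, 13, 14, 15}" "d + 1 \<notin> {11, 12, 13, 14, 15}"
      "d + 2 \<notin> {11, 12, 13, 14, 15}" using ls(3) by auto
    show ?thesis
      unfolding wp_Seq
    proof (rule wp_sim_get'[OF M'(1) d(1,4)], rule wp_sim_get'[OF _ d(2,5)], assumption,
        rule wp_sim_get'[OF _ d(3,6)], assumption)
      fix A B C :: "nat \<Rightarrow> nat"
      assume a: "sim_state x R A" "A d = R 0" "\<And>r. r \<notin> {15, d} \<Longrightarrow> A r = M3 r"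
        "sim_state x R B" "B (d + 1) = R 1" "\<And>r. r \<notin> {15, d + 1} \<Longrightarrow> B r = A r"
        "sim_state x R C" "C (d + 2) = R 2" "\<And>r. r \<notin> {15, d + 2} \<Longrightarrow> C r = B r"
      show "Q C"
      proof (rule fin[OF a(7) M'(2,3)])
        show "C d = R 0" "C (d + 1) = R 1" "C (d + 2) = R 2"
          using a(9)[of d] a(9)[of "d + 1"] a(6)[of d] a(2,5,8) d(4,5) by auto
        show "C r = M3 r" if "r \<notin> {15, d, d + 1, d + 2}" for r
          using a(3)[of r] a(6)[of r] a(9)[of r] that by simp
      qed
    qed
  qed
  have "wp y (sim_set 31 17 ;; sim P ;; sim_get d 0 ;; sim_get (d + 1) 1 ;; sim_get (d + 2) 2) (\<lambda>_. Q) M1"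
    unfolding wp_Seq[of _ "sim_set 31 17"] wp_Seq[of _ "sim P"]
  proof (rule wp_sim_set[OF st1], simp, rule sim, assumption, rule get)
  qed assumption+
  moreover have "M(14 := l, 13 := 102 - l + k * k, 16 := 0, 11 := M 12, 17 := M s) = M1"
    unfolding M1_def x by (simp add: add.commute)
  ultimately show ?thesis
    using ls(2) f(2) by (auto simp: sim_call_def)
qed

text \<open>Equality of two fractions with signed numerators, cross-multiplied and with the negative
  terms moved to the other side, since registers hold natural numbers. Denominator 0 of the
  candidate is rejected separately: otherwise the code 0, with empty numerator and denominator,
  would pass every test.\<close>

definition compare :: com where
  "compare = mul 48 40 45 ;; mul 49 44 42 ;; Op (Add 48 48 49) ;; mul 49 43 42 ;; mul 58 41 45 ;;
     Op (Add 49 49 58) ;; Op (Sub 58 48 49) ;; Op (Sub 59 49 48) ;; Op (Add 58 58 59) ;; Op (Const 59 1) ;;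
     Op (Sub 59 59 45) ;; Op (Add 58 58 59) ;; If 58 (Op (Const 36 0))"

lemma wp_compare:
  assumes "\<And>M'. M' 36 = (if M 45 \<noteq> 0 \<and> M 40 * M 45 + M 44 * M 42 = M 43 * M 42 + M 41 * M 45 then M 36 else 0) \<Longrightarrow>
     (\<And>r. r \<notin> {0, 36, 46, 47, 48, 49, 58, 59} \<Longrightarrow> M' r = M r) \<Longrightarrow> Q M'"
  shows "wp y compare (\<lambda>_. Q) M"
  unfolding compare_def wp_Seq[of _ "mul a b c" for a b c]
  apply (rule wp_mul)
     apply simp_all[3]
  apply (rule wp_mul)
     apply simp_all[3]
  apply (simp only: wp_Seq[of _ "Op i" for i] wp_Seq[of _ "mul a b c" for a b c] wp_ops)
  apply (rule wp_mul)
     apply simp_all[3]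
  apply (rule wp_mul)
     apply simp_all[3]
  subgoal premises p for M1 M2 M3 M4
  proof -
    have m1: "\<And>r. r \<notin> {0, 36, 46, 47, 48, 49, 58, 59} \<Longrightarrow> M1 r = M r"
      using p(2) by simp
    have m2: "\<And>r. r \<notin> {0, 36, 46, 47, 48, 49, 58, 59} \<Longrightarrow> M2 r = M r"
      using p(4) m1 by simp
    have m3: "\<And>r. r \<notin> {0, 36, 46, 47, 48, 49, 58, 59} \<Longrightarrow> M3 r = M r"
      using p(6) m2 by simp
    have m4: "\<And>r. r \<notin> {0, 36, 46, 47, 48, 49, 58, 59} \<Longrightarrow> M4 r = M r"
      using p(8) m3 by simp
    have 36: "M4 36 = M 36" using p(2,4,6,8) by simp
    have 48: "M4 48 = M 40 * M 45 + M 44 * M 42"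
      using p(1,3) p(8)[of 48] p(6)[of 48] p(4)[of 48] m1 by simp
    have 49: "M4 49 = M 43 * M 42" using p(5) p(8)[of 49] m2 by simp
    have 58: "M4 58 = M 41 * M 45" using p(7) m3 by simp
    show ?thesis
    proof (cases "M 40 * M 45 + M 44 * M 42" "M 43 * M 42 + M 41 * M 45" rule: linorder_cases)
      case less
      then show ?thesis by (simp add: 36 48 49 58 m4) ((intro conjI impI)?; rule assms; simp add: 36 m4)
    next
      case equal
      then show ?thesis by (simp add: 36 48 49 58 m4) ((intro conjI impI)?; rule assms; simp add: 36 m4)
    next
      case greater
      then show ?thesis by (simp add: 36 48 49 58 m4) ((intro conjI impI)?; rule assms; simp add: 36 m4)
    qed
  qed
  done

definition mat_list :: "nat \<Rightarrow> (nat \<Rightarrow> nat \<Rightarrow> nat) \<Rightarrow> nat list" where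
  "mat_list n f = n # concat (map (\<lambda>u. map (f u) [0..<n]) [0..<n])"

lemma concat_rows:
  fixes f :: "nat \<Rightarrow> nat \<Rightarrow> 'a"
  shows "length (concat (map (\<lambda>u. map (f u) [0..<n]) [0..<m])) = m * n"
    and "u < m \<Longrightarrow> v < n \<Longrightarrow> concat (map (\<lambda>u. map (f u) [0..<n]) [0..<m]) ! (u * n + v) = f u v"
proof -
  show l: "length (concat (map (\<lambda>u. map (f u) [0..<n]) [0..<m])) = m * n" for m
    by (induction m) auto
  show "u < m \<Longrightarrow> v < n \<Longrightarrow> concat (map (\<lambda>u. map (f u) [0..<n]) [0..<m]) ! (u * n + v) = f u v"
  proof (induction m)
    case (Suc m)
    show ?case
    proof (cases "u = m")
      case True
      then show ?thesis using Suc.prems l[of m] by (simp add: nth_append)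
    next
      case False
      then have u: "u < m" using Suc.prems by simp
      then have "u * n + v < Suc u * n" using Suc.prems by simp
      also have "\<dots> \<le> m * n" using u by (intro mult_le_mono1) simp
      finally show ?thesis using Suc.IH[OF u Suc.prems(2)] l[of m] by (simp add: nth_append)
    qed
  qed simp
qed

lemma length_mat_list [simp]: "length (mat_list n f) = Suc (n * n)"
  by (simp add: mat_list_def concat_rows)

lemma mat_list_cell:
  "input_cell (mat_list n f) 0 = n"
  "u < n \<Longrightarrow> v < n \<Longrightarrow> input_cell (mat_list n f) (Suc (u * n + v)) = f u v"
  using cell_less[of u n v] by (simp_all add: input_cell_def concat_rows mat_list_def)

lemma input_cell_Cons: "input_cell (a # x) (Suc i) = input_cell x i" "input_cell (a # x) 0 = a"
  by (simp_all add: input_cell_def)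

lemma mat_list_mem:
  assumes "M l = n" "\<And>u v. u < n \<Longrightarrow> v < n \<Longrightarrow> M (Suc l + (u * n + v)) = f u v" "M (Suc l + n * n) = 0"
    and "i \<le> length (mat_list n f)"
  shows "M (l + i) = input_cell (mat_list n f) i"
proof (cases i)
  case 0
  then show ?thesis using assms(1) by (simp add: mat_list_cell)
next
  case (Suc j)
  show ?thesis
  proof (cases "j = n * n")
    case True
    then show ?thesis using assms(3) Suc by (simp add: input_cell_def)
  next
    case False
    then have j: "j < n * n" using assms(4) Suc by simp
    then have n: "0 < n" by (cases n) auto
    have "j div n < n" "j mod n < n" "j = j div n * n + j mod n"
      using j n by (auto simp: less_mult_imp_div_less)
    then show ?thesis using assms(2)[of "j div n" "j mod n"] mat_list_cell(2)[of "j div n" n "j mod n" f] Suc by simp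
  qed
qed

definition check :: "instr list \<Rightarrow> instr list \<Rightarrow> com" where
  "check P P' = fill ;; sim_call P 101 38 40 ;; sim_call P' 100 31 43 ;; compare ;;
     Op (Const 57 1) ;; Op (Sub 35 57 34) ;; Op (Add 33 33 57)"

text \<open>Register 32 is 1 after a failure and 0 after a success. It is both the loop condition
  and the increment of the candidate, so that a successful candidate is left in register 31.\<close>

definition search :: "instr list \<Rightarrow> instr list \<Rightarrow> com" where
  "search P P' = mul 37 30 30 ;; Op (Const 59 0) ;; Op (Add 100 30 59) ;; Op (Add 101 30 59) ;;
     Op (Const 12 103) ;; Op (Add 12 12 37) ;; Op (Const 32 1) ;;
     While 32 (Op (Const 36 1) ;; Op (Const 33 0) ;; Op (Const 35 1) ;; While 35 (check P P') ;;
       Op (Const 57 1) ;; Op (Sub 32 57 36) ;; Op (Add 31 31 32))"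

definition outputs :: "instr list \<Rightarrow> nat list \<Rightarrow> nat \<Rightarrow> nat \<times> nat \<times> nat \<Rightarrow> bool" where
  "outputs P x N q \<longleftrightarrow> (\<exists>t pc R. (ram_step P x ^^ t) (0, (\<lambda>_. 0)(31 := N)) = (pc, R) \<and> length P \<le> pc \<and>
     q = (R 0, R 1, R 2))"

definition agree :: "nat \<times> nat \<times> nat \<Rightarrow> nat \<times> nat \<times> nat \<Rightarrow> bool" where
  "agree = (\<lambda>(p0, p1, p2) (c0, c1, c2). c2 \<noteq> 0 \<and> p0 * c2 + c1 * p2 = c0 * p2 + p1 * c2)"

lemma wp_check:
  assumes inv: "search_inv k M"
    and P: "outputs P (mat_list k (bit_mat (M 33) k)) 0 p"
    and P': "outputs P' (k # mat_list k (bit_mat (M 33) k)) (M 31) c"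
    and Q: "\<And>M'. search_inv k M' \<Longrightarrow> M' 33 = Suc (M 33) \<Longrightarrow> M' 31 = M 31 \<Longrightarrow>
      M' 35 = 1 - M 33 div 2 ^ (k * k) \<Longrightarrow> M' 36 = (if agree p c then M 36 else 0) \<Longrightarrow> M' 32 = M 32 \<Longrightarrow> Q M'"
  shows "wp y (check P P') (\<lambda>_. Q) M"
  unfolding check_def wp_Seq
proof (rule wp_fill[OF inv])
  let ?x = "mat_list k (bit_mat (M 33) k)" and ?tail = "wp y (Op (Const 57 1)) (\<lambda>_. wp y (Op (Sub 35 57 34)) (\<lambda>_. wp y (Op (Add 33 33 57)) (\<lambda>_. Q)))"
  obtain t pc R where R: "(ram_step P ?x ^^ t) (0, (\<lambda>_. 0)(31 := 0)) = (pc, R)" "length P \<le> pc" "p = (R 0, R 1, R 2)"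
    using P by (auto simp: outputs_def)
  obtain t' pc' R' where R': "(ram_step P' (k # ?x) ^^ t') (0, (\<lambda>_. 0)(31 := M 31)) = (pc', R')"
    "length P' \<le> pc'" "c = (R' 0, R' 1, R' 2)"
    using P' by (auto simp: outputs_def)
  fix M1 assume i1: "search_inv k M1" and y: "M1 34 = M 33 div 2 ^ (k * k)"
    and mat: "\<And>u v. u < k \<Longrightarrow> v < k \<Longrightarrow> M1 (102 + u * k + v) = bit_mat (M 33) k u v"
    and e1: "\<And>a. a < 100 \<Longrightarrow> a \<notin> {0, 34, 50, 51, 52, 53, 54, 55, 56, 57} \<Longrightarrow> M1 a = M a"
  note f1 = search_inv_facts[OF i1]
  have mem1: "M1 (101 + i) = input_cell ?x i" if "i \<le> length ?x" for i
    by (rule mat_list_mem) (use f1(5,6) mat that in \<open>simp_all add: add.assoc\<close>)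
  show "wp y (sim_call P 101 38 40) (\<lambda>_. wp y (sim_call P' 100 31 43) (\<lambda>_. wp y compare (\<lambda>_.
      ?tail))) M1"
  proof (rule wp_sim_call[OF i1, where x = ?x])
    show "(ram_step P ?x ^^ t) (0, (\<lambda>_. 0)(31 := M1 38)) = (pc, R)" using R(1) f1(3) by simp
    fix M2 assume i2: "search_inv k M2" and o2: "M2 40 = R 0" "M2 (40 + 1) = R 1" "M2 (40 + 2) = R 2"
      and e2: "\<And>a. a < M1 12 \<Longrightarrow> a \<notin> sim_regs \<union> {11, 13, 14, 40, 40 + 1, 40 + 2} \<Longrightarrow> M2 a = M1 a"
    note f2 = search_inv_facts[OF i2]
    have mem2: "M2 (100 + i) = input_cell (k # ?x) i" if "i \<le> length (k # ?x)" for i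
    proof (cases i)
      case 0
      then show ?thesis using f2(4) by (simp add: input_cell_Cons)
    next
      case (Suc j)
      then have j: "j \<le> length ?x" using that by simp
      have "M2 (101 + j) = M1 (101 + j)"
        by (rule e2) (use j f1(7) in \<open>auto simp: sim_regs_def\<close>)
      then show ?thesis using mem1[OF j] Suc by (simp add: input_cell_Cons)
    qed
    have k2: "M2 a = M a" if "a \<in> {31, 32, 33, 36}" for a
    proof -
      have "M2 a = M1 a" by (rule e2) (use that f1(7) in \<open>auto simp: sim_regs_def\<close>)
      also have "\<dots> = M a" by (rule e1) (use that in auto)
      finally show ?thesis .
    qed
    have y2: "M2 34 = M1 34" by (rule e2) (use f1(7) in \<open>auto simp: sim_regs_def\<close>)
    show "wp y (sim_call P' 100 31 43) (\<lambda>_. wp y compare (\<lambda>_.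
      ?tail)) M2"
    proof (rule wp_sim_call[OF i2, where x = "k # ?x"])
      show "(ram_step P' (k # ?x) ^^ t') (0, (\<lambda>_. 0)(31 := M2 31)) = (pc', R')" using R'(1) k2[of 31] by simp
      fix M3 assume i3: "search_inv k M3" and o3: "M3 43 = R' 0" "M3 (43 + 1) = R' 1" "M3 (43 + 2) = R' 2"
        and e3: "\<And>a. a < M2 12 \<Longrightarrow> a \<notin> sim_regs \<union> {11, 13, 14, 43, 43 + 1, 43 + 2} \<Longrightarrow> M3 a = M2 a"
      have k3: "M3 a = M2 a" if "a \<in> {31, 32, 33, 34, 36, 40, 41, 42}" for a
        by (rule e3) (use that f2(7) in \<open>auto simp: sim_regs_def\<close>)
      note f3 = search_inv_facts[OF i3]
      show "wp y compare (\<lambda>_. ?tail) M3"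
      proof (rule wp_compare)
        fix M4 :: "nat \<Rightarrow> nat"
        assume c4: "M4 36 = (if M3 45 \<noteq> 0 \<and> M3 40 * M3 45 + M3 44 * M3 42 = M3 43 * M3 42 + M3 41 * M3 45 then M3 36 else 0)"
          and e4: "\<And>r. r \<notin> {0, 36, 46, 47, 48, 49, 58, 59} \<Longrightarrow> M4 r = M3 r"
        let ?M = "M4(57 := 1, 35 := 1 - M4 34, 33 := M4 33 + 1)"
        have M12: "?M 12 = M3 12" using e4 by simp
        have big: "?M a = M3 a" if "100 \<le> a" for a using e4[of a] that by simp
        have "Q ?M"
        proof (rule Q)
          show "search_inv k ?M"
            unfolding search_inv_def M12
          proof (intro conjI allI impI)
            show "?M a = 0" if "M3 12 \<le> a" for a using f3(7) f3(8)[OF that] big[of a] that by simp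
            show "?M (102 + u * k + u) = 0" if "u < k" for u using f3(9)[OF that] big by simp
            show "?M (102 + k * k) = 0" using f3(6) big by simp
          qed (use f3(1-5,7) e4 in simp_all)
          show "?M 33 = Suc (M 33)" "?M 31 = M 31" "?M 32 = M 32"
            using e4[of 33] k3[of 33] k2[of 33] e4[of 31] k3[of 31] k2[of 31] e4[of 32] k3[of 32] k2[of 32] by simp_all
          show "?M 35 = 1 - M 33 div 2 ^ (k * k)"
            using e4[of 34] k3[of 34] y2 y by simp
          have "M3 40 = R 0" "M3 41 = R 1" "M3 42 = R 2" using k3[of 40] k3[of 41] k3[of 42] o2 by simp_all
          moreover have "M3 43 = R' 0" "M3 44 = R' 1" "M3 45 = R' 2" using o3 by simp_all
          moreover have "M3 36 = M 36" using k3[of 36] k2[of 36] by simp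
          ultimately show "?M 36 = (if agree p c then M 36 else 0)"
            using c4 R(3) R'(3) by (simp add: agree_def)
        qed
        then show "?tail M4"
          by simp
      qed
    qed (use mem2 R' in simp_all)
  qed (use mem1 R in simp_all)
qed

text \<open>The candidate never exceeds \<open>G\<close>, because \<open>G\<close> itself passes all
  tests. A smaller code may be found instead; hence the conclusion speaks only of the tests that it
  has passed.\<close>

lemma wp_search:
  assumes M: "M 30 = k" "M 31 = 0" "M 38 = 0" "\<And>a. 100 \<le> a \<Longrightarrow> M a = 0"
    and P: "\<And>h. outputs P (mat_list k (bit_mat h k)) 0 (p h)"
    and P': "\<And>h N. outputs P' (k # mat_list k (bit_mat h k)) N (c N h)"
    and good: "\<And>h. agree (p h) (c G h)"
    and Q: "\<And>M'. (\<forall>h \<le> 2 ^ (k * k). agree (p h) (c (M' 31) h)) \<Longrightarrow> Q M'"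
  shows "wp y (search P P') (\<lambda>_. Q) M"
proof -
  let ?H = "2 ^ (k * k) :: nat"
  let ?b = "Op (Const 36 1) ;; Op (Const 33 0) ;; Op (Const 35 1) ;; While 35 (check P P') ;;
       Op (Const 57 1) ;; Op (Sub 32 57 36) ;; Op (Add 31 31 32)"
  have upd: "search_inv k (M(r := v))" if "search_inv k M" "r \<in> {0, 31, 32, 33, 35, 36, 57}" for M r v
  proof -
    note f = search_inv_facts[OF that(1)]
    have r: "r < 100" "r \<noteq> 30" "r \<noteq> 37" "r \<noteq> 38" "r \<noteq> 12" using that(2) by auto
    show ?thesis
      unfolding search_inv_def
    proof (intro conjI allI impI)
      show "(M(r := v)) a = 0" if "(M(r := v)) 12 \<le> a" for a using f(7) f(8)[of a] that r by simp
      show "(M(r := v)) (102 + u * k + u) = 0" if "u < k" for u using f(9)[OF that] r by simp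
    qed (use f(1-7) r in simp_all)
  qed
  let ?I = "\<lambda>N i M'. search_inv k M' \<and> M' 33 = i \<and> M' 31 = N \<and> M' 32 = 1 \<and>
      M' 35 = of_bool (i \<le> ?H) \<and> M' 36 = of_bool (\<forall>h < i. agree (p h) (c N h))"
  have inner: "wp y (While 35 (check P P')) (\<lambda>_. Q') M1"
    if M1: "search_inv k M1" "M1 33 = 0" "M1 35 = 1" "M1 36 = 1" "M1 31 = N" "M1 32 = 1"
      and Q': "\<And>M'. search_inv k M' \<Longrightarrow> M' 31 = N \<Longrightarrow> M' 32 = 1 \<Longrightarrow>
        M' 36 = of_bool (\<forall>h \<le> ?H. agree (p h) (c N h)) \<Longrightarrow> Q' M'" for M1 N Q'
  \<comment> \<open>The loop notices the end only after \<open>2 ^ (k * k)\<close> itself has been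
    tested, hence the additional round; this number stands for the edgeless graph once more.\<close>
  proof (rule wp_While_count[where n = "?H + 1" and I = "?I N"])
    fix i M2
    assume i: "i < ?H + 1" and I: "?I N i M2"
    show "M2 35 \<noteq> 0 \<and> wp y (check P P') (\<lambda>_ M'. ?I N (Suc i) (M'(0 := 0))) M2"
    proof
      show "M2 35 \<noteq> 0" using i I by simp
      show "wp y (check P P') (\<lambda>_ M'. ?I N (Suc i) (M'(0 := 0))) M2"
      proof (rule wp_check[where k = k and p = "p i" and c = "c N i"])
        fix M' assume q: "search_inv k M'" "M' 33 = Suc (M2 33)" "M' 31 = M2 31" "M' 35 = 1 - M2 33 div ?H"
          "M' 36 = (if agree (p i) (c N i) then M2 36 else 0)" "M' 32 = M2 32"
        have "1 - i div ?H = of_bool (Suc i \<le> ?H)"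
          using i by (cases "i = ?H") auto
        then show "?I N (Suc i) (M'(0 := 0))"
          using q I upd[OF q(1), of 0 0] by (auto simp: less_Suc_eq)
      qed (use I P P' in auto)
    qed
  qed (use M1 Q' in \<open>auto simp: less_Suc_eq_le\<close>)
  let ?K = "\<lambda>i M'. search_inv k M' \<and> M' 31 \<le> G \<and>
      (M' 32 = 1 \<and> i = Suc G - M' 31 \<or> M' 32 = 0 \<and> i = 0 \<and> (\<forall>h \<le> ?H. agree (p h) (c (M' 31) h)))"
  have outer: "wp y (While 32 ?b) (\<lambda>_. Q) M1" if M1: "search_inv k M1" "M1 31 = 0" "M1 32 = 1" for M1
  proof (rule wp_While_variant[where i = "Suc G" and I = ?K])
    show "?K (Suc G) M1"
      using M1 by simp
  next
    fix i M2
    assume I: "?K i M2"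
      and nz: "M2 32 \<noteq> 0"
    let ?N = "M2 31"
    let ?J = "\<lambda>M'. \<exists>j. ?K j (M'(0 := 0)) \<and> j < i"
    have "wp y (While 35 (check P P')) (\<lambda>_. wp y (Op (Const 57 1) ;; Op (Sub 32 57 36) ;; Op (Add 31 31 32)) (\<lambda>_. ?J))
       (M2(36 := 1, 33 := 0, 35 := 1))"
    proof (rule inner[where N = ?N])
      show "search_inv k (M2(36 := 1, 33 := 0, 35 := 1))" using I by (intro upd) auto
      fix M' assume q: "search_inv k M'" "M' 31 = ?N" "M' 32 = 1" "M' 36 = of_bool (\<forall>h \<le> ?H. agree (p h) (c ?N h))"
      have s: "search_inv k (M'(57 := 1, 32 := a, 31 := b, 0 := 0))" for a b
        using q(1) by (intro upd) auto
      show "wp y (Op (Const 57 1) ;; Op (Sub 32 57 36) ;; Op (Add 31 31 32)) (\<lambda>_. ?J) M'"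
      proof (cases "\<forall>h \<le> ?H. agree (p h) (c ?N h)")
        case True
        have "?J (M'(57 := 1, 32 := 0, 31 := ?N))"
          by (intro exI[of _ 0] conjI s) (use True I nz in auto)
        then show ?thesis using True q by simp
      next
        case False
        then have "?N \<noteq> G" using good by blast
        then have "?N < G" using I by simp
        have "?J (M'(57 := 1, 32 := 1, 31 := ?N + 1))"
          by (intro exI[of _ "G - ?N"] conjI s) (use \<open>?N < G\<close> I nz in auto)
        moreover have "M' 36 = 0" using False q(4) by simp
        ultimately show ?thesis using q(2) by simp
      qed
    qed (use I nz in auto)
    then show "wp y ?b (\<lambda>_. ?J) M2" unfolding wp_Seq wp_ops .
  next
    fix t i M'
    assume "?K i M'" "M' 32 = 0"
    then show "Q M'" by (intro Q) auto
  qed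
  show ?thesis
    unfolding search_def wp_Seq[of _ "mul 37 30 30"]
  proof (rule wp_mul)
    fix M0 :: "nat \<Rightarrow> nat"
    assume q: "M0 37 = M 30 * M 30" "\<And>r. r \<notin> {0, 46, 47, 37} \<Longrightarrow> M0 r = M r"
    let ?M = "M0(59 := 0, 100 := k, 101 := k, 12 := 103 + k * k, 32 := 1)"
    have z: "M0 a = 0" if "100 \<le> a" for a using q(2)[of a] M(4) that by simp
    have "search_inv k ?M"
      unfolding search_inv_def
    proof (intro conjI allI impI)
      show "?M a = 0" if "?M 12 \<le> a" for a using z[of a] that by simp
      show "?M (102 + u * k + u) = 0" for u using z by simp
      show "?M (102 + k * k) = 0" using z by simp
    qed (use q(1) q(2)[of 30] q(2)[of 38] M in simp_all)
    then have "wp y (While 32 ?b) (\<lambda>_. Q) ?M"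
      by (rule outer) (use q(2)[of 31] M in simp_all)
    then show "wp y (Op (Const 59 0) ;; Op (Add 100 30 59) ;; Op (Add 101 30 59) ;;
     Op (Const 12 103) ;; Op (Add 12 12 37) ;; Op (Const 32 1) ;; While 32 ?b) (\<lambda>_. Q) M0"
      using q(1) q(2)[of 30] M(1) by simp
  qed simp_all
qed

section \<open>Counting tuples by types\<close>

definition inj_words :: "'v set \<Rightarrow> ('v \<Rightarrow> nat) \<Rightarrow> nat list \<Rightarrow> 'v list set" where
  "inj_words V T w = {vs. distinct vs \<and> set vs \<subseteq> V \<and> map T vs = w}"

lemma finite_distinct_lists: "finite V \<Longrightarrow> finite {vs. distinct vs \<and> set vs \<subseteq> V}"
  by (rule finite_subset[OF _ finite_lists_length_le[of V "card V"]])
    (auto simp: distinct_card[symmetric] intro: card_mono)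

text \<open>A tuple with word \<open>w\<close> is prolonged by any vertex of type \<open>t\<close>
  that it does not contain yet, and it already contains as many vertices of that type as
  \<open>t\<close> occurs in \<open>w\<close>. The number is thus a product of falling factorials,
  one for each type; if there are too few vertices, one of the factors is 0.\<close>

lemma card_inj_words:
  assumes "finite V"
  shows "card (inj_words V T w) = word_val (\<lambda>t. card {v\<in>V. T v = t}) w"
proof (induction w)
  case Nil
  have "inj_words V T [] = {[]}" by (auto simp: inj_words_def)
  then show ?case by simp
next
  case (Cons t w)
  let ?new = "\<lambda>vs. {v\<in>V. T v = t \<and> v \<notin> set vs}"
  have fin: "finite (inj_words V T w)"
    by (rule finite_subset[OF _ finite_distinct_lists[OF assms]]) (auto simp: inj_words_def)
  have new: "card (?new vs) = card {v\<in>V. T v = t} - count_list w t" if "vs \<in> inj_words V T w" for vs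
  proof -
    have vs: "distinct vs" "set vs \<subseteq> V" "map T vs = w" using that by (auto simp: inj_words_def)
    have "?new vs = {v\<in>V. T v = t} - {v\<in>set vs. T v = t}" using vs(2) by auto
    then have "card (?new vs) = card {v\<in>V. T v = t} - card {v\<in>set vs. T v = t}"
      using vs(2) assms by (simp add: card_Diff_subset subset_iff)
    also have "card {v\<in>set vs. T v = t} = count_list w t"
      unfolding vs(3)[symmetric] using vs(1) by (induction vs) (auto simp: Collect_conv_if conj_disj_distribR Collect_disj_eq)
    finally show ?thesis .
  qed
  have "inj_words V T (t # w) = (\<lambda>(vs, v). v # vs) ` (SIGMA vs:inj_words V T w. ?new vs)"
    by (auto simp: inj_words_def image_iff Cons_eq_map_conv map_eq_Cons_conv)
  moreover have "inj_on (\<lambda>(vs, v). v # vs) (SIGMA vs:inj_words V T w. ?new vs)"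
    by (auto simp: inj_on_def)
  ultimately have "card (inj_words V T (t # w)) = card (SIGMA vs:inj_words V T w. ?new vs)"
    by (simp add: card_image)
  also have "\<dots> = (\<Sum>vs\<in>inj_words V T w. card (?new vs))"
    using fin assms by (simp add: card_SigmaI)
  also have "\<dots> = card (inj_words V T w) * (card {v\<in>V. T v = t} - count_list w t)"
    using new by simp
  finally show ?case by (simp add: Cons.IH)
qed

section \<open>Codes as rational combinations of words\<close>

fun items :: "nat list \<Rightarrow> nat list \<Rightarrow> (nat list \<times> nat) list" where
  "items [] w = []"
| "items (d # L) w = (if d < 4 then (w, d) # items L [] else items L ((d - 4) # w))"

definition sign :: "nat \<Rightarrow> rat" where
  "sign s = of_bool (s = 1) - of_bool (s = 2)"

definition coeff :: "nat list \<Rightarrow> nat list \<Rightarrow> rat" where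
  "coeff L w = (\<Sum>(w', s)\<leftarrow>items L []. sign s * of_bool (w' = w))"

lemma letters_val_items:
  "of_nat (letters_val 1 \<tau> g c L w) - of_nat (letters_val 2 \<tau> g c L w) =
    (\<Sum>(w', s)\<leftarrow>items L w. sign s * of_bool (word_wt \<tau> w' = g) * (of_nat (word_val c w') :: rat))"
  by (induction L arbitrary: w) (auto simp: sign_def)

text \<open>Exchange of summation: instead of counting, for each word of the code, the injective
  tuples that spell it, one collects for each injective tuple the coefficient of its word.\<close>

lemma letters_val_eq_sum:
  fixes T :: "'v \<Rightarrow> nat"
  assumes "finite V"
  defines "c \<equiv> \<lambda>t. card {v\<in>V. T v = t}"
  shows "of_nat (letters_val 1 \<tau> g c L []) - of_nat (letters_val 2 \<tau> g c L []) =
    (\<Sum>vs | distinct vs \<and> set vs \<subseteq> V \<and> word_wt \<tau> (map T vs) = g. coeff L (map T vs))"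
proof -
  let ?D = "{vs. distinct vs \<and> set vs \<subseteq> V}"
  have fin: "finite ?D" by (rule finite_distinct_lists[OF assms(1)])
  have wv: "of_nat (word_val c w) = (\<Sum>vs\<in>?D. of_bool (map T vs = w) :: rat)" for w
  proof -
    have "of_nat (word_val c w) = (of_nat (card (?D \<inter> {vs. map T vs = w})) :: rat)"
      unfolding c_def card_inj_words[OF assms(1), symmetric] inj_words_def
      by (rule arg_cong[of _ _ "\<lambda>S. of_nat (card S)"]) auto
    also have "\<dots> = (\<Sum>vs\<in>?D. if map T vs = w then 1 else 0)"
      using fin by (simp add: sum.If_cases)
    finally show ?thesis by (simp add: of_bool_def)
  qed
  have "(\<Sum>(w, s)\<leftarrow>I. sign s * of_bool (word_wt \<tau> w = g) * (of_nat (word_val c w) :: rat)) =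
    (\<Sum>vs\<in>?D. of_bool (word_wt \<tau> (map T vs) = g) * (\<Sum>(w, s)\<leftarrow>I. sign s * of_bool (w = map T vs)))" for I
  proof (induction I)
    case (Cons i I)
    obtain w s where i: "i = (w, s)" by fastforce
    have "sign s * of_bool (word_wt \<tau> w = g) * of_nat (word_val c w) =
      (\<Sum>vs\<in>?D. of_bool (word_wt \<tau> (map T vs) = g) * (sign s * of_bool (w = map T vs)))"
      unfolding wv sum_distrib_left by (rule sum.cong) (auto simp: of_bool_def)
    then show ?case using Cons.IH by (simp add: i distrib_left sum.distrib)
  qed simp
  then have "of_nat (letters_val 1 \<tau> g c L []) - of_nat (letters_val 2 \<tau> g c L []) =
    (\<Sum>vs\<in>?D. of_bool (word_wt \<tau> (map T vs) = g) * coeff L (map T vs))"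
    unfolding letters_val_items coeff_def by blast
  also have "\<dots> = (\<Sum>vs\<in>{vs \<in> ?D. word_wt \<tau> (map T vs) = g}. coeff L (map T vs))"
    unfolding sum.inter_filter[OF fin] by (intro sum.cong) (auto simp: of_bool_def)
  finally show ?thesis by (simp add: conj_assoc)
qed

subsection \<open>Bits of types\<close>

lemma odd_div_low: "i < m \<Longrightarrow> odd ((p + 2 ^ m * q) div 2 ^ i) = odd ((p::nat) div 2 ^ i)"
proof -
  assume "i < m"
  then obtain d where m: "m = i + Suc d" by (auto dest: less_imp_Suc_add)
  have "p + 2 ^ m * q = p + 2 ^ i * (2 ^ Suc d * q)" unfolding m power_add by (simp only: ac_simps)
  then have "(p + 2 ^ m * q) div 2 ^ i = (p + 2 ^ i * (2 ^ Suc d * q)) div 2 ^ i" by (simp only:)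
  also have "\<dots> = 2 ^ Suc d * q + p div 2 ^ i" by (rule div_mult_self2) simp
  finally show ?thesis by simp
qed

lemma div_high: "(p::nat) < 2 ^ m \<Longrightarrow> (p + 2 ^ m * q) div 2 ^ (m + i) = q div 2 ^ i"
  by (simp add: power_add div_mult2_eq)

lemma odd_sum_bits: "i < m \<Longrightarrow> odd ((\<Sum>j<m. (2::nat) ^ j * of_bool (b j)) div 2 ^ i) = b i" for i m :: nat and b :: "nat \<Rightarrow> bool"
proof (induction m)
  case (Suc m)
  show ?case
  proof (cases "i = m")
    case True
    then show ?thesis
      using div_high[OF sum_bits_less[where m = m and f = b], of "of_bool (b m)" 0]
      by (simp del: sum_mult_of_bool_eq)
  next
    case False
    then have "i < m" using Suc.prems by simp
    then show ?thesis
      using Suc.IH odd_div_low[of i m "\<Sum>j<m. 2 ^ j * of_bool (b j)" "of_bool (b m)"] by (simp del: sum_mult_of_bool_eq)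
  qed
qed simp

lemma vtype_bits:
  assumes "i < \<tau>"
  shows "odd (vtype \<tau> E a v div 2 ^ i) = E (a i) v" "odd (vtype \<tau> E a v div 2 ^ (\<tau> + i)) = (v = a i)"
  unfolding vtype_def odd_div_low[OF assms] odd_sum_bits[OF assms] div_high[OF sum_bits_less]
  by (rule refl)+

lemma vtype_div: "vtype \<tau> E a v div 2 ^ \<tau> = (\<Sum>j<\<tau>. 2 ^ j * of_bool (v = a j))"
  unfolding vtype_def using div_high[OF sum_bits_less[where m = \<tau> and f = "\<lambda>j. E (a j) v"], of _ 0] by (simp del: sum_mult_of_bool_eq)

lemma vtype_cong:
  assumes "\<And>j. j < \<tau> \<Longrightarrow> a j = a' j"
  shows "vtype \<tau> E a = vtype \<tau> E a'"
  using assms by (auto simp: vtype_def fun_eq_iff)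

lemma sum_bits_full: "(\<Sum>j<m. 2 ^ j * of_bool (b j)) = (2::nat) ^ m - 1 \<longleftrightarrow> (\<forall>j<m. b j)"
proof
  assume *: "(\<Sum>j<m. 2 ^ j * of_bool (b j)) = (2::nat) ^ m - 1"
  have "(\<Sum>j<m. 2 ^ j * of_bool True) = (2::nat) ^ m - 1"
    by (induction m) auto
  then show "\<forall>j<m. b j" using * odd_sum_bits[of _ m b] odd_sum_bits[of _ m "\<lambda>_. True"] by metis
next
  assume "\<forall>j<m. b j"
  then have "(\<Sum>j<m. 2 ^ j * of_bool (b j)) = (\<Sum>j<m. (2::nat) ^ j)" by simp
  also have "\<dots> = 2 ^ m - 1" by (induction m) auto
  finally show "(\<Sum>j<m. 2 ^ j * of_bool (b j)) = (2::nat) ^ m - 1" .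
qed

text \<open>In a distinct list at most one vertex equals \<open>a j\<close>, so the equality bits of
  the letters add up without carries.\<close>

lemma word_wt_types:
  assumes "distinct vs"
  shows "word_wt \<tau> (map (vtype \<tau> E a) vs) = length vs * 2 ^ \<tau> + (\<Sum>j<\<tau>. 2 ^ j * of_bool (a j \<in> set vs))"
  using assms
proof (induction vs)
  case Nil
  then show ?case by (simp add: word_wt_def)
next
  case (Cons v vs)
  have "(\<Sum>j<\<tau>. 2 ^ j * of_bool (a j \<in> set (v # vs))) =
    (\<Sum>j<\<tau>. 2 ^ j * of_bool (v = a j)) + (\<Sum>j<\<tau>. (2::nat) ^ j * of_bool (a j \<in> set vs))"
    unfolding sum.distrib[symmetric] using Cons.prems by (intro sum.cong) auto
  then show ?case using Cons by (simp add: word_wt_def vtype_div del: sum_mult_of_bool_eq)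
qed

text \<open>Above the last digit in base \<open>2 ^ \<tau>\<close> the weight shows the length; the
  last digit is maximal exactly if all bits are set.\<close>

lemma word_wt_target:
  assumes "distinct vs" "0 < k"
  shows "word_wt \<tau> (map (vtype \<tau> E a) vs) = target \<tau> k \<longleftrightarrow> length vs = k \<and> (\<forall>j<\<tau>. a j \<in> set vs)"
proof -
  let ?S = "(\<Sum>j<\<tau>. 2 ^ j * of_bool (a j \<in> set vs)) :: nat"
  have S: "?S < 2 ^ \<tau>" by (rule sum_bits_less)
  have "length vs * 2 ^ \<tau> + ?S = k * 2 ^ \<tau> + (2 ^ \<tau> - 1) \<longleftrightarrow> length vs = k \<and> ?S = 2 ^ \<tau> - 1"
    by (rule cell_eq_iff[OF S]) simp
  then show ?thesis
    unfolding word_wt_types[OF assms(1)] target_def sum_bits_full[symmetric]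
    using assms(2) by (simp del: sum_mult_of_bool_eq)
qed

lemma word_wt_target_0: "word_wt \<tau> w = target \<tau> 0 \<longleftrightarrow> w = []"
  by (cases w) (auto simp: word_wt_def target_def)


subsection \<open>Sums over tuples\<close>

definition tuples :: "nat \<Rightarrow> 'v set \<Rightarrow> 'v list set" where
  "tuples m V = {al. length al = m \<and> set al \<subseteq> V}"

lemma finite_tuples: "finite V \<Longrightarrow> finite (tuples m V)"
  using finite_lists_length_eq[of V m] by (simp add: tuples_def conj_commute)

lemma tuples_Suc: "tuples (Suc m) V = (\<lambda>(al, u). al @ [u]) ` (tuples m V \<times> V)"
proof (intro equalityI subsetI)
  fix al assume "al \<in> tuples (Suc m) V"
  then show "al \<in> (\<lambda>(al, u). al @ [u]) ` (tuples m V \<times> V)"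
    by (cases al rule: rev_cases) (auto simp: tuples_def image_iff)
qed (auto simp: tuples_def)

lemma tuple_sum_eq:
  "tuple_sum m j F a = (\<Sum>al\<in>tuples j {..<m}. F (\<lambda>i. if i < j then al ! i else a i))"
proof (induction j arbitrary: a)
  case 0
  have "tuples 0 {..<m} = {[]}" by (auto simp: tuples_def)
  then show ?case by simp
next
  case (Suc j)
  let ?f = "\<lambda>al i. if i < Suc j then al ! i else a i"
  have "(\<Sum>al\<in>tuples (Suc j) {..<m}. F (?f al)) = (\<Sum>(al, u)\<in>tuples j {..<m} \<times> {..<m}. F (?f (al @ [u])))"
    unfolding tuples_Suc by (subst sum.reindex) (auto simp: inj_on_def case_prod_unfold)
  also have "\<dots> = (\<Sum>(al, u)\<in>tuples j {..<m} \<times> {..<m}. F (\<lambda>i. if i < j then al ! i else (a(j := u)) i))"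
    by (intro sum.cong refl) (auto simp: tuples_def nth_append less_Suc_eq intro!: arg_cong[of _ _ F])
  also have "\<dots> = (\<Sum>u<m. \<Sum>al\<in>tuples j {..<m}. F (\<lambda>i. if i < j then al ! i else (a(j := u)) i))"
    by (simp add: sum.cartesian_product[symmetric] sum.swap[of _ "{..<m}"])
  finally show ?case by (simp add: Suc.IH)
qed

definition cover_pairs :: "nat \<Rightarrow> nat \<Rightarrow> 'v set \<Rightarrow> ('v list \<times> 'v list) set" where
  "cover_pairs \<tau> k V = {(al, vs). length al = \<tau> \<and> length vs = k \<and> distinct vs \<and> set vs \<subseteq> V \<and> set al \<subseteq> set vs}"

text \<open>The graph function that a combination of words stands for, freed from codes and
  machines. For \<open>k = 0\<close> the sum would be empty whenever \<open>\<tau>\<close> is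
  positive, since the entries of \<open>al\<close> would have to lie in the empty set; a constant
  takes its place.\<close>

definition cover_sum :: "nat \<Rightarrow> nat \<Rightarrow> (nat list \<Rightarrow> rat) \<Rightarrow> 'v set \<Rightarrow> ('v \<Rightarrow> 'v \<Rightarrow> bool) \<Rightarrow> rat" where
  "cover_sum \<tau> k \<omega> V E = (if k = 0 then \<omega> []
     else \<Sum>(al, vs)\<in>cover_pairs \<tau> k V. \<omega> (map (vtype \<tau> E (nth al)) vs))"

lemma finite_cover_pairs: "finite V \<Longrightarrow> finite (cover_pairs \<tau> k V)"
  by (rule finite_subset[of _ "tuples \<tau> V \<times> {vs. distinct vs \<and> set vs \<subseteq> V}"])
    (auto simp: cover_pairs_def tuples_def finite_distinct_lists intro!: finite_cartesian_product finite_tuples[unfolded tuples_def])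

lemma count_val_eq_cover_sum:
  "of_nat (count_val 1 \<tau> k x n N) - of_nat (count_val 2 \<tau> k x n N) =
     cover_sum \<tau> k (coeff (digits (2 * \<tau> + 2) N)) {..<n} (cell_adj x n)"
proof -
  let ?E = "cell_adj x n" and ?L = "digits (2 * \<tau> + 2) N" and ?g = "target \<tau> k"
  let ?A = "tuples \<tau> {..<tuple_bound k n}"
  have T: "vtype \<tau> ?E (\<lambda>i. if i < \<tau> then al ! i else 0) = vtype \<tau> ?E (nth al)" for al
    by (rule vtype_cong) simp
  have c: "count_type n T = (\<lambda>t. card {v\<in>{..<n}. T v = t})" for T by (simp add: count_type_def fun_eq_iff)
  let ?W = "\<lambda>al. {vs. distinct vs \<and> set vs \<subseteq> {..<n} \<and> word_wt \<tau> (map (vtype \<tau> ?E (nth al)) vs) = ?g}"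
  have "of_nat (count_val 1 \<tau> k x n N) - of_nat (count_val 2 \<tau> k x n N) =
    (\<Sum>al\<in>?A. \<Sum>vs\<in>?W al. coeff ?L (map (vtype \<tau> ?E (nth al)) vs))"
    unfolding count_val_def tuple_sum_eq tuple_val_def T c of_nat_sum sum_subtractf[symmetric]
    by (intro sum.cong refl letters_val_eq_sum) simp
  also have "\<dots> = cover_sum \<tau> k (coeff ?L) {..<n} ?E"
  proof (cases "k = 0")
    case True
    have "?A = {replicate \<tau> 0}"
      using True by (auto simp: tuples_def tuple_bound_def intro!: replicate_eqI)
    moreover have "?W al = {[]}" for al
      unfolding True word_wt_target_0 by auto
    ultimately show ?thesis using True by (simp add: cover_sum_def)
  next
    case False
    then have k: "0 < k" by simp
    have W: "?W al = {vs. (al, vs) \<in> cover_pairs \<tau> k {..<n}}" if "al \<in> ?A" for al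
    proof -
      have len: "length al = \<tau>" using that by (simp add: tuples_def)
      have "(\<forall>j<\<tau>. al ! j \<in> set vs) \<longleftrightarrow> set al \<subseteq> set vs" for vs
        using len by (auto simp: set_conv_nth)
      then show ?thesis
        using word_wt_target[OF _ k, of _ \<tau> ?E "nth al"] len by (auto simp: cover_pairs_def)
    qed
    have "(\<Sum>al\<in>?A. \<Sum>vs\<in>?W al. coeff ?L (map (vtype \<tau> ?E (nth al)) vs)) =
      (\<Sum>al\<in>?A. \<Sum>vs\<in>{vs. (al, vs) \<in> cover_pairs \<tau> k {..<n}}. coeff ?L (map (vtype \<tau> ?E (nth al)) vs))"
      using W by (intro sum.cong) auto
    also have "\<dots> = (\<Sum>(al, vs)\<in>(SIGMA al:?A. {vs. (al, vs) \<in> cover_pairs \<tau> k {..<n}}). coeff ?L (map (vtype \<tau> ?E (nth al)) vs))"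
    proof (rule sum.Sigma)
      show "finite ?A" by (rule finite_tuples) simp
      show "\<forall>al\<in>?A. finite {vs. (al, vs) \<in> cover_pairs \<tau> k {..<n}}"
        by (auto simp: cover_pairs_def intro!: finite_subset[OF _ finite_distinct_lists[of "{..<n}"]])
    qed
    also have "(SIGMA al:?A. {vs. (al, vs) \<in> cover_pairs \<tau> k {..<n}}) = cover_pairs \<tau> k {..<n}"
      using False by (auto simp: cover_pairs_def tuples_def tuple_bound_def)
    finally show ?thesis using False by (simp add: cover_sum_def)
  qed
  finally show ?thesis .
qed

text \<open>A pair contributes to exactly one \<open>A\<close>, namely \<open>set vs\<close>. This
  is where the entries of \<open>al\<close> must lie among those of \<open>vs\<close>: otherwise
  \<open>A\<close> would not determine the range of \<open>al\<close>.\<close>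

lemma cover_sum_subsets:
  assumes "finite V" "0 < k"
  shows "cover_sum \<tau> k \<omega> V E = (\<Sum>A | A \<subseteq> V \<and> card A = k. cover_sum \<tau> k \<omega> A E)"
proof -
  let ?S = "{A. A \<subseteq> V \<and> card A = k}"
  have fin: "finite ?S" using assms(1) by simp
  have finA: "finite A" if "A \<in> ?S" for A using that assms(1) finite_subset by auto
  have set_vs: "set vs = A" if "(al, vs) \<in> cover_pairs \<tau> k A" "A \<in> ?S" for al vs A
    using that card_subset_eq[OF finA[OF that(2)], of "set vs"] by (auto simp: cover_pairs_def distinct_card)
  have U: "cover_pairs \<tau> k V = (\<Union>A\<in>?S. cover_pairs \<tau> k A)"
    by (auto simp: cover_pairs_def distinct_card)
  have "(\<Sum>(al, vs)\<in>cover_pairs \<tau> k V. \<omega> (map (vtype \<tau> E (nth al)) vs)) =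
    (\<Sum>A\<in>?S. \<Sum>(al, vs)\<in>cover_pairs \<tau> k A. \<omega> (map (vtype \<tau> E (nth al)) vs))"
    unfolding U
  proof (rule sum.UNION_disjoint[OF fin])
    show "\<forall>A\<in>?S. finite (cover_pairs \<tau> k A)" using finA finite_cover_pairs by blast
    show "\<forall>A\<in>?S. \<forall>B\<in>?S. A \<noteq> B \<longrightarrow> cover_pairs \<tau> k A \<inter> cover_pairs \<tau> k B = {}"
    proof (intro ballI impI equals0I)
      fix A B p assume AB: "A \<in> ?S" "B \<in> ?S" "A \<noteq> B" and p: "p \<in> cover_pairs \<tau> k A \<inter> cover_pairs \<tau> k B"
      obtain al vs where "p = (al, vs)" by fastforce
      with p set_vs AB show False by blast
    qed
  qed
  then show ?thesis using assms(2) by (simp add: cover_sum_def)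
qed

text \<open>Types record only adjacency and equality, and a bijection that respects adjacency
  preserves both.\<close>

lemma cover_sum_iso:
  fixes h :: "'v \<Rightarrow> 'w"
  assumes h: "bij_betw h V W" and E: "\<And>u v. u \<in> V \<Longrightarrow> v \<in> V \<Longrightarrow> E u v = F (h u) (h v)"
  shows "cover_sum \<tau> k \<omega> V E = cover_sum \<tau> k \<omega> W F"
proof -
  have inj: "inj_on h V" and im: "h ` V = W" using h by (auto simp: bij_betw_def)
  have img: "cover_pairs \<tau> k W = (\<lambda>(al, vs). (map h al, map h vs)) ` cover_pairs \<tau> k V"
  proof (intro equalityI subsetI)
    fix p assume "p \<in> cover_pairs \<tau> k W"
    then obtain al vs where p: "p = (al, vs)" "length al = \<tau>" "length vs = k" "distinct vs" "set vs \<subseteq> W" "set al \<subseteq> set vs"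
      by (auto simp: cover_pairs_def)
    let ?i = "the_inv_into V h"
    have i: "?i w \<in> V" "h (?i w) = w" if "w \<in> W" for w
      using that inj im by (auto simp: the_inv_into_into f_the_inv_into_f)
    have "inj_on ?i (set vs)" by (rule inj_on_inverseI[of _ h]) (use i(2) p(5) in auto)
    then have "(map ?i al, map ?i vs) \<in> cover_pairs \<tau> k V"
      using p i(1) by (auto simp: cover_pairs_def distinct_map subset_iff)
    moreover have "map h (map ?i al) = al" "map h (map ?i vs) = vs"
      using p(5,6) i(2) by (auto intro!: map_idI simp: subset_iff)
    ultimately show "p \<in> (\<lambda>(al, vs). (map h al, map h vs)) ` cover_pairs \<tau> k V"
      unfolding p(1) by (intro image_eqI[where x = "(map ?i al, map ?i vs)"]) (simp_all only: case_prod_conv)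
  next
    fix p assume "p \<in> (\<lambda>(al, vs). (map h al, map h vs)) ` cover_pairs \<tau> k V"
    then show "p \<in> cover_pairs \<tau> k W"
      using inj im by (auto simp: cover_pairs_def distinct_map subset_iff inj_on_def)
  qed
  have sub: "set al \<subseteq> V" "set vs \<subseteq> V" if "(al, vs) \<in> cover_pairs \<tau> k V" for al vs
    using that by (auto simp: cover_pairs_def)
  have "inj_on (\<lambda>(al, vs). (map h al, map h vs)) (cover_pairs \<tau> k V)"
  proof (rule inj_onI, clarify)
    fix al vs al' vs'
    assume p: "(al, vs) \<in> cover_pairs \<tau> k V" "(al', vs') \<in> cover_pairs \<tau> k V"
      and e: "map h al = map h al'" "map h vs = map h vs'"
    have "inj_on h (set al \<union> set al')" "inj_on h (set vs \<union> set vs')"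
      using sub[OF p(1)] sub[OF p(2)] inj by (auto intro: inj_on_subset)
    then show "al = al' \<and> vs = vs'" using e map_inj_on by blast
  qed
  then have "(\<Sum>(al, vs)\<in>cover_pairs \<tau> k W. \<omega> (map (vtype \<tau> F (nth al)) vs)) =
    (\<Sum>(al, vs)\<in>cover_pairs \<tau> k V. \<omega> (map (vtype \<tau> F (nth (map h al))) (map h vs)))"
    unfolding img by (subst sum.reindex) (auto simp: case_prod_unfold)
  also have "\<dots> = (\<Sum>(al, vs)\<in>cover_pairs \<tau> k V. \<omega> (map (vtype \<tau> E (nth al)) vs))"
  proof (intro sum.cong refl, clarify)
    fix al vs assume p: "(al, vs) \<in> cover_pairs \<tau> k V"
    then have len: "length al = \<tau>" by (simp add: cover_pairs_def)
    have "vtype \<tau> F (nth (map h al)) (h v) = vtype \<tau> E (nth al) v" if "v \<in> set vs" for v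
    proof -
      have v: "v \<in> V" using sub[OF p] that by auto
      have a: "al ! j \<in> V" if "j < \<tau>" for j using sub[OF p] len that by (auto simp: subset_iff)
      have 1: "F (map h al ! j) (h v) = E (al ! j) v" "(h v = map h al ! j) = (v = al ! j)" if "j < \<tau>" for j
        using E[OF a[OF that] v] a[OF that] v len that inj by (auto simp: inj_on_eq_iff)
      show ?thesis unfolding vtype_def by (intro arg_cong2[of _ _ _ _ "(+)"] arg_cong2[of _ _ _ _ "(*)"] sum.cong refl)
          (use 1 in auto)
    qed
    then show "\<omega> (map (vtype \<tau> F (nth (map h al))) (map h vs)) = \<omega> (map (vtype \<tau> E (nth al)) vs)"
      by (intro arg_cong[of _ _ \<omega>]) simp
  qed
  finally show ?thesis by (simp add: cover_sum_def)
qed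

section \<open>Existence of the coefficients\<close>

abbreviation graph_adj :: "graph \<Rightarrow> nat \<Rightarrow> nat \<Rightarrow> bool" where
  "graph_adj G \<equiv> \<lambda>u v. {u, v} \<in> edges G"

lemma cover_list_exists:
  assumes T: "simple_graph (V, T)" and vc: "vertex_cover_number (V, T) \<le> \<tau>" and V: "V \<noteq> {}"
  shows "\<exists>c. length c = \<tau> \<and> set c \<subseteq> V \<and> (\<forall>e\<in>T. e \<inter> set c \<noteq> {})"
proof -
  let ?S = "{C. vertex_cover (V, T) C}"
  have fV: "finite V" and TV: "\<And>e. e \<in> T \<Longrightarrow> e \<subseteq> V \<and> card e = 2" using T by (auto simp: simple_graph_def)
  have "?S \<subseteq> Pow V" by (auto simp: vertex_cover_def)
  then have fin: "finite (card ` ?S)" using fV by (simp add: finite_subset)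
  have "e \<inter> V \<noteq> {}" if "e \<in> T" for e
    using TV[OF that] by (auto simp: Int_absorb2)
  then have "V \<in> ?S" by (simp add: vertex_cover_def)
  then have "Min (card ` ?S) \<in> card ` ?S" using fin by (intro Min_in) auto
  then obtain C where C: "vertex_cover (V, T) C" "card C \<le> \<tau>"
    using vc by (auto simp: vertex_cover_number_def)
  then have CV: "C \<subseteq> V" and cov: "\<forall>e\<in>T. e \<inter> C \<noteq> {}" by (auto simp: vertex_cover_def)
  obtain xs where xs: "set xs = C" "distinct xs" using finite_distinct_list[OF finite_subset[OF CV fV]] by blast
  obtain v where v: "v \<in> V" using V by blast
  \<comment> \<open>Enlarging a cover leaves it a cover, so it can be padded to length exactly
    \<open>\<tau>\<close> with any vertex.\<close>
  let ?c = "xs @ replicate (\<tau> - card C) v"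
  have "length ?c = \<tau>" using xs C(2) by (simp add: distinct_card[symmetric])
  moreover have "set ?c \<subseteq> V" using xs CV v by auto
  moreover have "\<forall>e\<in>T. e \<inter> set ?c \<noteq> {}" using cov xs by auto
  ultimately show ?thesis by blast
qed

text \<open>The tuple \<open>al\<close> is meant to be the image under \<open>vs\<close> of a cover
  chosen for \<open>T\<close>. Every edge of \<open>T\<close> meets the cover, so the adjacency bits
  of the types suffice to see whether \<open>vs\<close> maps \<open>T\<close> into \<open>H\<close>,
  and the equality bits show whether \<open>al\<close> is the right tuple. Hence exactly one
  \<open>al\<close> detects such a \<open>T\<close>. The sum of \<open>\<gamma> T\<close> over the
  detected \<open>T\<close> is the value of \<open>\<Phi>\<close> at the graph pulled back along
  \<open>vs\<close>, which is isomorphic to \<open>H\<close>.\<close>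

lemma cover_sum_weights_exist:
  assumes iso: "iso_invariant \<Phi>"
    and ae: "\<And>G. simple_graph G \<Longrightarrow> vertex_cover_number G > \<tau> \<Longrightarrow> alternating_enumerator \<Phi> G = 0"
  shows "\<exists>\<omega>. \<forall>H. simple_graph H \<longrightarrow> verts H = {..<k} \<longrightarrow>
    cover_sum \<tau> k \<omega> {..<k} (graph_adj H) = \<Phi> H"
proof (cases "k = 0")
  case True
  have "H = ({}, {})" if "simple_graph H" "verts H = {..<k}" for H
    using that True by (cases H) (auto simp: simple_graph_def)
  then show ?thesis using True by (intro exI[of _ "\<lambda>_. \<Phi> ({}, {})"]) (auto simp: cover_sum_def)
next
  case False
  then have k: "0 < k" by simp
  let ?V = "{..<k}"
  let ?K = "{e. e \<subseteq> ?V \<and> card e = 2}"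
  have finK: "finite ?K" by (rule finite_subset[of _ "Pow ?V"]) auto
  have simp_K: "simple_graph (?V, T)" if "T \<subseteq> ?K" for T using that by (simp add: simple_graph_def)
  \<comment> \<open>With this sign inclusion-exclusion over subsets is an involution, and the
    alternating enumerator is one of its two directions.\<close>
  define \<gamma> where "\<gamma> T = (-1) ^ card T * alternating_enumerator \<Phi> (?V, T)" for T
  have \<gamma>: "(\<Sum>T\<in>Pow S. \<gamma> T) = \<Phi> (?V, S)" if "S \<subseteq> ?K" for S
    unfolding \<gamma>_def
    by (rule inclusion_exclusion_symmetric[symmetric])
      (use finite_subset[OF that finK] in \<open>simp_all add: alternating_enumerator_def mult.commute\<close>)
  \<comment> \<open>One cover is fixed for each \<open>T\<close>; otherwise \<open>T\<close> would
    be counted once for every list that covers it. Where \<open>\<gamma> T = 0\<close> the choice is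
    arbitrary and has no effect.\<close>
  define cov where "cov T = (SOME c. length c = \<tau> \<and> set c \<subseteq> ?V \<and> (\<forall>e\<in>T. e \<inter> set c \<noteq> {}))" for T
  have cov: "length (cov T) = \<tau>" "set (cov T) \<subseteq> ?V" "\<And>e. e \<in> T \<Longrightarrow> e \<inter> set (cov T) \<noteq> {}"
    if "T \<subseteq> ?K" "\<gamma> T \<noteq> 0" for T
  proof -
    have "vertex_cover_number (?V, T) \<le> \<tau>"
      using ae[OF simp_K[OF that(1)]] that(2) by (fastforce simp: \<gamma>_def)
    then have "\<exists>c. length c = \<tau> \<and> set c \<subseteq> ?V \<and> (\<forall>e\<in>T. e \<inter> set c \<noteq> {})"
      using cover_list_exists[OF simp_K[OF that(1)]] k by fastforce
    from someI_ex[OF this] show "length (cov T) = \<tau>" "set (cov T) \<subseteq> ?V" "\<And>e. e \<in> T \<Longrightarrow> e \<inter> set (cov T) \<noteq> {}"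
      unfolding cov_def by blast+
  qed
  \<comment> \<open>The letter \<open>w ! y\<close> is the type of the vertex at place
    \<open>y\<close>: bit \<open>\<tau> + i\<close> tells whether this vertex is the
    \<open>i\<close>-th tuple entry, bit \<open>i\<close> whether it is adjacent to that
    entry.\<close>
  define compat where "compat T w \<longleftrightarrow> (\<forall>i<\<tau>. odd (w ! (cov T ! i) div 2 ^ (\<tau> + i)) \<and>
    (\<forall>y<k. {cov T ! i, y} \<in> T \<longrightarrow> odd (w ! y div 2 ^ i)))" for T and w :: "nat list"
  define Perm where "Perm = {vs. length vs = k \<and> distinct vs \<and> set vs \<subseteq> ?V}"
  \<comment> \<open>Every ordering \<open>vs\<close> of the vertices contributes
    \<open>\<Phi> H\<close> once, hence the division.\<close>
  define \<omega> where "\<omega> w = (\<Sum>T\<in>Pow ?K. \<gamma> T * of_bool (compat T w)) / of_nat (card Perm)" for w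
  have finP: "finite Perm"
    unfolding Perm_def by (rule finite_subset[OF _ finite_distinct_lists[of ?V]]) auto
  have "[0..<k] \<in> Perm" by (auto simp: Perm_def)
  then have P0: "card Perm \<noteq> 0" using finP by auto
  have Perm_set: "set vs = ?V" if "vs \<in> Perm" for vs
    using that by (intro card_subset_eq) (auto simp: Perm_def distinct_card)
  have "cover_sum \<tau> k \<omega> ?V (graph_adj H) = \<Phi> H" if H: "simple_graph H" "verts H = ?V" for H
  proof -
    let ?E = "\<lambda>u v. {u, v} \<in> edges H"
    have HK: "edges H \<subseteq> ?K" using H by (auto simp: simple_graph_def)
    let ?img = "\<lambda>vs T. (\<lambda>e. nth vs ` e) ` T"
    have inner: "(\<Sum>al\<in>tuples \<tau> ?V. \<gamma> T * of_bool (compat T (map (vtype \<tau> ?E (nth al)) vs))) =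
      \<gamma> T * of_bool (?img vs T \<subseteq> edges H)" if vs: "vs \<in> Perm" and T: "T \<subseteq> ?K" for vs T
    proof (cases "\<gamma> T = 0")
      case False
      note c = cov[OF T False]
      let ?a = "map (nth vs) (cov T)"
      have len: "length vs = k" using vs by (simp add: Perm_def)
      have ck: "cov T ! i < k" if "i < \<tau>" for i using c(1,2) that by (auto simp: subset_iff)
      have compat: "compat T (map (vtype \<tau> ?E (nth al)) vs) \<longleftrightarrow> al = ?a \<and> ?img vs T \<subseteq> edges H"
        if al: "al \<in> tuples \<tau> ?V" for al
      proof -
        have al_len: "length al = \<tau>" using al by (simp add: tuples_def)
        have "compat T (map (vtype \<tau> ?E (nth al)) vs) \<longleftrightarrow>
          (\<forall>i<\<tau>. vs ! (cov T ! i) = al ! i \<and> (\<forall>y<k. {cov T ! i, y} \<in> T \<longrightarrow> {al ! i, vs ! y} \<in> edges H))"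
          unfolding compat_def using ck len by (simp add: vtype_bits)
        also have "\<dots> \<longleftrightarrow> al = ?a \<and> (\<forall>i<\<tau>. \<forall>y<k. {cov T ! i, y} \<in> T \<longrightarrow> {vs ! (cov T ! i), vs ! y} \<in> edges H)"
          using al_len c(1) by (auto simp: list_eq_iff_nth_eq)
        also have "(\<forall>i<\<tau>. \<forall>y<k. {cov T ! i, y} \<in> T \<longrightarrow> {vs ! (cov T ! i), vs ! y} \<in> edges H) \<longleftrightarrow> ?img vs T \<subseteq> edges H"
        proof
          assume *: "\<forall>i<\<tau>. \<forall>y<k. {cov T ! i, y} \<in> T \<longrightarrow> {vs ! (cov T ! i), vs ! y} \<in> edges H"
          show "?img vs T \<subseteq> edges H"
          proof clarify
            fix e assume e: "e \<in> T"
            then obtain x where x: "x \<in> e" "x \<in> set (cov T)" using c(3) by blast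
            then obtain i where i: "i < \<tau>" "x = cov T ! i" using c(1) by (auto simp: in_set_conv_nth)
            have "card e = 2" "e \<subseteq> ?V" using e T by auto
            then obtain y where y: "e = {x, y}" using x(1) by (auto simp: card_2_iff)
            then have "y < k" using \<open>e \<subseteq> ?V\<close> by auto
            then show "nth vs ` e \<in> edges H" using * i e y by auto
          qed
        next
          assume *: "?img vs T \<subseteq> edges H"
          show "\<forall>i<\<tau>. \<forall>y<k. {cov T ! i, y} \<in> T \<longrightarrow> {vs ! (cov T ! i), vs ! y} \<in> edges H"
          proof (intro allI impI)
            fix i y assume "{cov T ! i, y} \<in> T"
            then have "nth vs ` {cov T ! i, y} \<in> edges H" using * by blast
            then show "{vs ! (cov T ! i), vs ! y} \<in> edges H" by simp
          qed
        qed
        finally show ?thesis .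
      qed
      have "set ?a \<subseteq> set vs" using c(2) len by (auto simp: subset_iff)
      then have a: "?a \<in> tuples \<tau> ?V" using Perm_set[OF vs] c(1) by (simp add: tuples_def)
      have "(\<Sum>al\<in>tuples \<tau> ?V. \<gamma> T * of_bool (compat T (map (vtype \<tau> ?E (nth al)) vs))) =
        (\<Sum>al\<in>tuples \<tau> ?V. if al = ?a then \<gamma> T * of_bool (?img vs T \<subseteq> edges H) else 0)"
        by (intro sum.cong refl) (simp add: compat)
      then show ?thesis using a finite_tuples[of ?V \<tau>] by simp
    qed simp
    have perm: "(\<Sum>T\<in>Pow ?K. \<gamma> T * of_bool (?img vs T \<subseteq> edges H)) = \<Phi> H" if vs: "vs \<in> Perm" for vs
    proof -
      let ?H = "{e\<in>?K. nth vs ` e \<in> edges H}"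
      have bij: "bij_betw (nth vs) ?V ?V"
        by (rule bij_betw_nth) (use vs Perm_set[OF vs] in \<open>auto simp: Perm_def\<close>)
      have "(\<Sum>T\<in>Pow ?K. \<gamma> T * of_bool (?img vs T \<subseteq> edges H)) = (\<Sum>T\<in>Pow ?H. \<gamma> T)"
        by (rule sum.mono_neutral_cong_right) (use finK in auto)
      also have "\<dots> = \<Phi> (?V, ?H)" by (rule \<gamma>) auto
      also have "\<dots> = \<Phi> H"
      proof -
        have "edges H \<subseteq> ?img vs ?H"
        proof
          fix e assume e: "e \<in> edges H"
          then have "e \<subseteq> nth vs ` ?V" "card e = 2" using HK bij by (auto simp: bij_betw_def)
          then obtain e' where e': "e' \<subseteq> ?V" "e = nth vs ` e'" by (auto simp: subset_image_iff)
          moreover have "card e' = card e"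
            using e' bij by (metis bij_betw_def card_image inj_on_subset)
          ultimately show "e \<in> ?img vs ?H" using e \<open>card e = 2\<close> by auto
        qed
        then have "graph_iso (?V, ?H) H"
          unfolding graph_iso_def using bij H(2) by (intro exI[of _ "nth vs"]) auto
        then show ?thesis using iso simp_K[of ?H] H(1) unfolding iso_invariant_def by blast
      qed
      finally show ?thesis .
    qed
    have "cover_pairs \<tau> k ?V = tuples \<tau> ?V \<times> Perm"
    proof (intro equalityI subsetI)
      fix p assume "p \<in> tuples \<tau> ?V \<times> Perm"
      then obtain al vs where p: "p = (al, vs)" "al \<in> tuples \<tau> ?V" "vs \<in> Perm" by auto
      then show "p \<in> cover_pairs \<tau> k ?V" using Perm_set[OF p(3)] by (simp add: cover_pairs_def tuples_def Perm_def)
    qed (auto simp: cover_pairs_def tuples_def Perm_def)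
    then have "cover_sum \<tau> k \<omega> ?V ?E = (\<Sum>al\<in>tuples \<tau> ?V. \<Sum>vs\<in>Perm. \<omega> (map (vtype \<tau> ?E (nth al)) vs))"
      using False by (simp add: cover_sum_def sum.cartesian_product)
    also have "\<dots> = (\<Sum>vs\<in>Perm. \<Sum>al\<in>tuples \<tau> ?V. \<omega> (map (vtype \<tau> ?E (nth al)) vs))"
      by (rule sum.swap)
    also have "\<dots> = (\<Sum>vs\<in>Perm. (\<Sum>T\<in>Pow ?K. \<Sum>al\<in>tuples \<tau> ?V.
        \<gamma> T * of_bool (compat T (map (vtype \<tau> ?E (nth al)) vs))) / of_nat (card Perm))"
      unfolding \<omega>_def sum_divide_distrib[symmetric] by (subst sum.swap) (rule refl)
    also have "\<dots> = (\<Sum>vs\<in>Perm. (\<Sum>T\<in>Pow ?K. \<gamma> T * of_bool (?img vs T \<subseteq> edges H)) / of_nat (card Perm))"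
      by (intro sum.cong refl arg_cong2[of _ _ _ _ "(/)"] inner) auto
    also have "\<dots> = (\<Sum>vs\<in>Perm. \<Phi> H / of_nat (card Perm))"
      by (intro sum.cong refl) (simp only: perm)
    also have "\<dots> = \<Phi> H" using P0 by simp
    finally show ?thesis .
  qed
  then show ?thesis by blast
qed

section \<open>Integer coefficients and their codes\<close>

lemma common_denominator:
  fixes \<omega> :: "'a \<Rightarrow> rat"
  assumes "finite X"
  shows "\<exists>D::nat. 0 < D \<and> (\<forall>w\<in>X. \<exists>z. of_nat D * \<omega> w = of_int z)"
  using assms
proof (induction X)
  case empty
  then show ?case by (intro exI[of _ 1]) simp
next
  case (insert x X)
  then obtain D :: nat where D: "0 < D" "\<And>w. w \<in> X \<Longrightarrow> \<exists>z. of_nat D * \<omega> w = of_int z" by blast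
  obtain a b where ab: "quotient_of (\<omega> x) = (a, b)" by fastforce
  then have b: "0 < b" and x: "\<omega> x = of_int a / of_int b"
    by (auto intro: quotient_of_denom_pos quotient_of_div)
  have bb: "of_nat (nat b) = (of_int b :: rat)" using b by simp
  show ?case
  proof (intro exI[of _ "D * nat b"] conjI ballI)
    show "0 < D * nat b" using D b by simp
    fix w assume "w \<in> insert x X"
    then show "\<exists>z. of_nat (D * nat b) * \<omega> w = of_int z"
    proof
      assume "w = x"
      then have "of_nat (D * nat b) * \<omega> w = of_int (int D * a)" using b bb by (simp add: x)
      then show ?thesis by blast
    next
      assume "w \<in> X"
      then obtain z where "of_nat D * \<omega> w = of_int z" using D by blast
      then have "of_nat (D * nat b) * \<omega> w = of_int (b * z)" using bb by (simp add: algebra_simps)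
      then show ?thesis by blast
    qed
  qed
qed

text \<open>Since the last digit is the most significant one, it cannot be 0; apart from that, any
  list of sufficiently small letters is a code.\<close>

lemma digits_surj:
  assumes "set L \<subseteq> {..<2 ^ Suc b}" "L = [] \<or> last L \<noteq> 0"
  shows "\<exists>N. digits b N = L"
  using assms
proof (induction L)
  case (Cons d L)
  have "L = [] \<or> last L \<noteq> 0" using Cons.prems(2) by (auto split: if_splits)
  then obtain N where N: "digits b N = L" using Cons by auto
  have d: "d < 2 ^ Suc b" using Cons.prems(1) by simp
  have "d \<noteq> 0 \<or> N \<noteq> 0" using Cons.prems(2) N by (auto split: if_splits)
  then have "digits b (d + 2 ^ Suc b * N) = d # digits b N"
    using d div_high[OF d, of N 0] by (subst digits.simps) simp
  then show ?case using N by blast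
qed (auto intro: exI[of _ 0])

text \<open>\<open>items\<close> puts each letter in front of the current word, so a word has to be
  spelled backwards.\<close>

definition item :: "nat list \<times> nat \<Rightarrow> nat list" where
  "item = (\<lambda>(w, s). map (\<lambda>t. t + 4) (rev w) @ [s])"

lemma items_item: "s < 4 \<Longrightarrow> items (item (w, s) @ L) [] = (w, s) # items L []"
proof -
  assume s: "s < 4"
  have "items (map (\<lambda>t. t + 4) u @ s # L) w' = (rev u @ w', s) # items L []" for u w'
    using s by (induction u arbitrary: w') auto
  from this[of "rev w" "[]"] show ?thesis by (simp add: item_def)
qed

lemma items_concat:
  "(\<forall>p\<in>set ps. snd p < 4) \<Longrightarrow> items (concat (map item ps) @ L) [] = ps @ items L []"
  by (induction ps) (auto simp: items_item)

lemma items_replicate: "items (replicate D 3) [] = replicate D ([], 3)"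
  by (induction D) auto

lemma coeff_exists:
  assumes X: "finite X" "\<And>w t. w \<in> X \<Longrightarrow> t \<in> set w \<Longrightarrow> t < 2 ^ (2 * \<tau>)"
  shows "\<exists>N. 0 < denom \<tau> N \<and> (\<forall>w\<in>X. coeff (digits (2 * \<tau> + 2) N) w = of_nat (denom \<tau> N) * \<omega> w)"
proof -
  obtain D :: nat where D: "0 < D" "\<forall>w\<in>X. \<exists>z. of_nat D * \<omega> w = of_int z"
    using common_denominator[OF X(1)] by blast
  then obtain z where z: "\<And>w. w \<in> X \<Longrightarrow> of_nat D * \<omega> w = of_int (z w)" by metis
  obtain ws where ws: "set ws = X" "distinct ws" using finite_distinct_list[OF X(1)] by blast
  \<comment> \<open>The integer coefficients are written in unary, as repetitions of the word ended
    by the letter 1 or, for negative ones, by 2. At least one of the two blocks is empty.\<close>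
  let ?p = "\<lambda>w. replicate (nat (z w)) (w, 1::nat) @ replicate (nat (- z w)) (w, 2)"
  define ps where "ps = concat (map ?p ws)"
  have ps: "fst p \<in> X" "snd p = 1 \<or> snd p = 2" if "p \<in> set ps" for p
    using that ws by (auto simp: ps_def split: if_splits)
  \<comment> \<open>The final letters 3 set the denominator to \<open>D\<close> and, being nonzero,
    also make \<open>L\<close> a list of digits. Each of them ends an empty word, which counts with
    sign 0.\<close>
  define L where "L = concat (map item ps) @ replicate D 3"
  have "set L \<subseteq> {..<2 ^ Suc (2 * \<tau> + 2)}"
  proof
    fix d assume "d \<in> set L"
    then consider p where "p \<in> set ps" "d \<in> set (item p)" | "d = 3" by (auto simp: L_def split: if_splits)
    then show "d \<in> {..<2 ^ Suc (2 * \<tau> + 2)}"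
    proof cases
      case 1
      then have "(\<exists>t\<in>set (fst p). d = t + 4) \<or> d = snd p" by (cases p) (auto simp: item_def)
      then show ?thesis
      proof
        assume "\<exists>t\<in>set (fst p). d = t + 4"
        then have "d < 2 ^ (2 * \<tau>) + 4" using X(2) ps(1)[OF 1(1)] by auto
        \<comment> \<open>For \<open>\<tau> = 0\<close> there is one type besides the four control
          letters, and five letters need three bits: this is the origin of the base
          \<open>2 ^ (2 * \<tau> + 3)\<close>.\<close>
        also have "\<dots> \<le> 8 * 2 ^ (2 * \<tau>)" using one_le_power[of "2::nat" "2 * \<tau>"] by linarith
        also have "\<dots> = 2 ^ Suc (2 * \<tau> + 2)" by simp
        finally show ?thesis by simp
      next
        assume "d = snd p"
        then have "d < 4" using ps(2)[OF 1(1)] by auto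
        also have "4 \<le> (2::nat) ^ Suc (2 * \<tau> + 2)" by simp
        finally show ?thesis by simp
      qed
    next
      case 2
      have "3 < (2::nat) ^ Suc (2 * \<tau> + 2)" by (rule less_le_trans[of _ 4]) simp_all
      then show ?thesis using 2 by simp
    qed
  qed
  moreover have "last L \<noteq> 0" using D(1) by (simp add: L_def)
  ultimately obtain N where N: "digits (2 * \<tau> + 2) N = L" using digits_surj by blast
  have "count_list (item p) 3 = 0" if "p \<in> set ps" for p
    using ps(2)[OF that] by (cases p) (auto simp: item_def count_list_0_iff)
  then have "count_list (concat (map item ps)) 3 = 0" by (auto simp: count_list_0_iff)
  moreover have "count_list (replicate D (3::nat)) 3 = D" by (induction D) auto
  ultimately have den: "denom \<tau> N = D" unfolding denom_def N L_def by simp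
  have "coeff L w = of_int (z w)" if w: "w \<in> X" for w
  proof -
    have "items L [] = ps @ replicate D ([], 3)"
    proof -
      have "\<forall>p\<in>set ps. snd p < 4" using ps(2) by fastforce
      then show ?thesis unfolding L_def by (simp only: items_concat items_replicate)
    qed
    moreover have "(\<Sum>(w', s)\<leftarrow>replicate D ([], 3). sign s * of_bool (w' = w)) = 0"
      by (induction D) (auto simp: sign_def)
    ultimately have "coeff L w = (\<Sum>(w', s)\<leftarrow>ps. sign s * of_bool (w' = w))"
      by (simp add: coeff_def)
    also have "\<dots> = (\<Sum>w'\<leftarrow>ws. of_int (z w') * of_bool (w' = w))"
      unfolding ps_def
    proof (induction ws)
      case (Cons u us)
      have "(\<Sum>(w', s)\<leftarrow>replicate m (u, 1). sign s * of_bool (w' = w)) = of_nat m * of_bool (u = w)"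
        "(\<Sum>(w', s)\<leftarrow>replicate m (u, 2). sign s * of_bool (w' = w)) = - of_nat m * of_bool (u = w)" for m
        by (induction m) (auto simp: sign_def algebra_simps)
      moreover have "of_nat (nat (z u)) - of_nat (nat (- z u)) = (of_int (z u) :: rat)"
        by (cases "0 \<le> z u") auto
      ultimately show ?case using Cons.IH by (simp add: algebra_simps)
    qed simp
    also have "\<dots> = (\<Sum>w'\<in>X. of_int (z w') * of_bool (w' = w))"
      using ws by (simp add: sum_list_distinct_conv_sum_set)
    also have "\<dots> = (\<Sum>w'\<in>X. if w' = w then of_int (z w') else 0)"
      by (intro sum.cong) auto
    also have "\<dots> = of_int (z w)" using X(1) w by simp
    finally show ?thesis .
  qed
  then show ?thesis using D(1) z unfolding den[symmetric] N[symmetric] by (intro exI[of _ N]) auto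
qed

section \<open>Graphs and their codes\<close>

text \<open>Both sides are sums over the \<open>k\<close>-subsets, and each induced subgraph can be
  moved to the vertex set \<open>{..<k}\<close>. The factor \<open>D\<close> is the denominator of a
  code, kept in multiplied form because the weights of a code are integers.\<close>

lemma ind_sub_cover_sum:
  assumes iso: "iso_invariant \<Phi>" and G: "simple_graph G"
    and H: "\<And>H. simple_graph H \<Longrightarrow> verts H = {..<k} \<Longrightarrow>
      cover_sum \<tau> k \<omega> {..<k} (graph_adj H) = D * \<Phi> H"
  shows "cover_sum \<tau> k \<omega> (verts G) (graph_adj G) = D * ind_sub \<Phi> k G"
proof (cases "k = 0")
  case True
  have fin: "finite (verts G)" using G by (simp add: simple_graph_def)
  have "{A. A \<subseteq> verts G \<and> card A = 0} = {{}}"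
    by (auto simp: card_eq_0_iff dest: finite_subset[OF _ fin])
  moreover have "induced_subgraph G {} = ({}, {})"
    using G by (auto simp: induced_subgraph_def simple_graph_def)
  moreover have "cover_sum \<tau> k \<omega> {..<k} (graph_adj ({}, {})) = D * \<Phi> ({}, {})"
    by (rule H) (use True in \<open>auto simp: simple_graph_def\<close>)
  ultimately show ?thesis using True by (simp add: ind_sub_def cover_sum_def)
next
  case False
  have fin: "finite (verts G)" and GE: "\<And>e. e \<in> edges G \<Longrightarrow> card e = 2"
    using G by (auto simp: simple_graph_def)
  have "cover_sum \<tau> k \<omega> A (graph_adj G) = D * \<Phi> (induced_subgraph G A)"
    if A: "A \<subseteq> verts G" "card A = k" for A
  proof -
    have finA: "finite A" using A(1) fin finite_subset by blast
    obtain h where h: "bij_betw h {..<k} A"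
      using ex_bij_betw_nat_finite[OF finA] A(2) by (auto simp: atLeast0LessThan)
    then have inj: "inj_on h {..<k}" and im: "h ` {..<k} = A" by (auto simp: bij_betw_def)
    let ?H = "({..<k}, {e. e \<subseteq> {..<k} \<and> h ` e \<in> edges G}) :: graph"
    have sH: "simple_graph ?H"
    proof -
      have "card e = 2" if "e \<subseteq> {..<k}" "h ` e \<in> edges G" for e
        using GE[OF that(2)] card_image[OF inj_on_subset[OF inj that(1)]] by simp
      then show ?thesis by (auto simp: simple_graph_def)
    qed
    have sA: "simple_graph (induced_subgraph G A)"
      using finA GE by (auto simp: simple_graph_def induced_subgraph_def)
    have "(\<lambda>e. h ` e) ` edges ?H = edges (induced_subgraph G A)"
    proof (intro equalityI subsetI)
      fix e assume "e \<in> edges (induced_subgraph G A)"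
      then have e: "e \<in> edges G" "e \<subseteq> h ` {..<k}" using im by (auto simp: induced_subgraph_def)
      then obtain e' where "e' \<subseteq> {..<k}" "e = h ` e'" by (auto simp: subset_image_iff)
      then show "e \<in> (\<lambda>e. h ` e) ` edges ?H" using e(1) by auto
    qed (use im in \<open>auto simp: induced_subgraph_def\<close>)
    then have "graph_iso ?H (induced_subgraph G A)"
      unfolding graph_iso_def using h by (intro exI[of _ h]) (simp add: induced_subgraph_def)
    then have "\<Phi> ?H = \<Phi> (induced_subgraph G A)"
      using iso sH sA unfolding iso_invariant_def by blast
    moreover have "cover_sum \<tau> k \<omega> {..<k} (graph_adj ?H) = cover_sum \<tau> k \<omega> A (graph_adj G)"
      by (rule cover_sum_iso[OF h]) auto
    ultimately show ?thesis using H[OF sH] by simp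
  qed
  then show ?thesis
    using False fin by (simp add: cover_sum_subsets ind_sub_def sum_distrib_left)
qed

lemma graph_code_mat_list:
  assumes "graph_code G y"
  obtains vs where "distinct vs" "set vs = verts G"
    "y = mat_list (length vs) (\<lambda>u v. of_bool ({vs ! u, vs ! v} \<in> edges G))"
proof -
  obtain vs where vs: "distinct vs" "set vs = verts G"
    "y = length vs # concat (map (\<lambda>u. map (\<lambda>v. of_bool ({u, v} \<in> edges G)) vs) vs)"
    using assms by (auto simp: graph_code_def)
  have r: "map f vs = map (\<lambda>v. f (vs ! v)) [0..<length vs]" for f :: "nat \<Rightarrow> nat"
    using arg_cong[OF map_nth[of vs], of "map f"] by (simp add: o_def)
  have c: "map f vs = map (\<lambda>v. f (vs ! v)) [0..<length vs]" for f :: "nat \<Rightarrow> nat list"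
    using arg_cong[OF map_nth[of vs], of "map f"] by (simp add: o_def)
  have "map (\<lambda>u. map (\<lambda>v. of_bool ({u, v} \<in> edges G)) vs) vs =
    map (\<lambda>u. map (\<lambda>v. of_bool ({vs ! u, vs ! v} \<in> edges G) :: nat) [0..<length vs]) [0..<length vs]"
    by (subst c, rule map_cong, rule refl, rule r)
  then have "y = mat_list (length vs) (\<lambda>u v. of_bool ({vs ! u, vs ! v} \<in> edges G))"
    unfolding vs(3) mat_list_def by simp
  then show ?thesis using that vs(1,2) by blast
qed

lemma cell_adj_mat_list:
  assumes "u < n" "v < n"
  shows "cell_adj (k # mat_list n f) n u v \<longleftrightarrow> f u v \<noteq> 0"
  using assms by (simp add: cell_adj_def input_cell_Cons mat_list_cell)

lemma count_val_graph:
  fixes k :: nat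
  assumes vs: "distinct vs" "set vs = verts G"
  defines "n \<equiv> length vs"
  defines "x \<equiv> k # mat_list n (\<lambda>u v. of_bool ({vs ! u, vs ! v} \<in> edges G))"
  shows "of_nat (count_val 1 \<tau> k x n N) - of_nat (count_val 2 \<tau> k x n N) =
    cover_sum \<tau> k (coeff (digits (2 * \<tau> + 2) N)) (verts G) (graph_adj G)"
  unfolding count_val_eq_cover_sum
proof (rule cover_sum_iso)
  show "bij_betw (nth vs) {..<n} (verts G)"
    by (rule bij_betw_nth) (use vs in \<open>auto simp: n_def\<close>)
  show "cell_adj x n u v = ({vs ! u, vs ! v} \<in> edges G)" if "u \<in> {..<n}" "v \<in> {..<n}" for u v
    using that by (simp add: x_def cell_adj_mat_list)
qed

definition bit_graph :: "nat \<Rightarrow> nat \<Rightarrow> graph" where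
  "bit_graph h k = ({..<k}, {e. \<exists>u v. e = {u, v} \<and> v < u \<and> u < k \<and> odd (h div 2 ^ (u * k + v))})"

lemma simple_bit_graph: "simple_graph (bit_graph h k)"
  by (auto simp: simple_graph_def bit_graph_def)

lemma bit_graph_edge:
  assumes "u < k" "v < k"
  shows "of_bool ({u, v} \<in> edges (bit_graph h k)) = bit_mat h k u v"
  using assms by (cases u v rule: linorder_cases)
    (auto simp: bit_graph_def bit_mat_def doubleton_eq_iff odd_iff_mod_2_eq_one)

lemma bit_graph_mat_list:
  "mat_list k (\<lambda>u v. of_bool ({[0..<k] ! u, [0..<k] ! v} \<in> edges (bit_graph h k))) = mat_list k (bit_mat h k)"
  unfolding mat_list_def by (intro arg_cong2[of _ _ _ _ "(#)"] arg_cong[of _ _ concat] refl map_cong)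
    (simp_all add: bit_graph_edge)

lemma graph_code_bit_graph: "graph_code (bit_graph h k) (mat_list k (bit_mat h k))"
  unfolding graph_code_def
proof (intro exI[of _ "[0..<k]"] conjI)
  show "mat_list k (bit_mat h k) = length [0..<k] #
      concat (map (\<lambda>u. map (\<lambda>v. of_bool ({u, v} \<in> edges (bit_graph h k))) [0..<k]) [0..<k])"
    unfolding mat_list_def length_upt diff_zero
    by (intro arg_cong2[of _ _ _ _ "(#)"] arg_cong[of _ _ concat] refl map_cong)
      (simp_all add: bit_graph_edge)
qed (auto simp: bit_graph_def)

text \<open>All \<open>k * k\<close> adjacency bits of \<open>H\<close> are put into
  \<open>h\<close>; \<open>bit_graph\<close> reads only those below the diagonal, which is enough as
  edges are unordered.\<close>

lemma bit_graph_surj: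
  assumes H: "simple_graph H" "verts H = {..<k}"
  obtains h where "h < 2 ^ (k * k)" "H = bit_graph h k"
proof -
  let ?b = "\<lambda>j. {j div k, j mod k} \<in> edges H"
  define h :: nat where "h = (\<Sum>j<k * k. 2 ^ j * of_bool (?b j))"
  have "h < 2 ^ (k * k)" unfolding h_def by (rule sum_bits_less)
  moreover have bit: "odd (h div 2 ^ (u * k + v)) \<longleftrightarrow> {u, v} \<in> edges H" if "u < k" "v < k" for u v
    unfolding h_def odd_sum_bits[OF cell_less[OF that]] cell_div_mod[OF that(2)] ..
  have "edges H = edges (bit_graph h k)"
  proof (intro equalityI subsetI)
    fix e assume e: "e \<in> edges H"
    then have "card e = 2" "e \<subseteq> {..<k}" using H by (auto simp: simple_graph_def)
    then obtain u v where uv: "e = {u, v}" "u \<noteq> v" "u < k" "v < k" by (auto simp: card_2_iff)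
    then show "e \<in> edges (bit_graph h k)"
      using e bit[of u v] bit[of v u] unfolding bit_graph_def
      by (cases u v rule: linorder_cases) (auto simp: insert_commute)
  qed (auto simp: bit_graph_def bit)
  then have "H = bit_graph h k" using H(2) by (simp add: prod_eq_iff bit_graph_def)
  ultimately show ?thesis using that by blast
qed

section \<open>Running the programs\<close>

lemma no_read_sim: "no_read (sim P)"
proof -
  have i: "no_read (sim_instr i)" for i
    by (cases i) (auto simp: sim_get_def sim_set_def sim_put_def)
  have "no_read (dispatch j P)" for j
    by (induction P arbitrary: j) (auto simp: i)
  then show ?thesis by (simp add: sim_def sim_step_def)
qed

lemma no_read_search: "no_read (search P P')"
  by (simp add: search_def check_def fill_def fill_step_def fill_bit_def fill_next_def sim_call_def sim_get_def
      sim_set_def sim_put_def no_read_sim compare_def mul_def)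

section \<open>A clock for the first phase\<close>

definition clock_prog :: "instr list \<Rightarrow> com" where
  "clock_prog P = Op (Read 30 1) ;; Op (Const 59 0) ;; Op (Add 100 30 59) ;; Op (Const 14 100) ;;
     Op (Const 13 1) ;; Op (Const 11 102) ;; Op (Const 12 102) ;; sim P ;; sim_get 40 31 ;; Op (Add 0 40 21)"

text \<open>The value \<open>f k\<close> adds the simulated register 31, where the search leaves its
  code, to the number of simulated steps, so that it bounds both. No a priori bound for the search
  is needed. In \<open>clock_prog\<close>, \<open>Read 30 1\<close> fetches input cell 0 because
  register 1 is still 0.\<close>

lemma computable_clock:
  assumes "\<And>k. (ram_step P [k] ^^ t k) (0, \<lambda>_. 0) = (pc k, R k) \<and> length P \<le> pc k"
  obtains f where "computable_function f"
    "\<And>k. \<exists>s. (ram_step P [k] ^^ s) (0, \<lambda>_. 0) = (pc k, R k) \<and> f k = R k 31 + s"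
proof -
  have "\<exists>s. (ram_step P [k] ^^ s) (0, \<lambda>_. 0) = (pc k, R k) \<and>
    (\<exists>t' R'. halts_within (compile 0 (clock_prog P)) [k] t' R' \<and> R' 0 = R k 31 + s)" for k
  proof -
    obtain s where s: "(ram_step P [k] ^^ s) (0, \<lambda>_. 0) = (pc k, R k)"
      "\<And>y Q M. sim_state [k] (\<lambda>_. 0) M \<Longrightarrow>
        (\<And>M'. sim_state [k] (R k) M' \<Longrightarrow> sim_frame M M' \<Longrightarrow> M' 21 = s \<Longrightarrow> Q M') \<Longrightarrow> wp y (sim P) (\<lambda>_. Q) M"
      using wp_sim[OF conjunct1[OF assms[of k]] conjunct2[OF assms[of k]]] by metis
    let ?M = "(\<lambda>_. 0::nat)(30 := k, 59 := 0, 100 := k, 14 := 100, 13 := 1, 11 := 102, 12 := 102)"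
    have "sim_state [k] (\<lambda>_. 0) ?M"
      by (auto simp: sim_state_def input_cell_def le_Suc_eq)
    then have "wp [k] (sim P) (\<lambda>_. wp [k] (sim_get 40 31) (\<lambda>_ R'. R' 40 + R' 21 = R k 31 + s)) ?M"
    proof (rule s(2))
      fix M' assume M': "sim_state [k] (R k) M'" "M' 21 = s"
      show "wp [k] (sim_get 40 31) (\<lambda>_ R'. R' 40 + R' 21 = R k 31 + s) M'"
        using M' by (simp add: wp_sim_get[OF M'(1)])
    qed
    then have "wp [k] (clock_prog P) (\<lambda>_ R'. R' 0 = R k 31 + s) (\<lambda>_. 0)"
      by (simp add: clock_prog_def input_cell_def)
    then show ?thesis using s(1) halts_within_compile unfolding wp_def by blast
  qed
  then obtain s where s: "\<And>k. (ram_step P [k] ^^ s k) (0, \<lambda>_. 0) = (pc k, R k)"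
    "\<And>k. \<exists>t' R'. halts_within (compile 0 (clock_prog P)) [k] t' R' \<and> R' 0 = R k 31 + s k" by metis
  show ?thesis
    by (rule that[of "\<lambda>k. R k 31 + s k"]) (use s in \<open>auto simp: computable_function_def\<close>)
qed


definition phase1 :: "nat \<Rightarrow> instr list \<Rightarrow> com" where
  "phase1 \<tau> P = Op (Read 30 1) ;; search P (compile 0 (count_prog \<tau>))"

lemma outputs_count_prog:
  "outputs (compile 0 (count_prog \<tau>)) (k # mat_list k f) N
    (count_val 1 \<tau> k (k # mat_list k f) k N, count_val 2 \<tau> k (k # mat_list k f) k N, denom \<tau> N)"
proof -
  let ?x = "k # mat_list k f"
  have "wp ?x (count_prog \<tau>) (\<lambda>_ R. R 0 = count_val 1 \<tau> k ?x k N \<and> R 1 = count_val 2 \<tau> k ?x k N \<and>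
      R 2 = denom \<tau> N) ((\<lambda>_. 0)(31 := N))"
    by (rule wp_count_prog[where k = k and n = k and N = N]) (simp_all add: input_cell_Cons mat_list_cell)
  then obtain t R where e: "exec ?x (count_prog \<tau>) ((\<lambda>_. 0)(31 := N)) t R"
    and R: "R 0 = count_val 1 \<tau> k ?x k N" "R 1 = count_val 2 \<tau> k ?x k N" "R 2 = denom \<tau> N"
    unfolding wp_def by blast
  have "(ram_step (compile 0 (count_prog \<tau>)) ?x ^^ t) (0, (\<lambda>_. 0)(31 := N)) = (csize (count_prog \<tau>), R)"
    using compile_exec[OF e, of _ "[]" "[]"] by (simp add: run_below_def)
  then show ?thesis unfolding outputs_def R[symmetric] by (intro exI conjI) auto
qed

lemma agree_iff:
  assumes "p2 \<noteq> 0"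
  shows "agree (p0, p1, p2) (c0, c1, c2) \<longleftrightarrow> c2 \<noteq> 0 \<and>
    (of_nat c0 - of_nat c1 :: rat) = of_nat c2 * ((of_nat p0 - of_nat p1) / of_nat p2)"
proof -
  have "p0 * c2 + c1 * p2 = c0 * p2 + p1 * c2 \<longleftrightarrow>
    (of_nat (p0 * c2 + c1 * p2) :: rat) = of_nat (c0 * p2 + p1 * c2)" by (simp only: of_nat_eq_iff)
  also have "\<dots> \<longleftrightarrow> (of_nat c0 - of_nat c1 :: rat) = of_nat c2 * ((of_nat p0 - of_nat p1) / of_nat p2)"
    using assms by (auto simp: field_simps)
  finally show ?thesis by (simp add: agree_def)
qed

lemma phase1_correct:
  assumes iso: "iso_invariant \<Phi>"
    and P: "\<And>G x. simple_graph G \<Longrightarrow> graph_code G x \<Longrightarrow> \<exists>t R. halts_within P x t R \<and> rat_output R (\<Phi> G)"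
    and ae: "\<And>G. simple_graph G \<Longrightarrow> vertex_cover_number G > \<tau> \<Longrightarrow> alternating_enumerator \<Phi> G = 0"
  shows "\<exists>t R. exec [k] (phase1 \<tau> P) (\<lambda>_. 0) t R \<and> denom \<tau> (R 31) \<noteq> 0 \<and>
    (\<forall>G. simple_graph G \<longrightarrow> cover_sum \<tau> k (coeff (digits (2 * \<tau> + 2) (R 31))) (verts G) (graph_adj G)
      = of_nat (denom \<tau> (R 31)) * ind_sub \<Phi> k G)"
proof -
  let ?C = "\<lambda>N V E. cover_sum \<tau> k (coeff (digits (2 * \<tau> + 2) N)) V E"
  let ?x = "\<lambda>h. mat_list k (bit_mat h k)"
  define c where "c N h = (count_val 1 \<tau> k (k # ?x h) k N, count_val 2 \<tau> k (k # ?x h) k N, denom \<tau> N)" for N h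
  have "\<exists>p0 p1 p2. outputs P (?x h) 0 (p0, p1, p2) \<and> p2 \<noteq> 0 \<and>
      \<Phi> (bit_graph h k) = (of_nat p0 - of_nat p1) / of_nat p2" for h
  proof -
    obtain t R pc where "(ram_step P (?x h) ^^ t) (0, \<lambda>_. 0) = (pc, R)" "length P \<le> pc" "rat_output R (\<Phi> (bit_graph h k))"
      using P[OF simple_bit_graph graph_code_bit_graph] unfolding halts_within_def by blast
    moreover have "(\<lambda>_. 0)(31 := 0) = (\<lambda>_ :: nat. 0 :: nat)" by (simp add: fun_eq_iff)
    ultimately have "outputs P (?x h) 0 (R 0, R 1, R 2)" "rat_output R (\<Phi> (bit_graph h k))"
      unfolding outputs_def by auto
    then show ?thesis unfolding rat_output_def by blast
  qed
  then obtain p0 p1 p2 where p: "\<And>h. outputs P (?x h) 0 (p0 h, p1 h, p2 h)" "\<And>h. p2 h \<noteq> 0"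
    "\<And>h. \<Phi> (bit_graph h k) = (of_nat (p0 h) - of_nat (p1 h)) / of_nat (p2 h)" by metis
  have agr: "agree (p0 h, p1 h, p2 h) (c N h) \<longleftrightarrow> denom \<tau> N \<noteq> 0 \<and>
    ?C N {..<k} (graph_adj (bit_graph h k)) = of_nat (denom \<tau> N) * \<Phi> (bit_graph h k)" for N h
  proof -
    have "of_nat (count_val 1 \<tau> k (k # ?x h) k N) - of_nat (count_val 2 \<tau> k (k # ?x h) k N) =
        ?C N {..<k} (graph_adj (bit_graph h k))"
      using count_val_graph[of "[0..<k]" "bit_graph h k" \<tau> k N]
      by (simp add: bit_graph_mat_list del: nth_upt) (simp add: bit_graph_def atLeast0LessThan)
    then show ?thesis unfolding c_def agree_iff[OF p(2)] p(3) by simp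
  qed
  obtain \<omega> where \<omega>: "\<And>H. simple_graph H \<Longrightarrow> verts H = {..<k} \<Longrightarrow>
    cover_sum \<tau> k \<omega> {..<k} (graph_adj H) = \<Phi> H"
    using cover_sum_weights_exist[OF iso ae] by metis
  \<comment> \<open>Every word that occurs in \<open>cover_sum\<close> has length \<open>k\<close>
    and letters below \<open>2 ^ (2 * \<tau>)\<close>, so only finitely many weights have to be
    matched by a code.\<close>
  let ?X = "tuples k {..<2 ^ (2 * \<tau>)} :: nat list set"
  have fX: "finite ?X" by (rule finite_tuples) simp
  have lX: "t < 2 ^ (2 * \<tau>)" if "w \<in> ?X" "t \<in> set w" for w t using that by (auto simp: tuples_def)
  have ex: "\<exists>N. 0 < denom \<tau> N \<and> (\<forall>w\<in>?X. coeff (digits (2 * \<tau> + 2) N) w = of_nat (denom \<tau> N) * \<omega> w)"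
    by (rule coeff_exists[OF fX]) (rule lX)
  obtain G where G: "0 < denom \<tau> G" "\<And>w. w \<in> ?X \<Longrightarrow> coeff (digits (2 * \<tau> + 2) G) w = of_nat (denom \<tau> G) * \<omega> w"
    using ex by blast
  have "?C G {..<k} E = of_nat (denom \<tau> G) * cover_sum \<tau> k \<omega> {..<k} E" for E :: "nat \<Rightarrow> nat \<Rightarrow> bool"
  proof -
    define q where "q = coeff (digits (2 * \<tau> + 2) G)"
    have q: "q w = of_nat (denom \<tau> G) * \<omega> w" if "length w = k" "set w \<subseteq> {..<2 ^ (2 * \<tau>)}" for w
      using G(2)[of w] that by (simp add: q_def tuples_def)
    have "q (map (vtype \<tau> E (nth al)) vs) = of_nat (denom \<tau> G) * \<omega> (map (vtype \<tau> E (nth al)) vs)"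
      if "(al, vs) \<in> cover_pairs \<tau> k {..<k}" for al vs
      by (rule q) (use that in \<open>auto simp: cover_pairs_def vtype_less\<close>)
    then show ?thesis
      unfolding q_def[symmetric] cover_sum_def using q[of "[]"]
      by (auto simp: sum_distrib_left intro!: sum.cong)
  qed
  then have good: "agree (p0 h, p1 h, p2 h) (c G h)" for h
    using \<omega>[OF simple_bit_graph] G(1) by (simp add: agr bit_graph_def)
  have "wp [k] (phase1 \<tau> P) (\<lambda>_ R. \<forall>h \<le> 2 ^ (k * k). agree (p0 h, p1 h, p2 h) (c (R 31) h)) (\<lambda>_. 0)"
    unfolding phase1_def wp_Seq wp_ops
  proof (rule wp_search[where k = k and p = "\<lambda>h. (p0 h, p1 h, p2 h)" and c = c and G = G])
    show "outputs (compile 0 (count_prog \<tau>)) (k # ?x h) N (c N h)" for h N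
      unfolding c_def by (rule outputs_count_prog)
  qed (use p(1) good in \<open>auto simp: input_cell_def\<close>)
  then obtain t R where e: "exec [k] (phase1 \<tau> P) (\<lambda>_. 0) t R"
    and a: "\<And>h. h \<le> 2 ^ (k * k) \<Longrightarrow> agree (p0 h, p1 h, p2 h) (c (R 31) h)" unfolding wp_def by blast
  have D: "denom \<tau> (R 31) \<noteq> 0" using a[of 0] agr by simp
  have "?C (R 31) (verts G) (graph_adj G) = of_nat (denom \<tau> (R 31)) * ind_sub \<Phi> k G"
    if "simple_graph G" for G
  proof (rule ind_sub_cover_sum[OF iso that])
    fix H assume H: "simple_graph H" "verts H = {..<k}"
    obtain h where "h < 2 ^ (k * k)" "H = bit_graph h k" by (rule bit_graph_surj[OF H])
    then show "?C (R 31) {..<k} (graph_adj H) = of_nat (denom \<tau> (R 31)) * \<Phi> H"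
      using a[of h] agr by simp
  qed
  then show ?thesis using e D by blast
qed

lemma exec_phase1_input:
  assumes "exec [k] (phase1 \<tau> P) (\<lambda>_. 0) t R"
  shows "exec (k # y) (phase1 \<tau> P) (\<lambda>_. 0) t R"
proof -
  obtain t1 t2 R1 where e: "exec [k] (Op (Read 30 1)) (\<lambda>_. 0) t1 R1"
    "exec [k] (search P (compile 0 (count_prog \<tau>))) R1 t2 R" "t = t1 + t2"
    using assms unfolding phase1_def by (auto elim: exec_SeqE)
  have R1: "t1 = Suc 0" "R1 = snd (exec_instr (k # y) (Read 30 1) (0, \<lambda>_. 0))"
    using e(1) by (auto elim!: exec_OpE simp: input_cell_def)
  have "exec (k # y) (Op (Read 30 1)) (\<lambda>_. 0) t1 R1" unfolding R1 by (rule exec.Op) simp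
  then show ?thesis
    unfolding phase1_def e(3) using exec_no_read[OF e(2) no_read_search] exec.Seq by blast
qed

lemma exec_pos: "exec x c R t R' \<Longrightarrow> 0 < t"
  by (induction rule: exec.induct) auto

lemma length_le_input_size: "length x \<le> input_size x"
  unfolding input_size_def by (induction x) auto

theorem theorem5p3:
  fixes \<Phi> :: "graph \<Rightarrow> rat" and \<tau> :: nat
  assumes "graph_parameter \<Phi>"
    and "\<And>G. simple_graph G \<Longrightarrow> vertex_cover_number G > \<tau> \<Longrightarrow> alternating_enumerator \<Phi> G = 0"
  shows "ind_sub_fpt \<Phi> \<and>
    (\<exists>P f C. computable_function f \<and>
       (\<forall>k G x. ind_sub_code (k, G) x \<longrightarrow>
          (\<exists>t R. halts_within P x t R \<and> rat_output R (ind_sub \<Phi> k G) \<and>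
             (verts G \<noteq> {} \<longrightarrow> t \<le> C * (f k * card (verts G) ^ (\<tau> + 1))))))"
proof -
  have iso: "iso_invariant \<Phi>" using assms(1) by (simp add: graph_parameter_def)
  obtain P where P: "\<And>G x. simple_graph G \<Longrightarrow> graph_code G x \<Longrightarrow> \<exists>t R. halts_within P x t R \<and> rat_output R (\<Phi> G)"
    using assms(1) unfolding graph_parameter_def computable_on_graphs_def by blast
  define good where "good k t R \<longleftrightarrow> exec [k] (phase1 \<tau> P) (\<lambda>_. 0) t R \<and> denom \<tau> (R 31) \<noteq> 0 \<and>
    (\<forall>G. simple_graph G \<longrightarrow> cover_sum \<tau> k (coeff (digits (2 * \<tau> + 2) (R 31))) (verts G) (graph_adj G)
      = of_nat (denom \<tau> (R 31)) * ind_sub \<Phi> k G)" for k t R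
  have "\<exists>t R. good k t R" for k
    unfolding good_def by (rule phase1_correct[OF iso]) (rule P assms(2); assumption)+
  then obtain t1 R1 where "\<And>k. good k (t1 k) (R1 k)" by metis
  then have ph: "\<And>k. exec [k] (phase1 \<tau> P) (\<lambda>_. 0) (t1 k) (R1 k)"
    "\<And>k. denom \<tau> (R1 k 31) \<noteq> 0"
    "\<And>k G. simple_graph G \<Longrightarrow> cover_sum \<tau> k (coeff (digits (2 * \<tau> + 2) (R1 k 31))) (verts G) (graph_adj G)
      = of_nat (denom \<tau> (R1 k 31)) * ind_sub \<Phi> k G"
    unfolding good_def by blast+
  let ?P1 = "compile 0 (phase1 \<tau> P)" and ?F = "phase1 \<tau> P ;; count_prog \<tau>"
  have run: "(ram_step ?P1 [k] ^^ t1 k) (0, \<lambda>_. 0) = (csize (phase1 \<tau> P), R1 k) \<and> length ?P1 \<le> csize (phase1 \<tau> P)" for k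
    using compile_exec[OF ph(1), of _ "[]" "[]"] by (simp add: run_below_def)
  obtain f where f: "computable_function f"
    "\<And>k. \<exists>s. (ram_step ?P1 [k] ^^ s) (0, \<lambda>_. 0) = (csize (phase1 \<tau> P), R1 k) \<and> f k = R1 k 31 + s"
    by (rule computable_clock[where P = ?P1 and t = t1 and pc = "\<lambda>_. csize (phase1 \<tau> P)" and R = R1, OF run])
      (rule that)
  have fk: "R1 k 31 + t1 k \<le> f k" for k
  proof -
    obtain s where s: "(ram_step ?P1 [k] ^^ s) (0, \<lambda>_. 0) = (csize (phase1 \<tau> P), R1 k)" "f k = R1 k 31 + s"
      using f(2) by blast
    \<comment> \<open>Before step \<open>t1 k\<close> the program counter lies inside the program,
      so a step count at which the halted configuration is seen is at least
      \<open>t1 k\<close>.\<close>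
    have "\<not> s < t1 k"
      using compile_exec[OF ph(1), of ?P1 "[]" "[]" k] s(1) by (auto simp: run_below_def)
    then show ?thesis using s(2) by simp
  qed
  define c where "c = count_const \<tau> + 1"
  \<comment> \<open>The base is the number of vertices plus 1, so that the estimate also covers the
    graph without vertices, which the tractability claim includes.\<close>
  have main: "\<exists>t R. halts_within (compile 0 ?F) x t R \<and> rat_output R (ind_sub \<Phi> k G) \<and>
      t \<le> c * (f k * (card (verts G) + 1) ^ (\<tau> + 1)) \<and> card (verts G) + 1 \<le> input_size x \<and> 2 \<le> input_size x"
    if code: "ind_sub_code (k, G) x" for k G x
  proof -
    obtain y where G: "simple_graph G" and y: "graph_code G y" "x = k # y"
      using code by (auto simp: ind_sub_code_def)
    obtain vs where vs: "distinct vs" "set vs = verts G"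
      "y = mat_list (length vs) (\<lambda>u v. of_bool ({vs ! u, vs ! v} \<in> edges G))"
      using graph_code_mat_list[OF y(1)] by metis
    let ?n = "length vs" and ?N = "R1 k 31"
    have n: "card (verts G) = ?n" using vs(1,2) distinct_card by metis
    have "wp x (count_prog \<tau>) (\<lambda>t R. t \<le> count_const \<tau> * ((?N + 1) * (?n + 1) ^ (\<tau> + 1)) \<and>
      R 0 = count_val 1 \<tau> k x ?n ?N \<and> R 1 = count_val 2 \<tau> k x ?n ?N \<and> R 2 = denom \<tau> ?N) (R1 k)"
    proof (rule wp_count_prog[where k = k and n = ?n and N = ?N], goal_cases)
      case (4 t R)
      then show ?case using order.trans[OF 4(1) count_time] by blast
    qed (simp_all add: y(2) vs(3) input_cell_Cons mat_list_cell)
    then obtain t2 R where e2: "exec x (count_prog \<tau>) (R1 k) t2 R"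
      and t2: "t2 \<le> count_const \<tau> * ((?N + 1) * (?n + 1) ^ (\<tau> + 1))"
      and R: "R 0 = count_val 1 \<tau> k x ?n ?N" "R 1 = count_val 2 \<tau> k x ?n ?N" "R 2 = denom \<tau> ?N"
      unfolding wp_def by blast
    have "exec x ?F (\<lambda>_. 0) (t1 k + t2) R"
      using exec_phase1_input[OF ph(1)] e2 y(2) by (auto intro: exec.Seq)
    then have h: "halts_within (compile 0 ?F) x (t1 k + t2) R" by (rule halts_within_compile)
    have "of_nat (R 0) - of_nat (R 1) = of_nat (denom \<tau> ?N) * ind_sub \<Phi> k G"
      unfolding R y(2) vs(3) count_val_graph[OF vs(1,2)] ph(3)[OF G] ..
    then have out: "rat_output R (ind_sub \<Phi> k G)"
      using ph(2)[of k] R(3) by (simp add: rat_output_def)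
    \<comment> \<open>A run takes at least one step, which pays for the summand 1.\<close>
    have N1: "?N + 1 \<le> f k" using fk[of k] exec_pos[OF ph(1), of k] by simp
    have "t1 k \<le> f k * (?n + 1) ^ (\<tau> + 1)"
      using fk[of k] by (metis (no_types, lifting) add_leE le_trans mult.right_neutral mult_le_mono2 one_le_power le_add2)
    moreover have "t2 \<le> count_const \<tau> * (f k * (?n + 1) ^ (\<tau> + 1))"
      by (rule order.trans[OF t2]) (intro mult_le_mono le_refl N1)
    ultimately have t: "t1 k + t2 \<le> c * (f k * (?n + 1) ^ (\<tau> + 1))"
      unfolding c_def add_mult_distrib mult_1 by linarith
    have len: "length x = 2 + ?n * ?n" by (simp add: y(2) vs(3))
    have "?n \<le> ?n * ?n" by (cases ?n) auto
    then have "?n + 1 \<le> length x" "2 \<le> length x" unfolding len by linarith+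
    then have "?n + 1 \<le> input_size x" "2 \<le> input_size x"
      using length_le_input_size[of x] by linarith+
    then show ?thesis using h out t unfolding n by blast
  qed
  have "ind_sub_fpt \<Phi>"
    unfolding ind_sub_fpt_def fixed_parameter_tractable_def
  proof (rule exI[of _ "compile 0 ?F"], rule exI[of _ f], rule exI[of _ "c + (\<tau> + 1)"], intro conjI allI impI f(1))
    fix a x assume a: "ind_sub_code a x"
    obtain k G where kG: "a = (k, G)" by (rule prod.exhaust)
    from a main obtain t R where h: "halts_within (compile 0 ?F) x t R" "rat_output R (ind_sub \<Phi> k G)"
      and t: "t \<le> c * (f k * (card (verts G) + 1) ^ (\<tau> + 1))"
      and i: "card (verts G) + 1 \<le> input_size x" "2 \<le> input_size x"
      unfolding kG by blast
    \<comment> \<open>The definition of tractability has no constant factor. As the input has size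
      at least 2, \<open>c\<close> can be moved into the exponent.\<close>
    have "c \<le> 2 ^ c" by (simp add: less_imp_le)
    also have "\<dots> \<le> input_size x ^ c" using i(2) by (intro power_mono) auto
    finally have "c * (f k * (card (verts G) + 1) ^ (\<tau> + 1)) \<le> input_size x ^ c * (f k * input_size x ^ (\<tau> + 1))"
      using i(1) by (intro mult_le_mono le_refl power_mono) auto
    also have "\<dots> = f k * input_size x ^ (c + (\<tau> + 1))" by (simp only: power_add ac_simps)
    finally have "t \<le> f k * input_size x ^ (c + (\<tau> + 1))" using t by (rule order.trans[rotated])
    then show "\<exists>R. halts_within (compile 0 ?F) x (f (fst a) * input_size x ^ (c + (\<tau> + 1))) R \<and>
        rat_output R (case a of (k, G) \<Rightarrow> ind_sub \<Phi> k G)"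
      using halts_within_mono[OF h(1)] h(2) unfolding kG by auto
  qed
  moreover have "\<exists>t R. halts_within (compile 0 ?F) x t R \<and> rat_output R (ind_sub \<Phi> k G) \<and>
      (verts G \<noteq> {} \<longrightarrow> t \<le> c * 2 ^ (\<tau> + 1) * (f k * card (verts G) ^ (\<tau> + 1)))"
    if code: "ind_sub_code (k, G) x" for k G x
  proof -
    obtain t R where h: "halts_within (compile 0 ?F) x t R" "rat_output R (ind_sub \<Phi> k G)"
      and t: "t \<le> c * (f k * (card (verts G) + 1) ^ (\<tau> + 1))"
      using main[OF code] by blast
    have "t \<le> c * 2 ^ (\<tau> + 1) * (f k * card (verts G) ^ (\<tau> + 1))" if "verts G \<noteq> {}"
    proof -
      have "finite (verts G)" using code by (auto simp: ind_sub_code_def simple_graph_def)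
      then have "0 < card (verts G)" using that by (simp add: card_gt_0_iff)
      \<comment> \<open>For at least one vertex the base \<open>n + 1\<close> is at most
        \<open>2 * n\<close>; the resulting \<open>2 ^ (\<tau> + 1)\<close> goes into the
        constant.\<close>
      then have "(card (verts G) + 1) ^ (\<tau> + 1) \<le> (2 * card (verts G)) ^ (\<tau> + 1)" by (intro power_mono) auto
      then have "c * (f k * (card (verts G) + 1) ^ (\<tau> + 1)) \<le> c * (f k * (2 * card (verts G)) ^ (\<tau> + 1))"
        by (intro mult_le_mono le_refl)
      also have "\<dots> = c * 2 ^ (\<tau> + 1) * (f k * card (verts G) ^ (\<tau> + 1))" by (simp only: power_mult_distrib ac_simps)
      finally show ?thesis using t by (rule order.trans[rotated])
    qed
    then show ?thesis using h by blast
  qed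
  ultimately show ?thesis using f(1) by blast
qed

end
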